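(* Let $T$ be a locally finite, rooted tree with root $o$ and forward degrees $\ge2$. Consider a transient nearest neighbour random walk on $T$ that satisfies $$F(v,v^-)<1\quad\text{for every }v\in T\setminus\{o\}\qquad\text{and}\qquad\lim_{v\to\infty}G(v,o)=0 .$$ Then the boundary process on $\partial T$, i.e. the process induced by the Dirichlet form $\mathcal{E}_{\mathcal{HD}}$, coincides with the standard process on $\partial T$ associated with the ultra-metric element $\phi=G(\cdot,o)$ and the limit distribution $\nu_o$ of the random walk.
   Context: Tree. $v^-$ is the neighbour of $v\ne o$ on the geodesic from $o$ to $v$; the forward degree of $u$ is $\#\{v:v^-=u\}$, assumed finite and $\ge2$ for every $u$. $\partial T$ is the (compact) space of ends of $T$. For $u\in T$, $T_u=\{v:u\in\pi(o,v)\}$ ($\pi(o,v)$ the geodesic) and $\partial T_u$ is the set of ends with a representing ray in $T_u$. For distinct ends $x,y$, $x\wedge y$ is the last common vertex of the rays from $o$ to $x$ and $y$. Random walk. A nearest neighbour random walk $(Z_n)$ has stochastic transition matrix $\mathcal{P}=(p(u,v))$ with $p(u,v)>0$ iff $u\sim v$. $G(u,v)=\sum_{n\ge0}p^{(n)}(u,v)$ is finite (transience), $F(u,v)=\mathbb{P}_u[Z_n=v\text{ for some }n\ge0]$. "$\lim_{v\to\infty}G(v,o)=0$" means that for every $\varepsilon>0$, $G(v,o)<\varepsilon$ for all $v$ outside some finite set. $Z_n$ converges almost surely to a random end $Z_\infty$; $\nu_u(B)=\mathbb{P}_u[Z_\infty\in B]$ for Borel $B\subset\partial T$. Under the first hypothesis,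 $\nu_o$ has full support. Boundary form. Let $\mathsf{m}(o)=1$ and $\mathsf{m}(v)=\prod_{i=1}^k\frac{p(v_{i-1},v_i)}{p(v_i,v_{i-1})}$ if $\pi(o,v)=[v_0,\dots,v_k]$; $a(v^-,v)=\mathsf{m}(v)p(v,v^-)$. For $f,g:T\to\mathbb{R}$, $\mathcal{E}_T(f,g)=\sum_{v\ne o}(f(v)-f(v^-))(g(v)-g(v^-))a(v^-,v)$. For $\varphi\in L^1(\partial T,\nu_o)$ let $h_\varphi(u)=\int_{\partial T}\varphi\,d\nu_u$. Set $\mathcal{D}(\partial T,\mathcal{P})=\{\varphi\in L^1(\partial T,\nu_o):\mathcal{E}_T(h_\varphi,h_\varphi)<\infty\}$ and $\mathcal{E}_{\mathcal{HD}}(\varphi,\psi)=\mathcal{E}_T(h_\varphi,h_\psi)$ for $\varphi,\psi$ in it. The boundary process is the symmetric Markov process on $\partial T$ determined by this Dirichlet form on $L^2(\partial T,\nu_o)$. Standard process. An ultra-metric element is a function $\phi:T\to(0,\infty)$ with $\phi(v)<\phi(v^-)$ for $v\ne o$ and $\phi(v_n)\to0$ along every geodesic ray; it induces the ultra-metric $d_\phi(x,y)=\phi(x\wedge y)$ for $x\ne y$, $d_\phi(x,x)=0$, on $\partial T$, whose closed balls are the sets $\partial T_u$. Given a fully supported probability measure $\mu$ on $\partial T$, the standard process associated with $(\phi,\mu)$ is the symmetric Markov process with semigroup $P^t=\int_{[0,\infty)}\mathrm{Q}_r\,d\sigma_*^t(r)$, $\sigma_*(r)=e^{-1/r}$, where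 $\mathrm{Q}_rf(x)=\frac1{\mu(B_r(x))}\int_{B_r(x)}f\,d\mu$ and $B_r(x)$ is the closed $d_\phi$-ball. Its Dirichlet form on $L^2(\partial T,\mu)$ is $\mathcal{E}(f,g)=\frac12\iint(f(x)-f(y))(g(x)-g(y))J(x,y)\,d\mu(x)d\mu(y)$ with domain $\{f\in L^2:\mathcal{E}(f,f)<\infty\}$, where $J(x,y)=\int_0^{1/d_\phi(x,y)}\frac{d\tau}{\mu(B_{1/\tau}(x))}$. Two processes coincide if they have the same Dirichlet form (equivalently, the same transition semigroup). Part of the assertion is that $\phi=G(\cdot,o)$ is an ultra-metric element. *)

theory Defs
  imports "HOL-Probability.Probability"
begin

text \<open>
  The vertex set of the tree is the whole type \<open>'v\<close>; \<open>adj\<close> is the edge relation and \<open>rt\<close> the root.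
\<close>

definition simple_path :: "('v \<Rightarrow> 'v \<Rightarrow> bool) \<Rightarrow> 'v \<Rightarrow> 'v \<Rightarrow> 'v list \<Rightarrow> bool" where
  "simple_path adj u v xs \<longleftrightarrow>
     xs \<noteq> [] \<and> hd xs = u \<and> last xs = v \<and> distinct xs \<and> successively adj xs"

definition is_tree :: "('v \<Rightarrow> 'v \<Rightarrow> bool) \<Rightarrow> bool" where
  "is_tree adj \<longleftrightarrow> symp adj \<and> irreflp adj \<and> (\<forall>u v. \<exists>!xs. simple_path adj u v xs)"

definition geodesic :: "('v \<Rightarrow> 'v \<Rightarrow> bool) \<Rightarrow> 'v \<Rightarrow> 'v \<Rightarrow> 'v list" where
  "geodesic adj u v = (THE xs. simple_path adj u v xs)"

text \<open>The vertex \<open>v\<^sup>-\<close>; the value at \<open>v = rt\<close> is irrelevant and never used.\<close>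

definition parent :: "('v \<Rightarrow> 'v \<Rightarrow> bool) \<Rightarrow> 'v \<Rightarrow> 'v \<Rightarrow> 'v" where
  "parent adj rt v = (let xs = geodesic adj rt v in xs ! (length xs - 2))"

definition forward_neighbours :: "('v \<Rightarrow> 'v \<Rightarrow> bool) \<Rightarrow> 'v \<Rightarrow> 'v \<Rightarrow> 'v set" where
  "forward_neighbours adj rt u = {v. v \<noteq> rt \<and> parent adj rt v = u}"

definition subtree :: "('v \<Rightarrow> 'v \<Rightarrow> bool) \<Rightarrow> 'v \<Rightarrow> 'v \<Rightarrow> 'v set" where
  "subtree adj rt u = {v. u \<in> set (geodesic adj rt v)}"

definition geodesic_ray :: "('v \<Rightarrow> 'v \<Rightarrow> bool) \<Rightarrow> (nat \<Rightarrow> 'v) \<Rightarrow> bool" where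
  "geodesic_ray adj x \<longleftrightarrow> inj x \<and> (\<forall>n. adj (x n) (x (Suc n)))"

text \<open>
  An end is an equivalence class of geodesic rays (two rays being equivalent if they have a common
  tail). Each class contains exactly one ray starting at the root, and it is this ray that
  represents the end here. Consequently an end has a representing ray inside the subtree at \<open>u\<close>
  iff some tail of its ray from the root lies in that subtree.
\<close>

definition ends :: "('v \<Rightarrow> 'v \<Rightarrow> bool) \<Rightarrow> 'v \<Rightarrow> (nat \<Rightarrow> 'v) set" where
  "ends adj rt = {x. geodesic_ray adj x \<and> x 0 = rt}"

definition ends_below :: "('v \<Rightarrow> 'v \<Rightarrow> bool) \<Rightarrow> 'v \<Rightarrow> 'v \<Rightarrow> (nat \<Rightarrow> 'v) set" where
  "ends_below adj rt u = {x \<in> ends adj rt. \<exists>N. \<forall>n\<ge>N. x n \<in> subtree adj rt u}"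

definition ends_topology :: "('v \<Rightarrow> 'v \<Rightarrow> bool) \<Rightarrow> 'v \<Rightarrow> (nat \<Rightarrow> 'v) topology" where
  "ends_topology adj rt = topology_generated_by (range (ends_below adj rt))"

definition ends_borel :: "('v \<Rightarrow> 'v \<Rightarrow> bool) \<Rightarrow> 'v \<Rightarrow> (nat \<Rightarrow> 'v) measure" where
  "ends_borel adj rt = sigma (ends adj rt) {U. openin (ends_topology adj rt) U}"

text \<open>The vertex \<open>x \<and> y\<close>, for \<open>x \<noteq> y\<close>.\<close>

definition last_common :: "(nat \<Rightarrow> 'v) \<Rightarrow> (nat \<Rightarrow> 'v) \<Rightarrow> 'v" where
  "last_common x y = x (GREATEST n. x n \<in> range y)"


definition nn_transition_matrix :: "('v \<Rightarrow> 'v \<Rightarrow> bool) \<Rightarrow> ('v \<Rightarrow> 'v \<Rightarrow> real) \<Rightarrow> bool" where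
  "nn_transition_matrix adj p \<longleftrightarrow>
     (\<forall>u v. 0 \<le> p u v) \<and> (\<forall>u. (p u has_sum 1) UNIV) \<and> (\<forall>u v. 0 < p u v \<longleftrightarrow> adj u v)"

text \<open>
  \<open>M u\<close> is the probability \<open>\<bbbP>\<^sub>u\<close>, under which \<open>Z\<close> is the Markov chain with transition matrix \<open>p\<close>
  started at \<open>u\<close>. The last clause (the joint laws of \<open>Z\<^sub>0, \<dots>, Z\<^sub>n\<close>) combines the Markov property
  with \<open>Z\<^sub>0 = u\<close> almost surely.
\<close>

definition markov_chain ::
    "('v \<Rightarrow> 'v \<Rightarrow> real) \<Rightarrow> ('v \<Rightarrow> 'w measure) \<Rightarrow> (nat \<Rightarrow> 'w \<Rightarrow> 'v) \<Rightarrow> bool" where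
  "markov_chain p M Z \<longleftrightarrow>
     (\<forall>u. prob_space (M u) \<and>
          (\<forall>n. Z n \<in> M u \<rightarrow>\<^sub>M count_space UNIV) \<and>
          (\<forall>n x. measure (M u) {\<omega> \<in> space (M u). \<forall>i\<le>n. Z i \<omega> = x i} =
                 of_bool (x 0 = u) * (\<Prod>i<n. p (x i) (x (Suc i)))))"

primrec step_prob :: "('v \<Rightarrow> 'v \<Rightarrow> real) \<Rightarrow> nat \<Rightarrow> 'v \<Rightarrow> 'v \<Rightarrow> real" where
  "step_prob p 0 u v = of_bool (u = v)"
| "step_prob p (Suc n) u v = (\<Sum>\<^sub>\<infinity>w. p u w * step_prob p n w v)"

definition transient :: "('v \<Rightarrow> 'v \<Rightarrow> real) \<Rightarrow> bool" where
  "transient p \<longleftrightarrow> (\<forall>u v. summable (\<lambda>n. step_prob p n u v))"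

definition green :: "('v \<Rightarrow> 'v \<Rightarrow> real) \<Rightarrow> 'v \<Rightarrow> 'v \<Rightarrow> real" where
  "green p u v = (\<Sum>n. step_prob p n u v)"

definition hit_prob :: "('v \<Rightarrow> 'w measure) \<Rightarrow> (nat \<Rightarrow> 'w \<Rightarrow> 'v) \<Rightarrow> 'v \<Rightarrow> 'v \<Rightarrow> real" where
  "hit_prob M Z u v = measure (M u) {\<omega> \<in> space (M u). \<exists>n. Z n \<omega> = v}"

definition converges_to_end ::
    "('v \<Rightarrow> 'v \<Rightarrow> bool) \<Rightarrow> 'v \<Rightarrow> (nat \<Rightarrow> 'v) \<Rightarrow> (nat \<Rightarrow> 'v) \<Rightarrow> bool" where
  "converges_to_end adj rt z x \<longleftrightarrow>
     x \<in> ends adj rt \<and> (\<forall>k. \<forall>\<^sub>F n in sequentially. z n \<in> subtree adj rt (x k))"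

text \<open>
  A trajectory that does not converge is sent to a fixed arbitrary end, so that \<open>Z\<^sub>\<infinity>\<close> is defined
  everywhere; this happens with probability 0.
\<close>

definition limit_end :: "('v \<Rightarrow> 'v \<Rightarrow> bool) \<Rightarrow> 'v \<Rightarrow> (nat \<Rightarrow> 'v) \<Rightarrow> (nat \<Rightarrow> 'v)" where
  "limit_end adj rt z =
     (if \<exists>x. converges_to_end adj rt z x then THE x. converges_to_end adj rt z x
      else SOME x. x \<in> ends adj rt)"

definition limit_distr ::
    "('v \<Rightarrow> 'v \<Rightarrow> bool) \<Rightarrow> 'v \<Rightarrow> ('v \<Rightarrow> 'w measure) \<Rightarrow> (nat \<Rightarrow> 'w \<Rightarrow> 'v) \<Rightarrow> 'v \<Rightarrow> (nat \<Rightarrow> 'v) measure"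
  where
  "limit_distr adj rt M Z u =
     distr (M u) (ends_borel adj rt) (\<lambda>\<omega>. limit_end adj rt (\<lambda>n. Z n \<omega>))"


definition rev_measure :: "('v \<Rightarrow> 'v \<Rightarrow> bool) \<Rightarrow> 'v \<Rightarrow> ('v \<Rightarrow> 'v \<Rightarrow> real) \<Rightarrow> 'v \<Rightarrow> real" where
  "rev_measure adj rt p v =
     (let xs = geodesic adj rt v
      in \<Prod>i<length xs - 1. p (xs ! i) (xs ! Suc i) / p (xs ! Suc i) (xs ! i))"

definition energy_density ::
    "('v \<Rightarrow> 'v \<Rightarrow> bool) \<Rightarrow> 'v \<Rightarrow> ('v \<Rightarrow> 'v \<Rightarrow> real) \<Rightarrow> ('v \<Rightarrow> real) \<Rightarrow> ('v \<Rightarrow> real) \<Rightarrow> 'v \<Rightarrow> real" where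
  "energy_density adj rt p f g v =
     (f v - f (parent adj rt v)) * (g v - g (parent adj rt v)) *
     (rev_measure adj rt p v * p v (parent adj rt v))"

definition tree_form ::
    "('v \<Rightarrow> 'v \<Rightarrow> bool) \<Rightarrow> 'v \<Rightarrow> ('v \<Rightarrow> 'v \<Rightarrow> real) \<Rightarrow> ('v \<Rightarrow> real) \<Rightarrow> ('v \<Rightarrow> real) \<Rightarrow> real" where
  "tree_form adj rt p f g = (\<Sum>\<^sub>\<infinity>v\<in>-{rt}. energy_density adj rt p f g v)"

definition finite_energy ::
    "('v \<Rightarrow> 'v \<Rightarrow> bool) \<Rightarrow> 'v \<Rightarrow> ('v \<Rightarrow> 'v \<Rightarrow> real) \<Rightarrow> ('v \<Rightarrow> real) \<Rightarrow> bool" where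
  "finite_energy adj rt p f \<longleftrightarrow> energy_density adj rt p f f summable_on -{rt}"

text \<open>
  In what follows \<open>\<nu>\<close> is the family of limit distributions. Elements of Lebesgue spaces are given
  by representatives; all the conditions below are invariant under almost everywhere equality.
\<close>

definition poisson :: "('v \<Rightarrow> 'e measure) \<Rightarrow> ('e \<Rightarrow> real) \<Rightarrow> 'v \<Rightarrow> real" where
  "poisson \<nu> \<phi> u = (\<integral>x. \<phi> x \<partial>\<nu> u)"

definition HD_domain ::
    "('v \<Rightarrow> 'v \<Rightarrow> bool) \<Rightarrow> 'v \<Rightarrow> ('v \<Rightarrow> 'v \<Rightarrow> real) \<Rightarrow> ('v \<Rightarrow> 'e measure) \<Rightarrow> ('e \<Rightarrow> real) set" where
  "HD_domain adj rt p \<nu> = {\<phi>. integrable (\<nu> rt) \<phi> \<and> finite_energy adj rt p (poisson \<nu> \<phi>)}"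

definition HD_form ::
    "('v \<Rightarrow> 'v \<Rightarrow> bool) \<Rightarrow> 'v \<Rightarrow> ('v \<Rightarrow> 'v \<Rightarrow> real) \<Rightarrow> ('v \<Rightarrow> 'e measure) \<Rightarrow>
     ('e \<Rightarrow> real) \<Rightarrow> ('e \<Rightarrow> real) \<Rightarrow> real" where
  "HD_form adj rt p \<nu> \<phi> \<psi> = tree_form adj rt p (poisson \<nu> \<phi>) (poisson \<nu> \<psi>)"


definition ultrametric_element :: "('v \<Rightarrow> 'v \<Rightarrow> bool) \<Rightarrow> 'v \<Rightarrow> ('v \<Rightarrow> real) \<Rightarrow> bool" where
  "ultrametric_element adj rt \<phi> \<longleftrightarrow>
     (\<forall>v. 0 < \<phi> v) \<and> (\<forall>v. v \<noteq> rt \<longrightarrow> \<phi> v < \<phi> (parent adj rt v)) \<and>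
     (\<forall>x. geodesic_ray adj x \<longrightarrow> (\<lambda>n. \<phi> (x n)) \<longlonglongrightarrow> 0)"

definition end_dist :: "('v \<Rightarrow> real) \<Rightarrow> (nat \<Rightarrow> 'v) \<Rightarrow> (nat \<Rightarrow> 'v) \<Rightarrow> real" where
  "end_dist \<phi> x y = (if x = y then 0 else \<phi> (last_common x y))"

definition end_cball ::
    "('v \<Rightarrow> 'v \<Rightarrow> bool) \<Rightarrow> 'v \<Rightarrow> ('v \<Rightarrow> real) \<Rightarrow> (nat \<Rightarrow> 'v) \<Rightarrow> real \<Rightarrow> (nat \<Rightarrow> 'v) set" where
  "end_cball adj rt \<phi> x r = {y \<in> ends adj rt. end_dist \<phi> x y \<le> r}"

definition sigma_star :: "real \<Rightarrow> real" where
  "sigma_star r = (if 0 < r then exp (- 1 / r) else 0)"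

definition ball_average ::
    "('v \<Rightarrow> 'v \<Rightarrow> bool) \<Rightarrow> 'v \<Rightarrow> ('v \<Rightarrow> real) \<Rightarrow> (nat \<Rightarrow> 'v) measure \<Rightarrow> real \<Rightarrow>
     ((nat \<Rightarrow> 'v) \<Rightarrow> real) \<Rightarrow> (nat \<Rightarrow> 'v) \<Rightarrow> real" where
  "ball_average adj rt \<phi> \<mu> r f x =
     1 / measure \<mu> (end_cball adj rt \<phi> x r) * (LINT y:end_cball adj rt \<phi> x r|\<mu>. f y)"

text \<open>
  The transition operators \<open>P\<^sup>t\<close> for \<open>t > 0\<close>: the integrator is the Lebesgue-Stieltjes measure of
  the distribution function \<open>r \<mapsto> (\<sigma>\<^sub>*(r))\<^sup>t\<close>, which does not charge \<open>{..0}\<close>.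
\<close>

definition standard_semigroup ::
    "('v \<Rightarrow> 'v \<Rightarrow> bool) \<Rightarrow> 'v \<Rightarrow> ('v \<Rightarrow> real) \<Rightarrow> (nat \<Rightarrow> 'v) measure \<Rightarrow> real \<Rightarrow>
     ((nat \<Rightarrow> 'v) \<Rightarrow> real) \<Rightarrow> (nat \<Rightarrow> 'v) \<Rightarrow> real" where
  "standard_semigroup adj rt \<phi> \<mu> t f x =
     (LINT r:{0..}|interval_measure (\<lambda>r. sigma_star r powr t). ball_average adj rt \<phi> \<mu> r f x)"

text \<open>Only used for \<open>x \<noteq> y\<close>: on the diagonal it is multiplied by \<open>f x - f y = 0\<close>.\<close>

definition standard_kernel ::
    "('v \<Rightarrow> 'v \<Rightarrow> bool) \<Rightarrow> 'v \<Rightarrow> ('v \<Rightarrow> real) \<Rightarrow> (nat \<Rightarrow> 'v) measure \<Rightarrow>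
     (nat \<Rightarrow> 'v) \<Rightarrow> (nat \<Rightarrow> 'v) \<Rightarrow> real" where
  "standard_kernel adj rt \<phi> \<mu> x y =
     (LBINT \<tau>:{0<..1 / end_dist \<phi> x y}. 1 / measure \<mu> (end_cball adj rt \<phi> x (1 / \<tau>)))"

definition L2 :: "'e measure \<Rightarrow> ('e \<Rightarrow> real) set" where
  "L2 \<mu> = {f \<in> borel_measurable \<mu>. integrable \<mu> (\<lambda>x. (f x)\<^sup>2)}"

definition standard_domain ::
    "('v \<Rightarrow> 'v \<Rightarrow> bool) \<Rightarrow> 'v \<Rightarrow> ('v \<Rightarrow> real) \<Rightarrow> (nat \<Rightarrow> 'v) measure \<Rightarrow> ((nat \<Rightarrow> 'v) \<Rightarrow> real) set" where
  "standard_domain adj rt \<phi> \<mu> =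
     {f \<in> L2 \<mu>. integrable (\<mu> \<Otimes>\<^sub>M \<mu>)
                  (\<lambda>(x, y). (f x - f y)\<^sup>2 * standard_kernel adj rt \<phi> \<mu> x y)}"

definition standard_form ::
    "('v \<Rightarrow> 'v \<Rightarrow> bool) \<Rightarrow> 'v \<Rightarrow> ('v \<Rightarrow> real) \<Rightarrow> (nat \<Rightarrow> 'v) measure \<Rightarrow>
     ((nat \<Rightarrow> 'v) \<Rightarrow> real) \<Rightarrow> ((nat \<Rightarrow> 'v) \<Rightarrow> real) \<Rightarrow> real" where
  "standard_form adj rt \<phi> \<mu> f g =
     1 / 2 * (\<integral>(x, y). (f x - f y) * (g x - g y) * standard_kernel adj rt \<phi> \<mu> x y \<partial>(\<mu> \<Otimes>\<^sub>M \<mu>))"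

text \<open>
  \<open>(E, D)\<close> is the Dirichlet form on \<open>L\<^sup>2(\<mu>)\<close> of the symmetric Markov semigroup \<open>(P\<^sup>t)\<^sub>t\<^sub>>\<^sub>0\<close>:
  \<open>D\<close> consists of those \<open>f\<close> for which \<open>\<langle>f - P\<^sup>t f, f\<rangle> / t\<close> has a finite limit as \<open>t \<rightarrow> 0+\<close>, and
  \<open>E(f, g) = lim \<langle>f - P\<^sup>t f, g\<rangle> / t\<close>.
\<close>

definition dirichlet_form_of_semigroup ::
    "'e measure \<Rightarrow> (real \<Rightarrow> ('e \<Rightarrow> real) \<Rightarrow> 'e \<Rightarrow> real) \<Rightarrow>
     ('e \<Rightarrow> real) set \<Rightarrow> (('e \<Rightarrow> real) \<Rightarrow> ('e \<Rightarrow> real) \<Rightarrow> real) \<Rightarrow> bool" where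
  "dirichlet_form_of_semigroup \<mu> P D E \<longleftrightarrow>
     D = {f \<in> L2 \<mu>. \<exists>l. ((\<lambda>t. (\<integral>x. (f x - P t f x) * f x \<partial>\<mu>) / t) \<longlongrightarrow> l) (at_right 0)} \<and>
     (\<forall>f\<in>D. \<forall>g\<in>D. ((\<lambda>t. (\<integral>x. (f x - P t f x) * g x \<partial>\<mu>) / t) \<longlongrightarrow> E f g) (at_right 0))"

end

theory Submission
  imports Defs
begin

text \<open>
  Write \<open>\<phi> = G(\<cdot>,o)\<close>, \<open>\<mu> = \<nu>\<^sub>o\<close>, \<open>F v = F(v,v\<^sup>-)\<close>, and let \<open>f\<^sub>v\<close> be the \<open>\<mu>\<close>-average of \<open>f\<close> over \<open>\<partial>T\<^sub>v\<close>.
  The expected net number of crossings of the edge into \<open>v\<close> is \<open>\<mu>(\<partial>T\<^sub>v) = a(v\<^sup>-,v) (\<phi>(v\<^sup>-) - \<phi>(v))\<close>, and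
  since \<open>v\<close> and \<open>v\<^sup>-\<close> separate the tree, \<open>\<phi>(v) = F v \<phi>(v\<^sup>-)\<close> and
  \<open>h\<^sub>f(v) = F v h\<^sub>f(v\<^sup>-) + (1 - F v) f\<^sub>v\<close>. With the branching variances
  \<open>V\<^sub>u = \<Sum> \<mu>(\<partial>T\<^sub>v) (f\<^sub>v - f\<^sub>u)\<^sup>2\<close> (sum over \<open>v\<^sup>- = u\<close>), the energy of \<open>h\<^sub>f\<close> up to level \<open>n\<close> then equals
  \<open>\<Sum> V\<^sub>u / \<phi>(u)\<close> over the vertices \<open>u\<close> above level \<open>n\<close>, minus a nonnegative remainder on level \<open>n\<close>.
  The latter is bounded by the tail of the energy, by Thomson's principle tested against \<open>(\<phi> - \<epsilon>)\<^sup>+\<close>, so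
  \<open>\<E>\<^sub>H\<^sub>D(f,f) = \<Sum> V\<^sub>u / \<phi>(u)\<close>. On the other side, summation by parts in the radius turns the
  standard form into \<open>\<Sum> (1/\<phi>(v) - 1/\<phi>(v\<^sup>-)) Var\<^sub>v f\<close> and \<open>\<langle>f - P\<^sup>t f, f\<rangle>\<close> into
  \<open>\<Sum> (exp(-t/\<phi>(v\<^sup>-)) - exp(-t/\<phi>(v))) Var\<^sub>v f\<close>; martingale convergence gives \<open>Var\<^sub>v f = \<Sum> V\<^sub>u\<close> over
  \<open>u \<in> T\<^sub>v\<close>, which yields the same series.
\<close>

section \<open>Rooted trees and their ends\<close>

text \<open>Two obstacles shape the proof. An element of the boundary domain is only known to be
  integrable, whereas the standard form lives on \<open>L2 mu\<close>. Both quadratic forms are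
  therefore compared with one series, \<open>S2 f\<close>, which takes values in [0,\<infinity>] and
  makes sense for every integrable \<open>f\<close>; its finiteness forces square integrability,
  because 1/\<phi> is smallest at the root. Secondly, the telescoped energy identity leaves a
  residual whose smallness is not visible from the recursion: it has to be extracted from the
  finiteness of the energy itself. Here the hypothesis that \<phi> tends to 0 over all vertices
  enters. It makes the truncated potential finitely supported, so that summation by parts leaves no
  boundary term. It also makes the weights of the semigroup add up to 1 along every ray. Only the
  quadratic forms are computed; the bilinear statements follow by polarisation, which requires the
  common domain to be closed under addition.\<close>

locale rtree =
  fixes adj :: "'v \<Rightarrow> 'v \<Rightarrow> bool" and rt :: 'v
  assumes tree: "is_tree adj"
    and fwd: "\<And>u. finite (forward_neighbours adj rt u)" "\<And>u. 2 \<le> card (forward_neighbours adj rt u)"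
begin

abbreviation "geo \<equiv> geodesic adj rt"
abbreviation "par \<equiv> parent adj rt"
abbreviation "ch \<equiv> forward_neighbours adj rt"
abbreviation "T \<equiv> subtree adj rt"
abbreviation "E \<equiv> ends adj rt"
abbreviation "B \<equiv> ends_below adj rt"

definition depth :: "'v \<Rightarrow> nat" where "depth v = length (geo v) - 1"

lemma adj_sym: "adj u v \<Longrightarrow> adj v u"
  using tree by (auto simp: is_tree_def symp_def)

lemma adj_irrefl: "\<not> adj u u"
  using tree by (auto simp: is_tree_def irreflp_def)

lemma ex1_path: "\<exists>!xs. simple_path adj u v xs"
  using tree by (auto simp: is_tree_def)

lemma geo_path: "simple_path adj rt v (geo v)"
  unfolding geodesic_def by (rule theI'[OF ex1_path])

lemma geo_eqI: "simple_path adj rt v xs \<Longrightarrow> geo v = xs"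
  using geo_path ex1_path by blast

lemma geo_rt [simp]: "geo rt = [rt]"
  by (rule geo_eqI) (simp add: simple_path_def)

lemma par_props:
  assumes "v \<noteq> rt"
  shows geo_nonroot: "geo v = geo (par v) @ [v]" and adj_par: "adj (par v) v"
proof -
  define xs where "xs = geo v"
  have sp: "simple_path adj rt v xs" using geo_path by (simp add: xs_def)
  then have ne: "xs \<noteq> []" and h: "hd xs = rt" and l: "last xs = v" and d: "distinct xs"
    and s: "successively adj xs" by (auto simp: simple_path_def)
  obtain ys where ys: "xs = ys @ [v]" using ne l by (metis append_butlast_last_id)
  have yne: "ys \<noteq> []" using ys h assms by auto
  have pv: "par v = last ys"
    unfolding parent_def xs_def[symmetric] Let_def using yne
    by (simp add: ys nth_append last_conv_nth)
  have "simple_path adj rt (par v) ys"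
    using h d s yne pv unfolding ys by (auto simp: simple_path_def successively_append_iff hd_append)
  then have g: "geo (par v) = ys" by (rule geo_eqI)
  show "geo v = geo (par v) @ [v]" using g ys xs_def by simp
  show "adj (par v) v" using s yne pv unfolding ys by (auto simp: successively_append_iff)
qed

lemma geo_ne: "geo v \<noteq> []" using geo_path by (auto simp: simple_path_def)
lemma geo_last: "last (geo v) = v" using geo_path by (auto simp: simple_path_def)

lemma depth_rt [simp]: "depth rt = 0" by (simp add: depth_def)

lemma depth_par: "v \<noteq> rt \<Longrightarrow> depth v = Suc (depth (par v))"
  using geo_nonroot[of v] geo_ne[of "par v"] by (cases "geo (par v)") (simp_all add: depth_def)

lemma depth_0_iff [simp]: "depth v = 0 \<longleftrightarrow> v = rt"
  using depth_par[of v] by (cases "v = rt") auto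

text \<open>If the geodesic to \<open>u\<close> avoids \<open>v\<close>, appending \<open>v\<close>
  gives the geodesic to \<open>v\<close>. Otherwise its tail from \<open>v\<close> to
  \<open>u\<close> is a simple path between adjacent vertices, hence the single edge, so
  \<open>v\<close> immediately precedes \<open>u\<close>.\<close>

lemma adj_cases:
  assumes "adj u v"
  obtains "v \<noteq> rt" "par v = u" | "u \<noteq> rt" "par u = v"
proof (cases "v \<in> set (geo u)")
  case False
  have "simple_path adj rt v (geo u @ [v])"
    using geo_path[of u] False assms
    by (auto simp: simple_path_def successively_append_iff hd_append)
  then have g: "geo v = geo u @ [v]" by (rule geo_eqI)
  have vr: "v \<noteq> rt" using False geo_path[of u] unfolding simple_path_def
    by (metis hd_in_set)
  have "geo (par v) = geo u" using g geo_nonroot[OF vr] by simp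
  then have "par v = u" by (metis geo_last)
  then show ?thesis using that vr by blast
next
  case True
  then obtain xs ys where e: "geo u = xs @ v # ys" by (meson split_list)
  have sp: "simple_path adj rt u (xs @ v # ys)" using geo_path[of u] e by simp
  have "u \<noteq> v" using assms adj_irrefl by blast
  then have "simple_path adj v u [v, u]" using assms adj_sym by (auto simp: simple_path_def)
  moreover have "simple_path adj v u (v # ys)" using sp by (auto simp: simple_path_def successively_append_iff)
  ultimately have "ys = [u]" using ex1_path by blast
  then have e': "geo u = (xs @ [v]) @ [u]" using e by simp
  have ur: "u \<noteq> rt" using e' geo_rt by fastforce
  have "geo (par u) = xs @ [v]" using e' geo_nonroot[OF ur] by simp
  then have "par u = v" by (metis geo_last last_snoc)
  then show ?thesis using that ur by blast
qed

lemma adj_iff: "adj u v \<longleftrightarrow> (v \<noteq> rt \<and> par v = u) \<or> (u \<noteq> rt \<and> par u = v)"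
  using adj_cases adj_par adj_sym by metis

lemma ch_iff: "v \<in> ch u \<longleftrightarrow> v \<noteq> rt \<and> par v = u"
  by (simp add: forward_neighbours_def)

lemma ch_depth: "v \<in> ch u \<Longrightarrow> depth v = Suc (depth u)"
  using depth_par by (auto simp: ch_iff)

lemma depth_induct [case_names root step]:
  assumes "P rt" "\<And>v. v \<noteq> rt \<Longrightarrow> P (par v) \<Longrightarrow> P v"
  shows "P v"
proof (induction "depth v" arbitrary: v)
  case 0 then show ?case using assms(1) by (metis depth_0_iff)
next
  case (Suc n)
  then have "v \<noteq> rt" by auto
  then show ?case using assms(2) Suc depth_par by auto
qed

lemma T_rt: "rt \<in> T u \<longleftrightarrow> u = rt" by (auto simp: subtree_def)

section \<open>Subtrees and levels\<close>

lemma T_rec: "v \<noteq> rt \<Longrightarrow> v \<in> T u \<longleftrightarrow> v = u \<or> par v \<in> T u"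
  using geo_nonroot[of v] by (auto simp: subtree_def)

lemma T_refl [simp]: "u \<in> T u"
  by (metis T_rt T_rec)

lemma T_root [simp]: "T rt = UNIV"
proof -
  have "v \<in> T rt" for v by (induction v rule: depth_induct) (auto simp: T_rec)
  then show ?thesis by auto
qed

lemma T_depth: "v \<in> T u \<Longrightarrow> depth u \<le> depth v \<and> (depth u = depth v \<longrightarrow> u = v)"
proof (induction v rule: depth_induct)
  case root then show ?case by (auto simp: T_rt)
next
  case (step v) then show ?case using depth_par[of v] by (auto simp: T_rec)
qed

lemma T_trans: "w \<in> T v \<Longrightarrow> v \<in> T u \<Longrightarrow> w \<in> T u"
proof (induction w rule: depth_induct)
  case root then show ?case by (auto simp: T_rt)
next
  case (step v) then show ?case by (auto simp: T_rec)
qed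

lemma T_linear: "w \<in> T u \<Longrightarrow> w \<in> T v \<Longrightarrow> depth u \<le> depth v \<Longrightarrow> v \<in> T u"
proof (induction w rule: depth_induct)
  case root then show ?case by (auto simp: T_rt)
next
  case (step w)
  show ?case
  proof (cases "w = v")
    case True then show ?thesis using step by simp
  next
    case False
    then have "par w \<in> T v" using step by (simp add: T_rec)
    moreover have "w \<noteq> u" using T_depth[OF \<open>par w \<in> T v\<close>] step depth_par[of w] by auto
    ultimately show ?thesis using step by (simp add: T_rec)
  qed
qed

lemma T_same_depth: "w \<in> T u \<Longrightarrow> w \<in> T v \<Longrightarrow> depth u = depth v \<Longrightarrow> u = v"
  using T_linear[of w u v] T_depth[of v u] by auto

lemma T_ex: "n \<le> depth v \<Longrightarrow> \<exists>u. depth u = n \<and> v \<in> T u"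
proof (induction v rule: depth_induct)
  case root then show ?case by (intro exI[of _ rt]) auto
next
  case (step v)
  show ?case
  proof (cases "n = depth v")
    case True then show ?thesis by auto
  next
    case False
    then show ?thesis using step depth_par[of v] by (auto simp: T_rec)
  qed
qed

lemma par_notin_T: "u \<noteq> rt \<Longrightarrow> par u \<notin> T u"
  using T_depth[of "par u" u] depth_par[of u] by auto

text \<open>Sums over the tree are organised as series of level sums, which are finite because the
  tree is locally finite.\<close>

definition lev :: "nat \<Rightarrow> 'v set" where "lev n = {v. depth v = n}"

lemma lev_0: "lev 0 = {rt}" by (auto simp: lev_def)

lemma lev_Suc: "lev (Suc n) = (\<Union>u\<in>lev n. ch u)"
proof -
  have "v \<in> lev (Suc n) \<longleftrightarrow> (\<exists>u\<in>lev n. v \<in> ch u)" for v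
    using depth_par[of v] by (auto simp: lev_def ch_iff) (metis Zero_not_Suc depth_rt)
  then show ?thesis by auto
qed

lemma finite_lev [simp]: "finite (lev n)"
  by (induction n) (auto simp: lev_0 lev_Suc fwd)

lemma lev_UN: "(\<Union>n. lev n) = UNIV" by (auto simp: lev_def)

lemma countable_V: "countable (A :: 'v set)"
proof -
  have "countable (\<Union>n. lev n)" by (intro countable_UN) (auto intro: countable_finite)
  then show ?thesis unfolding lev_UN by (rule countable_subset[OF subset_UNIV])
qed

lemma sum_lev_Suc: "(\<Sum>v\<in>lev (Suc n). g v) = (\<Sum>u\<in>lev n. \<Sum>v\<in>ch u. (g v :: 'b::comm_monoid_add))"
  unfolding lev_Suc by (subst sum.UNION_disjoint) (auto simp: fwd ch_iff)

lemma nbr_finite: "finite {w. adj u w}"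
proof -
  have "{w. adj u w} \<subseteq> insert (par u) (ch u)" by (auto simp: adj_iff ch_iff)
  then show ?thesis using fwd by (meson finite_insert finite_subset)
qed

section \<open>Ends as rays from the root, and their cylinder sets\<close>

text \<open>Injectivity rules out a step towards the root: the only neighbour of
  \<open>x (Suc n)\<close> that is not a child is its parent \<open>x n\<close>, which has already
  been visited.\<close>

lemma ends_par:
  assumes "x \<in> E"
  shows "x 0 = rt" "x (Suc n) \<noteq> rt" "par (x (Suc n)) = x n" "depth (x n) = n"
proof -
  have inj: "inj x" and ad: "\<And>n. adj (x n) (x (Suc n))" and x0: "x 0 = rt"
    using assms by (auto simp: ends_def geodesic_ray_def)
  show "x 0 = rt" by fact
  have nr: "x (Suc n) \<noteq> rt" for n using inj x0 by (metis Zero_not_Suc injD)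
  have pr: "par (x (Suc n)) = x n" for n
  proof (induction n)
    case 0 show ?case using ad[of 0] x0 adj_iff[of "x 0" "x (Suc 0)"] by simp
  next
    case (Suc n)
    have "x n \<noteq> x (Suc (Suc n))" using inj by (metis injD n_not_Suc_n Suc_inject less_SucI lessI less_irrefl)
    then show ?case using adj_cases[OF ad[of "Suc n"]] Suc by metis
  qed
  show "x (Suc n) \<noteq> rt" by (rule nr)
  show "par (x (Suc n)) = x n" by (rule pr)
  show "depth (x n) = n" by (induction n) (use x0 depth_par[OF nr] pr in auto)
qed

lemma endsI:
  assumes "x 0 = rt" "\<And>n. x (Suc n) \<in> ch (x n)"
  shows "x \<in> E"
proof -
  have d: "depth (x n) = n" for n
  proof (induction n)
    case (Suc n) then show ?case using ch_depth[OF assms(2)] by simp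
  qed (simp add: assms)
  have "inj x" by (metis d injI)
  then show ?thesis using assms by (auto simp: ends_def geodesic_ray_def adj_iff ch_iff)
qed

lemma ends_T:
  assumes "x \<in> E"
  shows "x m \<in> T (x n) \<longleftrightarrow> n \<le> m"
proof
  assume "x m \<in> T (x n)" then show "n \<le> m" using T_depth ends_par(4)[OF assms] by metis
next
  assume "n \<le> m" then show "x m \<in> T (x n)"
    by (induction m rule: dec_induct) (auto simp: T_rec ends_par[OF assms])
qed

lemma ends_T_iff:
  assumes "x \<in> E"
  shows "x m \<in> T u \<longleftrightarrow> depth u \<le> m \<and> x (depth u) = u"
proof
  assume a: "x m \<in> T u"
  then have le: "depth u \<le> m" using T_depth ends_par(4)[OF assms] by metis
  have "x m \<in> T (x (depth u))" using le ends_T[OF assms] by simp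
  then have "x (depth u) = u" using T_same_depth[OF _ a] ends_par(4)[OF assms] by simp
  then show "depth u \<le> m \<and> x (depth u) = u" using le by simp
next
  assume "depth u \<le> m \<and> x (depth u) = u"
  then show "x m \<in> T u" using ends_T[OF assms, of m "depth u"] by simp
qed

text \<open>A ray from the root that is ever inside \<open>T u\<close> passed through
  \<open>u\<close> at time \<open>depth u\<close> and never leaves again, so the condition on a tail
  reduces to one coordinate.\<close>

lemma B_iff: "x \<in> B u \<longleftrightarrow> x \<in> E \<and> x (depth u) = u"
  unfolding ends_below_def using ends_T_iff by (auto)

lemma B_subset: "B u \<subseteq> E" by (auto simp: B_iff)

lemma B_rt [simp]: "B rt = E" by (auto simp: B_iff ends_par)

lemma B_mono: "v \<in> T u \<Longrightarrow> B v \<subseteq> B u"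
proof
  fix x assume v: "v \<in> T u" and x: "x \<in> B v"
  then have "x \<in> E" "x (depth v) = v" by (auto simp: B_iff)
  then show "x \<in> B u" using ends_T_iff[of x "depth v" u] v by (auto simp: B_iff)
qed

lemma B_disjoint: "v \<notin> T u \<Longrightarrow> u \<notin> T v \<Longrightarrow> B u \<inter> B v = {}"
proof (rule ccontr)
  assume a: "v \<notin> T u" "u \<notin> T v" "B u \<inter> B v \<noteq> {}"
  then obtain x where x: "x \<in> E" "x (depth u) = u" "x (depth v) = v" by (auto simp: B_iff)
  show False using a x ends_T[OF x(1), of "depth u" "depth v"] ends_T[OF x(1), of "depth v" "depth u"] by auto
qed

lemma B_cases: "B u \<inter> B v = {} \<or> B u \<inter> B v = B u \<or> B u \<inter> B v = B v"
  using B_disjoint[of v u] B_mono[of u v] B_mono[of v u] by blast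

lemma in_B [simp]: "x \<in> E \<Longrightarrow> x \<in> B (x n)" by (simp add: B_iff ends_par)

lemma B_lev_disjoint: "depth u = depth v \<Longrightarrow> u \<noteq> v \<Longrightarrow> B u \<inter> B v = {}"
  by (auto simp: B_iff)

lemma B_split: "depth u \<le> n \<Longrightarrow> B u = (\<Union>v\<in>lev n \<inter> T u. B v)"
proof -
  assume n: "depth u \<le> n"
  have "x \<in> (\<Union>v\<in>lev n \<inter> T u. B v)" if "x \<in> B u" for x
  proof -
    have x: "x \<in> E" "x (depth u) = u" using that by (auto simp: B_iff)
    have "x n \<in> lev n \<inter> T u" using x n ends_T_iff[OF x(1)] by (auto simp: lev_def ends_par)
    then show ?thesis using x in_B[OF x(1), of n] by blast
  qed
  then show ?thesis using B_mono by blast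
qed

lemma ch_eq: "ch u = lev (Suc (depth u)) \<inter> T u"
proof -
  have "v \<in> ch u" if "depth v = Suc (depth u)" "v \<in> T u" for v
  proof -
    have "v \<noteq> rt" using that by auto
    then have "par v \<in> T u" using that by (auto simp: T_rec)
    then show ?thesis using T_depth[of "par v" u] that depth_par[of v] \<open>v \<noteq> rt\<close> by (auto simp: ch_iff)
  qed
  then show ?thesis by (auto simp: lev_def ch_depth) (auto simp: ch_iff T_rec)
qed

lemma ch_ne: "ch u \<noteq> {}" using fwd(2)[of u] by auto

lemma B_ne: "B u \<noteq> {}"
proof -
  obtain c where c: "\<And>u. c u \<in> ch u" using ch_ne using that by (meson ex_in_conv)
  \<comment> \<open>The geodesic to \<open>u\<close>, prolonged by iterating a choice of
    child.\<close>
  define x where "x n = (if n \<le> depth u then geo u ! n else (c ^^ (n - depth u)) u)" for n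
  have len: "length (geo v) = Suc (depth v)" for v using geo_ne[of v] by (simp add: depth_def)
  have g: "Suc n \<le> depth v \<Longrightarrow> geo v ! Suc n \<in> ch (geo v ! n)" for n v
  proof (induction v rule: depth_induct)
    case root then show ?case by simp
  next
    case (step v)
    show ?case
    proof (cases "Suc n \<le> depth (par v)")
      case True
      then show ?thesis using step by (simp add: geo_nonroot[OF step(1)] nth_append len)
    next
      case False
      then have n: "n = depth (par v)" using step depth_par[of v] by auto
      have "geo (par v) ! n = par v" using geo_last[of "par v"] geo_ne[of "par v"] by (simp add: last_conv_nth n len)
      then show ?thesis using step n by (simp add: geo_nonroot[OF step(1)] nth_append len ch_iff)
    qed
  qed
  have gl: "geo v ! depth v = v" for v using geo_last[of v] geo_ne[of v] by (simp add: last_conv_nth len)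
  have "x \<in> E"
  proof (rule endsI)
    have "hd (geo u) = rt" using geo_path[of u] by (simp add: simple_path_def)
    then show "x 0 = rt" using geo_ne[of u] by (simp add: x_def hd_conv_nth)
    show "x (Suc n) \<in> ch (x n)" for n
    proof (cases "Suc n \<le> depth u")
      case True then show ?thesis using g by (simp add: x_def)
    next
      case False
      then have *: "Suc n - depth u = Suc (n - depth u)" by simp
      have "x n = (c ^^ (n - depth u)) u" using False gl by (cases "n = depth u") (auto simp: x_def)
      then show ?thesis using False c * by (simp add: x_def)
    qed
  qed
  moreover have "x (depth u) = u" using gl by (simp add: x_def)
  ultimately show ?thesis by (auto simp: B_iff)
qed

lemma E_ne: "E \<noteq> {}" using B_ne[of rt] by simp

lemma ends_agree: "x \<in> E \<Longrightarrow> y \<in> E \<Longrightarrow> x n = y n \<Longrightarrow> k \<le> n \<Longrightarrow> x k = y k"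
  by (rule T_same_depth[of "x n"]) (simp_all add: ends_T ends_par, metis ends_T)

section \<open>Borel sets of the boundary\<close>

lemma space_eb [simp]: "space (ends_borel adj rt) = E"
proof -
  have "openin (ends_topology adj rt) U \<Longrightarrow> U \<subseteq> E" for U
    unfolding ends_topology_def
    using openin_subset[of "topology_generated_by (range B)" U] B_subset by auto
  then show ?thesis unfolding ends_borel_def by (subst space_measure_of) auto
qed

text \<open>Each point of an open set has a cylinder neighbourhood inside it (claim
  \<open>nb\<close>), so open sets are unions of cylinder sets, and these unions are countable
  because the tree is.\<close>

lemma sets_eb: "sets (ends_borel adj rt) = sigma_sets E (range B)"
proof -
  have sub: "U \<subseteq> E" if "openin (ends_topology adj rt) U" for U
    using that unfolding ends_topology_def
    using openin_subset[of "topology_generated_by (range B)" U] B_subset by auto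
  have nb: "x \<in> U \<Longrightarrow> \<exists>n. B (x n) \<subseteq> U" if g: "generate_topology_on (range B) U" and "x \<in> E" for U x
    using g
  proof (induction U rule: generate_topology_on.induct)
    case Empty then show ?case by simp
  next
    case (Int a b)
    then obtain n m where nm: "B (x n) \<subseteq> a" "B (x m) \<subseteq> b" by auto
    have "B (x (max n m)) \<subseteq> B (x n)" "B (x (max n m)) \<subseteq> B (x m)"
      using ends_T[OF that(2)] by (intro B_mono; simp)+
    then show ?case using nm by blast
  next
    case (UN K)
    then show ?case by blast
  next
    case (Basis s)
    then obtain u where u: "s = B u" "x (depth u) = u" by (auto simp: B_iff)
    then show ?case by (intro exI[of _ "depth u"]) simp
  qed
  have open_iff: "openin (ends_topology adj rt) U \<Longrightarrow> U = \<Union> (B ` {v. B v \<subseteq> U})" for U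
    using nb sub[of U] unfolding ends_topology_def openin_topology_generated_by_iff
    by (auto) (meson in_B subsetD)
  have "{U. openin (ends_topology adj rt) U} \<subseteq> sigma_sets E (range B)"
  proof clarify
    fix U assume "openin (ends_topology adj rt) U"
    then have U: "U = \<Union> (B ` {v. B v \<subseteq> U})" by (rule open_iff)
    show "U \<in> sigma_sets E (range B)"
      by (subst U, rule sigma_sets_UNION) (auto intro: countable_V)
  qed
  moreover have "range B \<subseteq> {U. openin (ends_topology adj rt) U}"
    by (auto simp: ends_topology_def intro: topology_generated_by_Basis)
  ultimately have "sigma_sets E {U. openin (ends_topology adj rt) U} = sigma_sets E (range B)"
    by (intro antisym sigma_sets_mono) (auto intro: sigma_sets.Basic)
  then show ?thesis unfolding ends_borel_def using sub by (subst sets_measure_of) auto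
qed

lemma B_sets [measurable, simp]: "B u \<in> sets (ends_borel adj rt)"
  unfolding sets_eb by (rule sigma_sets.Basic) simp

text \<open>Cylinder sets are nested or disjoint, so only the empty set has to be added. The bound
  \<open>N\<close> is carried along because the identity in \<open>nu_deep\<close> is available only
  for vertices strictly deeper than a given one; deep cylinders still generate all Borel
  sets.\<close>

lemma Int_stable_B: "Int_stable (insert {} (B ` {w. N \<le> depth w}))"
proof (rule Int_stableI)
  fix a b assume a: "a \<in> insert {} (B ` {w. N \<le> depth w})" and b: "b \<in> insert {} (B ` {w. N \<le> depth w})"
  show "a \<inter> b \<in> insert {} (B ` {w. N \<le> depth w})"
  proof (cases "a = {} \<or> b = {}")
    case True then show ?thesis by auto
  next
    case False
    then obtain u v where "a = B u" "b = B v" "N \<le> depth u" "N \<le> depth v" using a b by auto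
    then show ?thesis using B_cases[of u v] by auto
  qed
qed

lemma sigma_sets_deep: "sigma_sets E (insert {} (B ` {w. N \<le> depth w})) = sigma_sets E (range B)"
proof (intro antisym sigma_sets_mono)
  show "insert {} (B ` {w. N \<le> depth w}) \<subseteq> sigma_sets E (range B)"
    by (auto intro: sigma_sets.Basic sigma_sets.Empty)
  show "range B \<subseteq> sigma_sets E (insert {} (B ` {w. N \<le> depth w}))"
  proof clarify
    fix u
    have "B u = (\<Union>v\<in>lev (max N (depth u)) \<inter> T u. B v)" by (rule B_split) simp
    also have "\<dots> \<in> sigma_sets E (insert {} (B ` {w. N \<le> depth w}))"
      by (rule sigma_sets_UNION) (auto simp: lev_def intro: countable_V)
    finally show "B u \<in> sigma_sets E (insert {} (B ` {w. N \<le> depth w}))" .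
  qed
qed

lemma measure_eqI_deep:
  assumes s: "sets N1 = sets (ends_borel adj rt)" "sets N2 = sets (ends_borel adj rt)"
    and f: "finite_measure N1"
    and eq: "\<And>w. N \<le> depth w \<Longrightarrow> emeasure N1 (B w) = emeasure N2 (B w)"
  shows "N1 = N2"
proof (rule measure_eqI_generator_eq_countable[OF Int_stable_B[of N], of E _ _ "B ` lev N"])
  have EU: "E = (\<Union>v\<in>lev N \<inter> T rt. B v)" using B_split[of rt N] by simp
  show "insert {} (B ` {w. N \<le> depth w}) \<subseteq> Pow E" using B_subset by auto
  show "emeasure N1 X = emeasure N2 X" if "X \<in> insert {} (B ` {w. N \<le> depth w})" for X
    using that eq by auto
  show "sets N1 = sigma_sets E (insert {} (B ` {w. N \<le> depth w}))" "sets N2 = sigma_sets E (insert {} (B ` {w. N \<le> depth w}))"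
    using s by (auto simp: sets_eb sigma_sets_deep)
  show "B ` lev N \<subseteq> insert {} (B ` {w. N \<le> depth w})" by (auto simp: lev_def)
  show "\<Union> (B ` lev N) = E" using EU by auto
  show "countable (B ` lev N)" by (intro countable_image countable_V)
  show "emeasure N1 a \<noteq> \<infinity>" for a using f by (simp add: finite_measure.emeasure_finite)
qed

end

section \<open>The random walk\<close>

locale walk = rtree adj rt for adj :: "'v \<Rightarrow> 'v \<Rightarrow> bool" and rt :: 'v +
  fixes p :: "'v \<Rightarrow> 'v \<Rightarrow> real" and M :: "'v \<Rightarrow> 'w measure" and Z :: "nat \<Rightarrow> 'w \<Rightarrow> 'v"
  assumes nn: "nn_transition_matrix adj p" and mc: "markov_chain p M Z" and tr: "transient p"
begin

abbreviation "nb u \<equiv> {w. adj u w}"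

lemma p_pos: "adj u v \<Longrightarrow> 0 < p u v" and p_nonneg [simp]: "0 \<le> p u v" and p_zero: "\<not> adj u v \<Longrightarrow> p u v = 0"
  using nn by (auto simp: nn_transition_matrix_def) (metis less_eq_real_def)

lemma infsum_nb: "(\<Sum>\<^sub>\<infinity>w. p u w * g w) = (\<Sum>w\<in>nb u. p u w * (g w :: real))"
proof -
  have "(\<Sum>\<^sub>\<infinity>w. p u w * g w) = (\<Sum>\<^sub>\<infinity>w\<in>nb u. p u w * g w)"
    by (rule infsum_cong_neutral) (auto simp: p_zero)
  then show ?thesis using nbr_finite by simp
qed

lemma step_Suc: "step_prob p (Suc n) u v = (\<Sum>w\<in>nb u. p u w * step_prob p n w v)"
  by (simp add: infsum_nb)

declare step_prob.simps(2) [simp del]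

lemma step_nonneg [simp]: "0 \<le> step_prob p n u v"
  by (induction n arbitrary: u) (auto simp: step_Suc intro!: sum_nonneg)

lemma Mprob: "prob_space (M u)" and Zmeas: "Z n \<in> M u \<rightarrow>\<^sub>M count_space UNIV"
  and Zcyl: "measure (M u) {\<omega> \<in> space (M u). \<forall>i\<le>n. Z i \<omega> = x i} =
                 of_bool (x 0 = u) * (\<Prod>i<n. p (x i) (x (Suc i)))"
  using mc by (auto simp: markov_chain_def)

lemma Zpred [measurable]: "Measurable.pred (M u) (\<lambda>\<omega>. Z k \<omega> \<in> S)"
  by (rule measurable_compose[OF Zmeas]) simp

lemma Zpred_eq [measurable]: "Measurable.pred (M u) (\<lambda>\<omega>. Z k \<omega> = v)"
  using Zpred[where S="{v}"] by simp

text \<open>The exceptional event is a union of null cylinders. They are indexed by a length and a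
  list, not by a function on the naturals, so that there are only countably many of them.\<close>

lemma AE_path: "AE \<omega> in M u. Z 0 \<omega> = u \<and> (\<forall>i. adj (Z i \<omega>) (Z (Suc i) \<omega>))"
proof -
  interpret prob_space "M u" by (rule Mprob)
  let ?bad = "\<lambda>(n, xs). xs ! 0 \<noteq> u \<or> (\<exists>i<n. \<not> adj (xs ! i) (xs ! Suc i))"
  have cnt: "countable {(n :: nat, xs :: 'v list). ?bad (n, xs)}"
  proof -
    have "countable (UNIV \<times> lists (UNIV :: 'v set) :: (nat \<times> 'v list) set)"
      by (intro countable_SIGMA countable_lists countable_V) auto
    then show ?thesis by (rule countable_subset[rotated]) auto
  qed
  have "AE \<omega> in M u. \<forall>q\<in>{(n, xs). ?bad (n, xs)}. \<not> (\<forall>i\<le>fst q. Z i \<omega> = snd q ! i)"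
    unfolding AE_ball_countable[OF cnt]
  proof (intro ballI)
    fix q assume q: "q \<in> {(n, xs). ?bad (n, xs)}"
    obtain n xs where qq: "q = (n, xs)" by (cases q)
    have bad: "xs ! 0 \<noteq> u \<or> (\<exists>i<n. p (xs ! i) (xs ! Suc i) = 0)"
      using q p_zero unfolding qq by blast
    have "(\<Prod>i<n. p (xs ! i) (xs ! Suc i)) = 0" if "\<exists>i<n. p (xs ! i) (xs ! Suc i) = 0"
      using that by (auto simp: prod_zero_iff)
    then have "measure (M u) {\<omega> \<in> space (M u). \<forall>i\<le>n. Z i \<omega> = xs ! i} = 0"
      unfolding Zcyl using bad by auto
    then have "emeasure (M u) {\<omega> \<in> space (M u). \<forall>i\<le>n. Z i \<omega> = xs ! i} = 0"
      by (simp add: emeasure_eq_measure)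
    then have "{\<omega> \<in> space (M u). \<forall>i\<le>n. Z i \<omega> = xs ! i} \<in> null_sets (M u)"
      by (intro null_setsI) measurable
    then have "AE \<omega> in M u. \<not> (\<forall>i\<le>n. Z i \<omega> = xs ! i)"
      by (rule AE_I') auto
    then show "AE \<omega> in M u. \<not> (\<forall>i\<le>fst q. Z i \<omega> = snd q ! i)"
      by (simp add: qq)
  qed
  then show ?thesis
  proof eventually_elim
    case (elim \<omega>)
    have *: "\<not> ?bad (n, xs)" if "\<forall>i\<le>n. Z i \<omega> = xs ! i" for n xs
    proof
      assume "?bad (n, xs)"
      then have "(n, xs) \<in> {(n, xs). ?bad (n, xs)}" by simp
      from bspec[OF elim this] that show False by simp
    qed
    \<comment> \<open>The cylinder to exclude is the one given by the initial segment of the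
      trajectory itself.\<close>
    have "\<not> ?bad (Suc n, map (\<lambda>i. Z i \<omega>) [0..<Suc (Suc n)])" for n
      by (rule *) (auto simp del: upt_Suc)
    then have **: "Z 0 \<omega> = u \<and> (\<forall>i<Suc n. adj (Z i \<omega>) (Z (Suc i) \<omega>))" for n
      by (auto simp del: upt_Suc)
    then show ?case by blast
  qed
qed

section \<open>Path probabilities\<close>

text \<open>First-step recursion for the probability, under \<open>M u\<close>, that
  \<open>Z j\<close> lies in \<open>A j\<close> for all \<open>j \<le> n\<close>;
  \<open>measure_Q\<close> makes this precise.\<close>

primrec Q :: "nat \<Rightarrow> (nat \<Rightarrow> 'v set) \<Rightarrow> 'v \<Rightarrow> real" where
  "Q 0 A u = of_bool (u \<in> A 0)"
| "Q (Suc n) A u = of_bool (u \<in> A 0) * (\<Sum>w\<in>nb u. p u w * Q n (\<lambda>i. A (Suc i)) w)"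

lemma cylinder_sets:
  "{\<omega> \<in> space (M u). (\<forall>i\<le>m. Z i \<omega> = x i) \<and> (\<forall>j\<le>n. Z (m + j) \<omega> \<in> A j)} \<in> sets (M u)"
  by measurable

text \<open>Only the joint laws of initial segments are given, so the claim is generalised to a
  fixed past \<open>x 0, ..., x m\<close>. The induction moves one step from the future into this
  past, which plays the part of the Markov property.\<close>

lemma measure_Q_aux:
  "measure (M u) {\<omega> \<in> space (M u). (\<forall>i\<le>m. Z i \<omega> = x i) \<and> (\<forall>j\<le>n. Z (m + j) \<omega> \<in> A j)} =
     of_bool (x 0 = u) * (\<Prod>i<m. p (x i) (x (Suc i))) * Q n A (x m)"
proof (induction n arbitrary: m x A)
  case 0
  have "{\<omega> \<in> space (M u). (\<forall>i\<le>m. Z i \<omega> = x i) \<and> (\<forall>j\<le>0. Z (m + j) \<omega> \<in> A j)} =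
     (if x m \<in> A 0 then {\<omega> \<in> space (M u). \<forall>i\<le>m. Z i \<omega> = x i} else {})" by auto
  then show ?case using Zcyl by simp
next
  case (Suc n)
  interpret prob_space "M u" by (rule Mprob)
  let ?E = "\<lambda>m x n A. {\<omega> \<in> space (M u). (\<forall>i\<le>m. Z i \<omega> = x i) \<and> (\<forall>j\<le>n. Z (m + j) \<omega> \<in> A j)}"
  let ?E' = "\<lambda>w. ?E (Suc m) (x(Suc m := w)) n (\<lambda>i. A (Suc i))"
  show ?case
  proof (cases "x m \<in> A 0")
    case False
    then have "?E m x (Suc n) A = {}" by (auto intro: exI[of _ 0])
    then show ?thesis using False by (simp only: measure_empty) simp
  next
    case True
    \<comment> \<open>Split according to the value at time \<open>m + 1\<close>. Almost surely it is
      a neighbour of \<open>x m\<close>, which keeps the union finite.\<close>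
    have "measure (M u) (?E m x (Suc n) A) = measure (M u) (\<Union>w\<in>nb (x m). ?E' w)"
    proof (rule finite_measure_eq_AE)
      show "AE \<omega> in M u. \<omega> \<in> ?E m x (Suc n) A \<longleftrightarrow> \<omega> \<in> (\<Union>w\<in>nb (x m). ?E' w)"
        using AE_path AE_space
      proof eventually_elim
        case (elim \<omega>)
        show ?case
        proof
          assume a: "\<omega> \<in> ?E m x (Suc n) A"
          then have "adj (x m) (Z (Suc m) \<omega>)" using elim by (auto dest: spec[of _ m])
          moreover have "\<omega> \<in> ?E' (Z (Suc m) \<omega>)"
          proof -
            have "Z (Suc m + j) \<omega> \<in> A (Suc j)" if "j \<le> n" for j
              using a that by (auto dest: spec[of _ "Suc j"])
            moreover have "Z i \<omega> = (x(Suc m := Z (Suc m) \<omega>)) i" if "i \<le> Suc m" for i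
              using a that by (auto simp: le_Suc_eq)
            ultimately show ?thesis using a by blast
          qed
          ultimately show "\<omega> \<in> (\<Union>w\<in>nb (x m). ?E' w)" by blast
        next
          assume "\<omega> \<in> (\<Union>w\<in>nb (x m). ?E' w)"
          then obtain w where w: "\<omega> \<in> ?E' w" by blast
          then have e': "\<And>i. i \<le> Suc m \<Longrightarrow> Z i \<omega> = (x(Suc m := w)) i"
            and f: "\<And>j. j \<le> n \<Longrightarrow> Z (Suc (m + j)) \<omega> \<in> A (Suc j)" by auto
          have e: "Z i \<omega> = x i" if "i \<le> m" for i using e'[of i] that by simp
          have "Z (m + j) \<omega> \<in> A j" if "j \<le> Suc n" for j
            using that e[of m] f True by (cases j) auto
          then show "\<omega> \<in> ?E m x (Suc n) A" using elim e by auto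
        qed
      qed
      show "?E m x (Suc n) A \<in> sets (M u)" by (rule cylinder_sets)
      show "(\<Union>w\<in>nb (x m). ?E' w) \<in> sets (M u)"
        by (rule sets.finite_UN[OF nbr_finite cylinder_sets])
    qed
    also have "\<dots> = (\<Sum>w\<in>nb (x m). measure (M u) (?E' w))"
    proof (rule finite_measure_finite_Union[OF nbr_finite])
      show "?E' ` nb (x m) \<subseteq> sets (M u)" by (rule image_subsetI) (rule cylinder_sets)
      have *: "Z (Suc m) \<omega> = w" if "\<omega> \<in> ?E' w" for \<omega> w
      proof -
        have "\<forall>i\<le>Suc m. Z i \<omega> = (x(Suc m := w)) i" using that by blast
        from this[rule_format, of "Suc m"] show ?thesis by simp
      qed
      show "disjoint_family_on ?E' (nb (x m))" unfolding disjoint_family_on_def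
      proof (intro ballI impI equals0I)
        fix a b \<omega> assume "a \<noteq> b" and \<omega>: "\<omega> \<in> ?E' a \<inter> ?E' b"
        then show False using *[OF IntD1[OF \<omega>]] *[OF IntD2[OF \<omega>]] by simp
      qed
    qed
    also have "\<dots> = (\<Sum>w\<in>nb (x m). of_bool (x 0 = u) * (\<Prod>i<m. p (x i) (x (Suc i))) *
        (p (x m) w * Q n (\<lambda>i. A (Suc i)) w))"
    proof (intro sum.cong refl)
      fix w
      have "(\<Prod>i<m. p ((x(Suc m := w)) i) ((x(Suc m := w)) (Suc i))) = (\<Prod>i<m. p (x i) (x (Suc i)))"
        by (rule prod.cong) auto
      then show "measure (M u) (?E' w) = of_bool (x 0 = u) * (\<Prod>i<m. p (x i) (x (Suc i))) *
        (p (x m) w * Q n (\<lambda>i. A (Suc i)) w)"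
        unfolding Suc.IH by (simp add: mult_ac)
    qed
    also have "\<dots> = of_bool (x 0 = u) * (\<Prod>i<m. p (x i) (x (Suc i))) * Q (Suc n) A (x m)"
      using True by (simp add: sum_distrib_left)
    finally show ?thesis .
  qed
qed

lemma measure_Q: "measure (M u) {\<omega> \<in> space (M u). \<forall>j\<le>n. Z j \<omega> \<in> A j} = Q n A u"
proof -
  interpret prob_space "M u" by (rule Mprob)
  have "measure (M u) {\<omega> \<in> space (M u). \<forall>j\<le>n. Z j \<omega> \<in> A j} =
    measure (M u) {\<omega> \<in> space (M u). (\<forall>i\<le>0. Z i \<omega> = u) \<and> (\<forall>j\<le>n. Z (0 + j) \<omega> \<in> A j)}"
  proof (rule finite_measure_eq_AE)
    show "AE x in M u. (x \<in> {\<omega> \<in> space (M u). \<forall>j\<le>n. Z j \<omega> \<in> A j}) =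
      (x \<in> {\<omega> \<in> space (M u). (\<forall>i\<le>0. Z i \<omega> = u) \<and> (\<forall>j\<le>n. Z (0 + j) \<omega> \<in> A j)})"
      using AE_path by eventually_elim auto
  qed measurable
  also have "\<dots> = Q n A u" by (subst measure_Q_aux[where x="\<lambda>_. u"]) simp
  finally show ?thesis .
qed

lemma Q_step: "Q n (\<lambda>i. if i = n then {v} else UNIV) u = step_prob p n u v"
  by (induction n arbitrary: u) (auto simp: step_Suc)

lemma Q_step2: "Q (Suc n) (\<lambda>i. if i = n then {a} else if i = Suc n then {b} else UNIV) u = step_prob p n u a * p a b"
proof (induction n arbitrary: u)
  case 0
  have "(\<Sum>w\<in>nb u. p u w * of_bool (w = b)) = p u b"
    using nbr_finite by (auto simp: p_zero of_bool_def if_distrib sum.delta cong: if_cong)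
  then show ?case by auto
next
  case (Suc n)
  have "Q (Suc (Suc n)) (\<lambda>i. if i = Suc n then {a} else if i = Suc (Suc n) then {b} else UNIV) u
     = (\<Sum>w\<in>nb u. p u w * Q (Suc n) (\<lambda>i. if i = n then {a} else if i = Suc n then {b} else UNIV) w)"
    unfolding Q.simps(2)[of "Suc n"] by (simp only: nat.inject nat.distinct if_False UNIV_I of_bool_eq mult_1)
  then show ?case unfolding Suc by (simp only: step_Suc sum_distrib_right mult.assoc)
qed

lemma prob_step: "measure (M u) {\<omega> \<in> space (M u). Z n \<omega> = v} = step_prob p n u v"
  unfolding Q_step[symmetric] measure_Q[symmetric]
  by (rule arg_cong[where f="measure (M u)"]) (auto split: if_splits)

lemma prob_step2: "measure (M u) {\<omega> \<in> space (M u). Z n \<omega> = a \<and> Z (Suc n) \<omega> = b} = step_prob p n u a * p a b"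
proof -
  have "(\<forall>j\<le>Suc n. z j \<in> (if j = n then {a} else if j = Suc n then {b} else UNIV)) \<longleftrightarrow> z n = a \<and> z (Suc n) = b" for z
  proof
    assume z: "\<forall>j\<le>Suc n. z j \<in> (if j = n then {a} else if j = Suc n then {b} else UNIV)"
    show "z n = a \<and> z (Suc n) = b" using z[rule_format, of n] z[rule_format, of "Suc n"] by simp
  qed auto
  then show ?thesis unfolding Q_step2[symmetric] measure_Q[symmetric] by simp
qed

text \<open>\<open>fp n x u\<close> is the probability, starting at \<open>u\<close>, of visiting \<open>x\<close> for the first time at time \<open>n\<close>.\<close>

definition fp :: "nat \<Rightarrow> 'v \<Rightarrow> 'v \<Rightarrow> real" where
  "fp n x u = Q n (\<lambda>i. if i = n then {x} else - {x}) u"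

lemma fp_0: "fp 0 x u = of_bool (u = x)" by (simp add: fp_def)

lemma fp_Suc: "fp (Suc n) x u = of_bool (u \<noteq> x) * (\<Sum>w\<in>nb u. p u w * fp n x w)"
  unfolding fp_def by simp

lemma fp_nonneg: "0 \<le> fp n x u"
  unfolding fp_def measure_Q[symmetric] by simp

lemma hit_sums: "(\<lambda>n. fp n x u) sums hit_prob M Z u x"
proof -
  interpret prob_space "M u" by (rule Mprob)
  let ?A = "\<lambda>n. {\<omega> \<in> space (M u). \<forall>j\<le>n. Z j \<omega> \<in> (if j = n then {x} else - {x})}"
  have "(\<lambda>n. measure (M u) (?A n)) sums measure (M u) (\<Union>n. ?A n)"
  proof (rule finite_measure_UNION)
    show "range ?A \<subseteq> sets (M u)" by auto
    show "disjoint_family ?A"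
      unfolding disjoint_family_on_def
    proof (intro ballI impI)
      fix m n :: nat assume mn: "m \<noteq> n"
      have "False" if "\<omega> \<in> ?A m" "\<omega> \<in> ?A n" for \<omega>
      proof (cases "m < n")
        case True then show False using that by (auto dest!: spec[of _ m])
      next
        case False then have "n < m" using mn by simp
        then show False using that by (auto dest!: spec[of _ n])
      qed
      then show "?A m \<inter> ?A n = {}" by blast
    qed
  qed
  moreover have "(\<Union>n. ?A n) = {\<omega> \<in> space (M u). \<exists>n. Z n \<omega> = x}"
  proof -
    have "\<omega> \<in> (\<Union>n. ?A n)" if h: "\<omega> \<in> space (M u)" "\<exists>n. Z n \<omega> = x" for \<omega>
    proof -
      define n where "n = (LEAST n. Z n \<omega> = x)"
      have "Z n \<omega> = x" "\<And>j. j < n \<Longrightarrow> Z j \<omega> \<noteq> x"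
        using h(2) unfolding n_def by (auto intro: LeastI dest: not_less_Least)
      then have "\<omega> \<in> ?A n" using h(1) by auto
      then show ?thesis by blast
    qed
    moreover have "\<omega> \<in> space (M u) \<and> (\<exists>n. Z n \<omega> = x)" if "\<omega> \<in> ?A n" for \<omega> n
    proof -
      have "\<omega> \<in> space (M u)" "Z n \<omega> \<in> (if n = n then {x} else - {x})" using that by blast+
      then show ?thesis by auto
    qed
    ultimately show ?thesis by blast
  qed
  ultimately show ?thesis unfolding hit_prob_def fp_def measure_Q by simp
qed

section \<open>The Green function at cut vertices\<close>

text \<open>The region \<open>S\<close> can be left only through \<open>x\<close>, so a walk from
  \<open>S\<close> must visit \<open>x\<close> before it can be at \<open>w\<close>; the index
  \<open>k\<close> is the time of the first visit. The first-step recursion of both sides replaces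
  the strong Markov property.\<close>

lemma first_passage:
  assumes S: "\<And>u. u \<in> S \<Longrightarrow> nb u \<subseteq> insert x S" "w \<notin> S" and u: "u \<in> insert x S"
  shows "step_prob p n u w = (\<Sum>k\<le>n. fp k x u * step_prob p (n - k) x w)"
  using u
proof (induction n arbitrary: u)
  case 0
  then show ?case using S(2) by (auto simp: fp_0)
next
  case (Suc n)
  show ?case
  proof (cases "u = x")
    case True
    then show ?thesis by (subst sum.atMost_Suc_shift) (simp add: fp_0 fp_Suc)
  next
    case False
    then have "u \<in> S" using Suc by auto
    have "step_prob p (Suc n) u w = (\<Sum>v\<in>nb u. p u v * (\<Sum>k\<le>n. fp k x v * step_prob p (n - k) x w))"
      unfolding step_Suc using Suc.IH S(1)[OF \<open>u \<in> S\<close>] by (intro sum.cong refl) auto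
    also have "\<dots> = (\<Sum>k\<le>n. \<Sum>v\<in>nb u. p u v * fp k x v * step_prob p (n - k) x w)"
      by (subst sum.swap) (simp add: sum_distrib_left mult_ac)
    also have "\<dots> = (\<Sum>k\<le>n. fp (Suc k) x u * step_prob p (n - k) x w)"
      using False by (simp add: fp_Suc sum_distrib_right)
    also have "\<dots> = (\<Sum>k\<le>Suc n. fp k x u * step_prob p (Suc n - k) x w)"
      using False by (simp add: fp_0 sum.atMost_Suc_shift del: sum.atMost_Suc)
    finally show ?thesis .
  qed
qed

lemma step_summable: "summable (\<lambda>n. step_prob p n u v)" using tr by (simp add: transient_def)

lemma green_sums: "(\<lambda>n. step_prob p n u v) sums green p u v"
  using step_summable by (simp add: green_def summable_sums)

text \<open>Summed over time, the convolution of \<open>first_passage\<close> becomes a product of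
  two absolutely convergent series.\<close>

lemma green_factor:
  assumes S: "\<And>u. u \<in> S \<Longrightarrow> nb u \<subseteq> insert x S" "w \<notin> S" and u: "u \<in> S"
  shows "green p u w = hit_prob M Z u x * green p x w"
proof -
  have "(\<lambda>n. \<Sum>k\<le>n. fp k x u * step_prob p (n - k) x w) sums ((\<Sum>k. fp k x u) * (\<Sum>k. step_prob p k x w))"
    using hit_sums step_summable by (intro Cauchy_product_sums) (auto simp: fp_nonneg sums_iff)
  moreover have "(\<lambda>n. \<Sum>k\<le>n. fp k x u * step_prob p (n - k) x w) = (\<lambda>n. step_prob p n u w)"
    using first_passage[OF S, of u] u by auto
  ultimately show ?thesis using hit_sums[of x u] green_sums[of u w] by (simp add: sums_iff green_def)
qed

lemma leave_T: "a \<in> T v \<Longrightarrow> adj a b \<Longrightarrow> b \<notin> T v \<Longrightarrow> a = v \<and> v \<noteq> rt \<and> b = par v"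
  by (erule adj_cases) (metis T_rec)+

lemma enter_T: "a \<notin> T v \<Longrightarrow> adj a b \<Longrightarrow> b \<in> T v \<Longrightarrow> b = v \<and> v \<noteq> rt \<and> a = par v"
  using leave_T[of b v a] adj_sym by blast

lemma green_up: "v \<noteq> rt \<Longrightarrow> w \<notin> T v \<Longrightarrow> green p v w = hit_prob M Z v (par v) * green p (par v) w"
  by (rule green_factor[where S="T v"]) (use leave_T in auto)

lemma green_down: "u \<notin> T v \<Longrightarrow> w \<in> T v \<Longrightarrow> green p u w = hit_prob M Z u v * green p v w"
  by (rule green_factor[where S="- T v"]) (use enter_T in auto)

lemma green_diag: "1 \<le> green p u u"
proof -
  have "(\<Sum>n<1. step_prob p n u u) \<le> green p u u"
    unfolding green_def using step_summable by (rule sum_le_suminf) auto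
  then show ?thesis by simp
qed

lemma hit_up_pos: assumes "v \<noteq> rt" shows "0 < hit_prob M Z v (par v)"
proof -
  have a: "adj v (par v)" using adj_par adj_sym assms by blast
  have "(\<Sum>n<2. fp n (par v) v) \<le> hit_prob M Z v (par v)"
    using hit_sums[of "par v" v] sum_le_suminf[of "\<lambda>n. fp n (par v) v" "{..<2}"] fp_nonneg
    by (auto simp: sums_iff)
  moreover have "(\<Sum>n<2. fp n (par v) v) = fp 0 (par v) v + fp (Suc 0) (par v) v"
    by (simp add: numeral_2_eq_2)
  moreover have "0 < fp (Suc 0) (par v) v"
  proof -
    have "v \<noteq> par v" using a adj_irrefl by metis
    moreover have "0 < (\<Sum>w\<in>nb v. p v w * fp 0 (par v) w)"
      by (rule sum_pos2[OF nbr_finite, of "par v"]) (use a p_pos in \<open>auto simp: fp_0\<close>)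
    ultimately show ?thesis by (simp add: fp_Suc)
  qed
  ultimately show ?thesis using fp_nonneg[of 0 "par v" v] by linarith
qed

definition "ph v = green p v rt"

lemma ph_rec: "v \<noteq> rt \<Longrightarrow> ph v = hit_prob M Z v (par v) * ph (par v)"
  unfolding ph_def by (rule green_up) (auto simp: T_rt)

lemma ph_pos: "0 < ph v"
proof (induction v rule: depth_induct)
  case root show ?case using green_diag[of rt] by (simp add: ph_def)
next
  case (step v) then show ?case using ph_rec hit_up_pos by simp
qed

section \<open>Reversibility\<close>

definition "mm v = rev_measure adj rt p v"

lemma mm_rt: "mm rt = 1" by (simp add: mm_def rev_measure_def)

lemma mm_rec: "v \<noteq> rt \<Longrightarrow> mm v = mm (par v) * (p (par v) v / p v (par v))"
proof -
  assume v: "v \<noteq> rt"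
  obtain k where k: "length (geo (par v)) = Suc k" using geo_ne[of "par v"] by (cases "geo (par v)") auto
  have l: "geo (par v) ! k = par v" using geo_last[of "par v"] geo_ne[of "par v"] k by (simp add: last_conv_nth)
  show ?thesis
    unfolding mm_def rev_measure_def Let_def geo_nonroot[OF v] using k l by (simp add: nth_append)
qed

lemma mm_pos: "0 < mm v"
proof (induction v rule: depth_induct)
  case root show ?case by (simp add: mm_rt)
next
  case (step v) then show ?case using mm_rec adj_par adj_sym p_pos by simp
qed

lemma mm_par: "v \<noteq> rt \<Longrightarrow> mm (par v) * p (par v) v = mm v * p v (par v)"
  using mm_rec[of v] adj_par[of v] adj_sym p_pos[of v "par v"] by simp

lemma mm_rev: "mm u * p u v = mm v * p v u"
proof (cases "adj u v")
  case True then show ?thesis by (rule adj_cases) (use mm_par in auto)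
next
  case False then show ?thesis using adj_sym p_zero by fastforce
qed

text \<open>The last-step counterpart of the defining recursion; time reversal exchanges the two,
  which drives the induction in \<open>step_rev\<close>.\<close>

lemma step_Suc': "step_prob p (Suc n) u v = (\<Sum>w\<in>nb v. step_prob p n u w * p w v)"
proof (induction n arbitrary: u)
  case 0
  have "(\<Sum>w\<in>nb u. p u w * of_bool (w = v)) = p u v"
    using nbr_finite by (auto simp: p_zero of_bool_def if_distrib sum.delta cong: if_cong)
  moreover have "(\<Sum>w\<in>nb v. of_bool (u = w) * p w v) = p u v"
  proof -
    have "(\<Sum>w\<in>nb v. of_bool (u = w) * p w v) = (\<Sum>w\<in>nb v. if w = u then p w v else 0)"
      by (rule sum.cong) auto
    also have "\<dots> = p u v" using nbr_finite[of v] adj_sym[of u v] p_zero[of u v] by (auto simp: sum.delta)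
    finally show ?thesis .
  qed
  ultimately show ?case by (simp add: step_Suc)
next
  case (Suc n)
  have "step_prob p (Suc (Suc n)) u v = (\<Sum>w\<in>nb u. p u w * (\<Sum>z\<in>nb v. step_prob p n w z * p z v))"
    unfolding step_Suc[of "Suc n"] Suc ..
  also have "\<dots> = (\<Sum>z\<in>nb v. (\<Sum>w\<in>nb u. p u w * step_prob p n w z) * p z v)"
    unfolding sum_distrib_left sum_distrib_right mult.assoc by (rule sum.swap)
  finally show ?case by (simp add: step_Suc)
qed

lemma step_rev: "mm u * step_prob p n u v = mm v * step_prob p n v u"
proof (induction n arbitrary: u)
  case 0 then show ?case by auto
next
  case (Suc n)
  have "mm u * step_prob p (Suc n) u v = (\<Sum>w\<in>nb u. p w u * (mm w * step_prob p n w v))"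
    unfolding step_Suc sum_distrib_left
  proof (intro sum.cong refl)
    fix w
    have "mm u * (p u w * step_prob p n w v) = (mm u * p u w) * step_prob p n w v" by simp
    also have "\<dots> = (mm w * p w u) * step_prob p n w v" by (simp only: mm_rev[of u w])
    finally show "mm u * (p u w * step_prob p n w v) = p w u * (mm w * step_prob p n w v)"
      by (simp only: mult_ac)
  qed
  also have "\<dots> = (\<Sum>w\<in>nb u. mm v * (step_prob p n v w * p w u))"
    unfolding Suc by (simp add: mult_ac)
  also have "\<dots> = mm v * step_prob p (Suc n) v u" unfolding step_Suc' sum_distrib_left ..
  finally show ?case .
qed

lemma green_rt: "green p rt v = mm v * ph v"
proof -
  have "green p rt v = (\<Sum>n. mm v * step_prob p n v rt)"
    unfolding green_def using step_rev[of rt _ v] mm_rt by simp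
  then show ?thesis using step_summable by (simp add: suminf_mult ph_def green_def)
qed

section \<open>Limit distributions\<close>

abbreviation "conv z \<equiv> \<exists>x. converges_to_end adj rt z x"

lemma limit_unique: "converges_to_end adj rt z x \<Longrightarrow> converges_to_end adj rt z y \<Longrightarrow> x = y"
proof
  fix n assume "converges_to_end adj rt z x" "converges_to_end adj rt z y"
  then have x: "x \<in> E" and y: "y \<in> E"
    and e: "\<forall>\<^sub>F k in sequentially. z k \<in> T (x n)" "\<forall>\<^sub>F k in sequentially. z k \<in> T (y n)"
    by (auto simp: converges_to_end_def)
  have "\<forall>\<^sub>F k in sequentially. z k \<in> T (x n) \<and> z k \<in> T (y n)" using e by eventually_elim simp
  then obtain k where "z k \<in> T (x n)" "z k \<in> T (y n)" using eventually_happens'[OF sequentially_bot] by blast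
  then show "x n = y n" using T_same_depth ends_par(4)[OF x] ends_par(4)[OF y] by metis
qed

lemma limit_end_eq: "converges_to_end adj rt z x \<Longrightarrow> limit_end adj rt z = x"
  unfolding limit_end_def using limit_unique by (auto intro!: the_equality)

lemma limit_in_B:
  assumes "converges_to_end adj rt z x"
  shows "x \<in> B v \<longleftrightarrow> (\<forall>\<^sub>F n in sequentially. z n \<in> T v)"
proof
  assume "x \<in> B v" then show "\<forall>\<^sub>F n in sequentially. z n \<in> T v"
    using assms unfolding converges_to_end_def B_iff by (metis (full_types))
next
  assume a: "\<forall>\<^sub>F n in sequentially. z n \<in> T v"
  have x: "x \<in> E" and e: "\<forall>\<^sub>F k in sequentially. z k \<in> T (x (depth v))"
    using assms by (auto simp: converges_to_end_def)
  have "\<forall>\<^sub>F k in sequentially. z k \<in> T v \<and> z k \<in> T (x (depth v))" using a e by eventually_elim simp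
  then obtain k where "z k \<in> T v" "z k \<in> T (x (depth v))" using eventually_happens'[OF sequentially_bot] by blast
  then have "x (depth v) = v" using T_same_depth ends_par(4)[OF x] by metis
  then show "x \<in> B v" using x by (simp add: B_iff)
qed

text \<open>Eliminates the quantifier over the uncountably many ends, so that convergence becomes a
  measurable event. Conversely, vertices chosen on consecutive levels are compatible because some
  \<open>z k\<close> lies below both.\<close>

lemma conv_iff: "conv z \<longleftrightarrow> (\<forall>n. \<exists>v\<in>lev n. \<forall>\<^sub>F k in sequentially. z k \<in> T v)"
proof
  assume "conv z"
  then obtain x where x: "x \<in> E" "\<And>n. \<forall>\<^sub>F k in sequentially. z k \<in> T (x n)" by (auto simp: converges_to_end_def)
  then show "\<forall>n. \<exists>v\<in>lev n. \<forall>\<^sub>F k in sequentially. z k \<in> T v"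
    using ends_par(4)[OF x(1)] by (auto simp: lev_def)
next
  assume "\<forall>n. \<exists>v\<in>lev n. \<forall>\<^sub>F k in sequentially. z k \<in> T v"
  then obtain x where x: "\<And>n. x n \<in> lev n" "\<And>n. \<forall>\<^sub>F k in sequentially. z k \<in> T (x n)" by metis
  have "x \<in> E"
  proof (rule endsI)
    show "x 0 = rt" using x(1)[of 0] by (simp add: lev_0)
    fix n
    have "\<forall>\<^sub>F k in sequentially. z k \<in> T (x n) \<and> z k \<in> T (x (Suc n))"
      using x(2)[of n] x(2)[of "Suc n"] by eventually_elim simp
    then obtain k where "z k \<in> T (x n)" "z k \<in> T (x (Suc n))" using eventually_happens'[OF sequentially_bot] by blast
    then have "x (Suc n) \<in> T (x n)" by (rule T_linear) (use x(1)[of n] x(1)[of "Suc n"] in \<open>auto simp: lev_def\<close>)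
    then show "x (Suc n) \<in> ch (x n)" using x(1)[of n] x(1)[of "Suc n"] by (simp add: ch_eq lev_def)
  qed
  then show "conv z" using x by (auto simp: converges_to_end_def)
qed

text \<open>Such a path eventually avoids the finitely many vertices of depth less than
  \<open>n\<close>. From then on it cannot change its subtree on level \<open>n\<close>, since the
  only exit leads to a vertex of depth \<open>n - 1\<close>.\<close>

lemma conv_path:
  assumes ad: "\<And>i. adj (z i) (z (Suc i))" and fin: "\<And>v. \<forall>\<^sub>F k in sequentially. z k \<noteq> v"
  shows "conv z"
  unfolding conv_iff
proof
  fix n
  have "\<forall>\<^sub>F k in sequentially. \<forall>v\<in>(\<Union>i<n. lev i). z k \<noteq> v"
    by (rule eventually_ball_finite) (use fin in auto)
  then obtain K where K: "\<And>k. k \<ge> K \<Longrightarrow> z k \<notin> (\<Union>i<n. lev i)"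
    unfolding eventually_sequentially by blast
  then have d: "n \<le> depth (z k)" if "k \<ge> K" for k using that by (fastforce simp: lev_def not_less)
  obtain v where v: "depth v = n" "z K \<in> T v" using T_ex d by blast
  have "z k \<in> T v" if "k \<ge> K" for k
    using that
  proof (induction k rule: dec_induct)
    case base then show ?case by (rule v)
  next
    case (step k)
    show ?case
    proof (rule ccontr)
      assume "z (Suc k) \<notin> T v"
      then have "z (Suc k) = par v" "v \<noteq> rt" using leave_T[OF step(3) ad] by auto
      then show False using d[of "Suc k"] step v depth_par[of v] by auto
    qed
  qed
  then show "\<exists>v\<in>lev n. \<forall>\<^sub>F k in sequentially. z k \<in> T v"
    using v unfolding eventually_sequentially by (auto simp: lev_def)
qed

text \<open>Transience says that the probabilities of being at \<open>v\<close> at time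
  \<open>n\<close> are summable, so by Borel-Cantelli every vertex is visited finitely
  often.\<close>

lemma AE_conv: "AE \<omega> in M u. conv (\<lambda>n. Z n \<omega>)"
proof -
  interpret prob_space "M u" by (rule Mprob)
  have "AE \<omega> in M u. \<forall>v\<in>UNIV. \<forall>\<^sub>F n in sequentially. \<omega> \<in> space (M u) - {\<omega> \<in> space (M u). Z n \<omega> = v}"
    unfolding AE_ball_countable[OF countable_V]
  proof
    fix v
    show "AE \<omega> in M u. \<forall>\<^sub>F n in sequentially. \<omega> \<in> space (M u) - {\<omega> \<in> space (M u). Z n \<omega> = v}"
      by (rule borel_cantelli_AE1) (auto simp: prob_step step_summable less_top[symmetric] emeasure_eq_measure)
  qed
  then show ?thesis
    using AE_path[of u]
  proof eventually_elim
    case (elim \<omega>)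
    show ?case
    proof (rule conv_path)
      show "adj (Z i \<omega>) (Z (Suc i) \<omega>)" for i using elim by auto
      show "\<forall>\<^sub>F k in sequentially. Z k \<omega> \<noteq> v" for v
        using elim(1)[rule_format, of v] by (auto elim: eventually_mono)
    qed
  qed
qed

definition "nu u = limit_distr adj rt M Z u"

lemma limit_meas [measurable]: "(\<lambda>\<omega>. limit_end adj rt (\<lambda>n. Z n \<omega>)) \<in> M u \<rightarrow>\<^sub>M ends_borel adj rt"
proof (rule measurable_sigma_sets)
  show "sets (ends_borel adj rt) = sigma_sets E (range B)" by (rule sets_eb)
  show "range B \<subseteq> Pow E" using B_subset by auto
  \<comment> \<open>The default end assigned to trajectories without a limit; on that event,
    membership in \<open>B v\<close> does not depend on the trajectory.\<close>
  let ?e = "SOME x. x \<in> E"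
  have e: "?e \<in> E" using E_ne by (simp add: some_in_eq)
  have "limit_end adj rt z \<in> E" for z
  proof (cases "conv z")
    case True
    then obtain x where "converges_to_end adj rt z x" by blast
    then show ?thesis using limit_end_eq by (auto simp: converges_to_end_def)
  next
    case False then show ?thesis using e by (simp add: limit_end_def)
  qed
  then show "(\<lambda>\<omega>. limit_end adj rt (\<lambda>n. Z n \<omega>)) \<in> space (M u) \<rightarrow> E" by auto
  fix A assume "A \<in> range B"
  then obtain v where A: "A = B v" by auto
  have *: "limit_end adj rt z \<in> B v \<longleftrightarrow> (if conv z then \<forall>\<^sub>F n in sequentially. z n \<in> T v else ?e \<in> B v)" for z
  proof (cases "conv z")
    case True
    then obtain x where x: "converges_to_end adj rt z x" by blast
    show ?thesis using True limit_in_B[OF x, of v] unfolding limit_end_eq[OF x] by simp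
  next
    case False
    then show ?thesis unfolding limit_end_def by (simp only: if_False)
  qed
  have [measurable]: "Measurable.pred (M u) (\<lambda>\<omega>. \<forall>\<^sub>F n in sequentially. Z n \<omega> \<in> T v)" for v
    unfolding eventually_sequentially by measurable
  have [measurable]: "Measurable.pred (M u) (\<lambda>\<omega>. conv (\<lambda>n. Z n \<omega>))"
    unfolding conv_iff by (intro pred_intros_countable pred_intros_finite) measurable
  have "(\<lambda>\<omega>. limit_end adj rt (\<lambda>n. Z n \<omega>)) -` A \<inter> space (M u) =
    {\<omega> \<in> space (M u). if conv (\<lambda>n. Z n \<omega>) then \<forall>\<^sub>F n in sequentially. Z n \<omega> \<in> T v else ?e \<in> B v}"
    unfolding A using * by blast
  also have "\<dots> \<in> sets (M u)" by measurable
  finally show "(\<lambda>\<omega>. limit_end adj rt (\<lambda>n. Z n \<omega>)) -` A \<inter> space (M u) \<in> sets (M u)" .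
qed

lemma sets_nu [simp, measurable_cong]: "sets (nu u) = sets (ends_borel adj rt)"
  by (simp add: nu_def limit_distr_def)

lemma space_nu [simp]: "space (nu u) = E"
  by (simp add: nu_def limit_distr_def)

lemma prob_nu: "prob_space (nu u)"
  unfolding nu_def limit_distr_def by (rule prob_space.prob_space_distr[OF Mprob limit_meas])

section \<open>The mass of a cylinder set as a net flow\<close>

text \<open>The indicators converge almost surely: if the limit end misses \<open>B v\<close>, the
  walk is eventually in the subtree of another vertex on the same level, which is disjoint from
  \<open>T v\<close>.\<close>

lemma T_tendsto: "(\<lambda>n. measure (M u) {\<omega> \<in> space (M u). Z n \<omega> \<in> T v}) \<longlonglongrightarrow> measure (nu u) (B v)"
proof -
  interpret prob_space "M u" by (rule Mprob)
  let ?L = "\<lambda>\<omega>. limit_end adj rt (\<lambda>n. Z n \<omega>)"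
  have "(\<lambda>n. \<integral>\<omega>. indicat_real {\<omega> \<in> space (M u). Z n \<omega> \<in> T v} \<omega> \<partial>M u)
     \<longlonglongrightarrow> (\<integral>\<omega>. indicat_real (?L -` B v \<inter> space (M u)) \<omega> \<partial>M u)"
  proof (rule integral_dominated_convergence[where w="\<lambda>_. 1"])
    show "indicat_real (?L -` B v \<inter> space (M u)) \<in> borel_measurable (M u)"
      using measurable_sets[OF limit_meas B_sets] by (rule borel_measurable_indicator)
    show "AE \<omega> in M u. (\<lambda>n. indicat_real {\<omega> \<in> space (M u). Z n \<omega> \<in> T v} \<omega>) \<longlonglongrightarrow> indicat_real (?L -` B v \<inter> space (M u)) \<omega>"
      using AE_conv[of u] AE_path[of u] AE_space
    proof eventually_elim
      case (elim \<omega>)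
      then obtain x where x: "converges_to_end adj rt (\<lambda>n. Z n \<omega>) x" by blast
      have L: "?L \<omega> = x" by (rule limit_end_eq[OF x])
      show ?case
      proof (cases "x \<in> B v")
        case True
        then have "\<forall>\<^sub>F n in sequentially. Z n \<omega> \<in> T v" using limit_in_B[OF x] by blast
        then have "\<forall>\<^sub>F n in sequentially. indicat_real {\<omega> \<in> space (M u). Z n \<omega> \<in> T v} \<omega> = indicat_real (?L -` B v \<inter> space (M u)) \<omega>"
          by eventually_elim (use True L elim in auto)
        then show ?thesis by (rule tendsto_eventually)
      next
        case False
        then have xv: "x (depth v) \<noteq> v" using x by (auto simp: B_iff converges_to_end_def)
        have xE: "x \<in> E" using x by (auto simp: converges_to_end_def)
        have "\<forall>\<^sub>F n in sequentially. Z n \<omega> \<in> T (x (depth v))" using x by (auto simp: converges_to_end_def)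
        then have "\<forall>\<^sub>F n in sequentially. indicat_real {\<omega> \<in> space (M u). Z n \<omega> \<in> T v} \<omega> = indicat_real (?L -` B v \<inter> space (M u)) \<omega>"
        proof eventually_elim
          case (elim n)
          then have "Z n \<omega> \<notin> T v" using T_same_depth[of "Z n \<omega>" "x (depth v)" v] xv ends_par(4)[OF xE] by auto
          then show ?case using False L by auto
        qed
        then show ?thesis by (rule tendsto_eventually)
      qed
    qed
  qed auto
  then show ?thesis
    unfolding nu_def limit_distr_def by (subst measure_distr[OF limit_meas]) (simp_all add: Int_commute Int_def conj_commute)
qed

text \<open>A single edge joins \<open>T v\<close> to its complement, so the probability of being in
  \<open>T v\<close> changes in each step by the expected inward crossings minus the outward
  ones.\<close>

lemma T_flux:
  assumes v: "v \<noteq> rt"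
  shows "measure (M u) {\<omega> \<in> space (M u). Z n \<omega> \<in> T v} = of_bool (u \<in> T v) +
     (\<Sum>k<n. step_prob p k u (par v) * p (par v) v - step_prob p k u v * p v (par v))"
proof (induction n)
  interpret prob_space "M u" by (rule Mprob)
  case 0
  have "measure (M u) {\<omega> \<in> space (M u). Z 0 \<omega> \<in> T v} = Q 0 (\<lambda>_. T v) u"
    unfolding measure_Q[symmetric] by simp
  then show ?case by simp
next
  interpret prob_space "M u" by (rule Mprob)
  case (Suc n)
  let ?S = "\<lambda>n. {\<omega> \<in> space (M u). Z n \<omega> \<in> T v}"
  let ?P = "\<lambda>a b. {\<omega> \<in> space (M u). Z n \<omega> = a \<and> Z (Suc n) \<omega> = b}"
  have m: "?S k \<in> sets (M u)" "?P a b \<in> sets (M u)" for k a b by measurable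
  have np: "par v \<notin> T v" using par_notin_T[OF v] .
  \<comment> \<open>Both unions below describe the event of being in \<open>T v\<close> at time
    \<open>n\<close> or \<open>n + 1\<close>. Each is disjoint, so no differences of events have to
    be formed.\<close>
  have "measure (M u) (?S (Suc n)) + measure (M u) (?P v (par v)) = measure (M u) (?S (Suc n) \<union> ?P v (par v))"
    by (rule finite_measure_Union[symmetric]) (use m np in auto)
  also have "\<dots> = measure (M u) (?S n \<union> ?P (par v) v)"
  proof (rule finite_measure_eq_AE)
    show "AE \<omega> in M u. (\<omega> \<in> ?S (Suc n) \<union> ?P v (par v)) = (\<omega> \<in> ?S n \<union> ?P (par v) v)"
      using AE_path[of u]
    proof eventually_elim
      case (elim \<omega>)
      then have a: "adj (Z n \<omega>) (Z (Suc n) \<omega>)" by blast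
      have "Z (Suc n) \<omega> \<in> T v \<or> Z n \<omega> = v \<and> Z (Suc n) \<omega> = par v \<longleftrightarrow>
        Z n \<omega> \<in> T v \<or> Z n \<omega> = par v \<and> Z (Suc n) \<omega> = v"
      proof (cases "Z n \<omega> \<in> T v"; cases "Z (Suc n) \<omega> \<in> T v")
        assume "Z n \<omega> \<in> T v" "Z (Suc n) \<omega> \<notin> T v"
        then show ?thesis using leave_T[OF _ a, of v] by simp
      next
        assume "Z n \<omega> \<notin> T v" "Z (Suc n) \<omega> \<in> T v"
        then show ?thesis using enter_T[OF _ a, of v] by simp
      next
        assume "Z n \<omega> \<notin> T v" "Z (Suc n) \<omega> \<notin> T v"
        then show ?thesis using T_refl[of v] by metis
      qed simp
      then show ?case by blast
    qed
  qed (use m in auto)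
  also have "\<dots> = measure (M u) (?S n) + measure (M u) (?P (par v) v)"
    by (rule finite_measure_Union) (use m np in auto)
  finally show ?case using Suc unfolding prob_step2 by simp
qed

lemma nu_B:
  assumes v: "v \<noteq> rt"
  shows "measure (nu u) (B v) = of_bool (u \<in> T v) + green p u (par v) * p (par v) v - green p u v * p v (par v)"
proof -
  have "(\<lambda>n. of_bool (u \<in> T v) + (\<Sum>k<n. step_prob p k u (par v) * p (par v) v - step_prob p k u v * p v (par v)))
    \<longlonglongrightarrow> of_bool (u \<in> T v) + (green p u (par v) * p (par v) v - green p u v * p v (par v))"
    using green_sums unfolding sums_def[symmetric]
    by (intro tendsto_add tendsto_const) (auto simp: sums_def[symmetric] intro!: sums_diff sums_mult2)
  then show ?thesis using LIMSEQ_unique[OF T_tendsto[of u v]] unfolding T_flux[OF v] by auto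
qed

lemma nu_rt_B: "v \<noteq> rt \<Longrightarrow> measure (nu rt) (B v) = mm v * p v (par v) * (ph (par v) - ph v)"
  using nu_B[of v rt] mm_par[of v] by (simp add: T_rt green_rt algebra_simps)

end

context rtree begin

lemma measure_B_split:
  assumes "finite_measure N" "sets N = sets (ends_borel adj rt)" "depth u \<le> n"
  shows "measure N (B u) = (\<Sum>w\<in>lev n \<inter> T u. measure N (B w))"
proof -
  interpret finite_measure N by fact
  show ?thesis unfolding B_split[OF assms(3)]
  proof (rule finite_measure_finite_Union)
    show "disjoint_family_on B (lev n \<inter> T u)"
      unfolding disjoint_family_on_def lev_def using B_lev_disjoint by simp
  qed (auto simp: assms(2))
qed

end

section \<open>Comparing the limit distributions for different starting points\<close>

locale limit_walk = walk +
  assumes F_less: "\<And>v. v \<noteq> rt \<Longrightarrow> hit_prob M Z v (par v) < 1"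
begin

abbreviation "mu \<equiv> nu rt"
abbreviation "mb v \<equiv> measure mu (B v)"
abbreviation "F v \<equiv> hit_prob M Z v (par v)"

lemma ph_dec: "v \<noteq> rt \<Longrightarrow> ph v < ph (par v)"
  using ph_rec[of v] F_less[of v] ph_pos[of "par v"] by simp

lemma nu_E [simp]: "measure (nu u) E = 1"
  using prob_space.prob_space[OF prob_nu[of u]] by simp

lemma mb_pos: "0 < mb v"
proof (cases "v = rt")
  case False
  then show ?thesis using nu_rt_B mm_pos ph_dec adj_par adj_sym p_pos by simp
qed simp

definition "K v = (1 - F v) / mb v"

text \<open>
  Hence \<open>\<nu>\<^sub>v = F v \<cdot> \<nu>\<^sub>v\<^sub>- + (1 - F v) \<cdot> \<mu>(\<cdot> | B v)\<close>. The proportionality constant \<open>K v\<close> on \<open>B v\<close>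
  comes from comparing total masses.
\<close>

lemma nu_deep:
  assumes v: "v \<noteq> rt" and w: "depth v < depth w"
  shows "measure (nu v) (B w) = F v * measure (nu (par v)) (B w) + K v * measure mu (B v \<inter> B w)"
proof -
  \<comment> \<open>For \<open>w\<close> strictly below \<open>v\<close>, the measures
    \<open>nu v\<close>, \<open>nu (par v)\<close> and \<open>mu\<close> give \<open>B w\<close> the
    mass \<open>X\<close> times 1, times the probability of reaching \<open>v\<close> from
    \<open>par v\<close>, and times that of reaching it from the root. The constant \<open>c\<close>
    is what then balances the identity.\<close>
  define c where "c = (1 - F v * hit_prob M Z (par v) v) / hit_prob M Z rt v"
  have rv: "rt \<notin> T v" using v by (simp add: T_rt)
  have "green p rt v = hit_prob M Z rt v * green p v v" using green_down[OF rv] by simp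
  moreover have "green p rt v > 0" unfolding green_rt using mm_pos ph_pos by simp
  ultimately have h0: "hit_prob M Z rt v \<noteq> 0" by auto
  have main: "measure (nu v) (B w) = F v * measure (nu (par v)) (B w) + c * measure mu (B v \<inter> B w)"
    if w: "depth v < depth w" for w
  proof -
    have wr: "w \<noteq> rt" using w by auto
    have nt: "v \<notin> T w" "par v \<notin> T w" "rt \<notin> T w"
      using T_depth[of v w] T_depth[of "par v" w] w depth_par[OF v] wr by (auto simp: T_rt)
    have wv: "w \<noteq> v" using w by auto
    show ?thesis
    proof (cases "w \<in> T v")
      case True
      then have pw: "par w \<in> T v" using T_rec[OF wr] wv by auto
      have i: "B v \<inter> B w = B w" using B_mono[OF True] by auto
      define X where "X = green p v (par w) * p (par w) w - green p v w * p w (par w)"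
      have "measure (nu v) (B w) = X"
        using nu_B[OF wr, of v] nt by (simp add: X_def)
      moreover have "measure (nu (par v)) (B w) = hit_prob M Z (par v) v * X"
        using nu_B[OF wr, of "par v"] nt green_down[OF par_notin_T[OF v] True] green_down[OF par_notin_T[OF v] pw]
        by (simp add: X_def algebra_simps)
      moreover have "measure mu (B w) = hit_prob M Z rt v * X"
        using nu_B[OF wr, of rt] nt green_down[OF rv True] green_down[OF rv pw]
        by (simp add: X_def algebra_simps)
      ultimately show ?thesis using h0 unfolding i c_def by (simp add: field_simps)
    next
      case False
      then have pw: "par w \<notin> T v" using T_rec[OF wr] by auto
      have i: "B v \<inter> B w = {}" using B_disjoint False nt by auto
      have e1: "measure (nu v) (B w) = F v * green p (par v) (par w) * p (par w) w - F v * green p (par v) w * p w (par w)"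
        using nu_B[OF wr, of v] nt green_up[OF v False] green_up[OF v pw] by simp
      have e2: "measure (nu (par v)) (B w) = green p (par v) (par w) * p (par w) w - green p (par v) w * p w (par w)"
        using nu_B[OF wr, of "par v"] nt by simp
      show ?thesis unfolding i e1 e2 by (simp add: algebra_simps)
    qed
  qed
  let ?n = "Suc (depth v)"
  have tot: "(\<Sum>w\<in>lev ?n. measure (nu u) (B w)) = 1" for u
    using measure_B_split[of "nu u" rt ?n] prob_nu[of u] by (simp add: prob_space.finite_measure)
  have mbv: "mb v = (\<Sum>w\<in>lev ?n. measure mu (B v \<inter> B w))"
  proof -
    have "mb v = (\<Sum>w\<in>lev ?n \<inter> T v. measure mu (B v \<inter> B w))"
      using measure_B_split[of mu v ?n] prob_nu B_mono
      by (auto simp: prob_space.finite_measure Int_absorb1 intro!: sum.cong)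
    also have "\<dots> = (\<Sum>w\<in>lev ?n. measure mu (B v \<inter> B w))"
    proof (rule sum.mono_neutral_left)
      show "\<forall>i\<in>lev ?n - lev ?n \<inter> T v. measure mu (B v \<inter> B i) = 0"
      proof
        fix i assume "i \<in> lev ?n - lev ?n \<inter> T v"
        then have "i \<notin> T v" "v \<notin> T i" using T_depth[of v i] by (auto simp: lev_def)
        then have "B v \<inter> B i = {}" by (rule B_disjoint)
        then show "measure mu (B v \<inter> B i) = 0" by simp
      qed
    qed auto
    finally show ?thesis .
  qed
  have "1 = (\<Sum>w\<in>lev ?n. measure (nu v) (B w))" using tot by simp
  also have "\<dots> = (\<Sum>w\<in>lev ?n. F v * measure (nu (par v)) (B w) + c * measure mu (B v \<inter> B w))"
    by (intro sum.cong refl main) (auto simp: lev_def)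
  also have "\<dots> = F v + c * mb v" unfolding mbv by (simp add: sum.distrib sum_distrib_left[symmetric] tot)
  finally have "c = K v" using mb_pos[of v] by (simp add: K_def field_simps)
  then show ?thesis using main[OF w] by simp
qed

lemma K_nonneg: "v \<noteq> rt \<Longrightarrow> 0 \<le> K v"
  unfolding K_def using F_less[of v] mb_pos[of v] by simp

text \<open>Equality is tested only on cylinders deeper than \<open>v\<close>, where
  \<open>nu_deep\<close> applies; these suffice to identify the measures.\<close>

lemma nu_density_step:
  assumes v: "v \<noteq> rt" and D [measurable]: "D \<in> borel_measurable (ends_borel adj rt)" "\<And>x. 0 \<le> D x"
    and nuD: "nu (par v) = density mu (\<lambda>x. ennreal (D x))"
  shows "nu v = density mu (\<lambda>x. ennreal (F v * D x + K v * indicator (B v) x))"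
proof (rule measure_eqI_deep[where N="Suc (depth v)"])
  interpret m: prob_space mu by (rule prob_nu)
  interpret n: prob_space "nu v" by (rule prob_nu)
  interpret n': prob_space "nu (par v)" by (rule prob_nu)
  show "finite_measure (nu v)" by unfold_locales
  fix w assume "Suc (depth v) \<le> depth w"
  then have id: "measure (nu v) (B w) = F v * measure (nu (par v)) (B w) + K v * measure mu (B v \<inter> B w)"
    using nu_deep[OF v] by simp
  have Fn: "0 \<le> F v" using hit_up_pos[OF v] by simp
  have "emeasure (density mu (\<lambda>x. ennreal (F v * D x + K v * indicator (B v) x))) (B w)
    = (\<integral>\<^sup>+x. (ennreal (F v) * ennreal (D x) + ennreal (K v) * indicator (B v) x) * indicator (B w) x \<partial>mu)"
    by (subst emeasure_density)
      (auto intro!: nn_integral_cong simp: ennreal_plus ennreal_mult' Fn K_nonneg[OF v] D ennreal_indicator split: split_indicator)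
  also have "\<dots> = (\<integral>\<^sup>+x. ennreal (F v) * (ennreal (D x) * indicator (B w) x) + ennreal (K v) * indicator (B v \<inter> B w) x \<partial>mu)"
    by (intro nn_integral_cong) (auto split: split_indicator)
  also have "\<dots> = ennreal (F v) * emeasure (nu (par v)) (B w) + ennreal (K v) * emeasure mu (B v \<inter> B w)"
    unfolding nuD by (simp add: nn_integral_add nn_integral_cmult emeasure_density)
  also have "\<dots> = ennreal (measure (nu v) (B w))"
    unfolding id using Fn K_nonneg[OF v]
    by (simp add: m.emeasure_eq_measure n'.emeasure_eq_measure ennreal_mult' ennreal_plus)
  finally show "emeasure (nu v) (B w) = emeasure (density mu (\<lambda>x. ennreal (F v * D x + K v * indicator (B v) x))) (B w)"
    by (simp add: n.emeasure_eq_measure)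
qed auto

text \<open>The bound on the density matters: through it every \<open>mu\<close>-integrable function
  is integrable for all \<open>nu v\<close>, so Poisson integrals are finite and additive.\<close>

lemma nu_density:
  "\<exists>D C. D \<in> borel_measurable (ends_borel adj rt) \<and> (\<forall>x. 0 \<le> D x \<and> D x \<le> C) \<and> nu v = density mu (\<lambda>x. ennreal (D x))"
proof (induction v rule: depth_induct)
  case root
  show ?case by (intro exI[of _ "\<lambda>_. 1"] exI[of _ 1]) (auto simp: density_1)
next
  case (step v)
  then obtain D C where D: "D \<in> borel_measurable (ends_borel adj rt)" "\<And>x. 0 \<le> D x" "\<And>x. D x \<le> C"
    and nuD: "nu (par v) = density mu (\<lambda>x. ennreal (D x))" by blast
  have Fn: "0 \<le> F v" using hit_up_pos[OF step(1)] by simp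
  have "F v * D x + K v * indicator (B v) x \<le> F v * C + K v" for x
    using D(3)[of x] Fn K_nonneg[OF step(1)] by (intro add_mono mult_left_mono) (auto split: split_indicator)
  moreover have "0 \<le> F v * D x + K v * indicator (B v) x" for x
    using D(2)[of x] Fn K_nonneg[OF step(1)] by simp
  moreover have "(\<lambda>x. F v * D x + K v * indicator (B v) x) \<in> borel_measurable (ends_borel adj rt)"
    using D(1) by measurable
  ultimately show ?case using nu_density_step[OF step(1) D(1,2) nuD] by blast
qed

lemma poisson_rec:
  assumes v: "v \<noteq> rt" and f: "integrable mu f"
  shows "poisson nu f v = F v * poisson nu f (par v) + (1 - F v) * ((LINT x:B v|mu. f x) / mb v)"
proof -
  obtain D C where D [measurable]: "D \<in> borel_measurable (ends_borel adj rt)" and D0: "\<And>x. 0 \<le> D x" and DC: "\<And>x. D x \<le> C"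
    and nuD: "nu (par v) = density mu (\<lambda>x. ennreal (D x))" using nu_density by blast
  have fm [measurable]: "f \<in> borel_measurable (ends_borel adj rt)"
    using borel_measurable_integrable[OF f] by (simp cong: measurable_cong_sets)
  have Fn: "0 \<le> F v" using hit_up_pos[OF v] by simp
  have nuv: "nu v = density mu (\<lambda>x. ennreal (F v * D x + K v * indicator (B v) x))"
    by (rule nu_density_step[OF v D D0 nuD])
  have iD: "integrable mu (\<lambda>x. D x * f x)"
  proof (rule Bochner_Integration.integrable_bound[of _ "\<lambda>x. C * f x"])
    have "\<bar>D x\<bar> \<le> \<bar>C\<bar>" for x using D0[of x] DC[of x] by auto
    then show "AE x in mu. norm (D x * f x) \<le> norm (C * f x)" by (auto simp: abs_mult intro!: mult_right_mono)
  qed (use f in auto)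
  have iB: "integrable mu (\<lambda>x. indicator (B v) x * f x)"
    using integrable_mult_indicator[OF _ f, of "B v"] by simp
  have "poisson nu f v = (\<integral>x. (F v * D x + K v * indicator (B v) x) * f x \<partial>mu)"
    unfolding poisson_def nuv using D0 Fn K_nonneg[OF v] by (subst integral_density) auto
  also have "\<dots> = (\<integral>x. F v * (D x * f x) + K v * (indicator (B v) x * f x) \<partial>mu)"
    by (simp add: algebra_simps)
  also have "\<dots> = F v * (\<integral>x. D x * f x \<partial>mu) + K v * (\<integral>x. indicator (B v) x * f x \<partial>mu)"
    using iD iB by simp
  also have "(\<integral>x. D x * f x \<partial>mu) = poisson nu f (par v)"
    unfolding poisson_def nuD using D0 by (subst integral_density) auto
  finally show ?thesis by (simp add: K_def set_lebesgue_integral_def)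
qed

end

section \<open>Conditional expectations on the boundary\<close>

text \<open>The standard process depends on the walk only through \<phi> and \<mu>, so the walk is
  replaced by the properties of this pair.\<close>

locale boundary = rtree adj rt for adj :: "'v \<Rightarrow> 'v \<Rightarrow> bool" and rt :: 'v +
  fixes ph :: "'v \<Rightarrow> real" and mu :: "(nat \<Rightarrow> 'v) measure"
  assumes ph_pos: "\<And>v. 0 < ph v" and ph_dec: "\<And>v. v \<noteq> rt \<Longrightarrow> ph v < ph (par v)"
    and ph_lim: "(ph \<longlongrightarrow> 0) cofinite"
    and prob_mu: "prob_space mu" and sets_mu [simp, measurable_cong]: "sets mu = sets (ends_borel adj rt)"
    and mb_pos: "\<And>v. 0 < measure mu (B v)"
begin

abbreviation "mb v \<equiv> measure mu (B v)"

sublocale prob_space mu by (rule prob_mu)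

lemma space_mu [simp]: "space mu = E"
  using sets_eq_imp_space_eq[OF sets_mu] by simp

lemma B_Int_E [simp]: "B v \<inter> E = B v" using B_subset by blast

lemma mb_ne [simp]: "mb v \<noteq> 0" using mb_pos[of v] by simp

lemma mb_rt [simp]: "measure mu E = 1" using prob_space by simp

lemma ray_lim: "geodesic_ray adj x \<Longrightarrow> (\<lambda>n. ph (x n)) \<longlonglongrightarrow> 0"
proof -
  assume "geodesic_ray adj x"
  then have "inj x" by (simp add: geodesic_ray_def)
  then have "filterlim x cofinite sequentially"
    unfolding filterlim_def le_filter_def eventually_filtermap eventually_cofinite
      cofinite_eq_sequentially[symmetric]
    by (auto dest: finite_vimageI simp: vimage_def)
  then show ?thesis by (rule filterlim_compose[OF ph_lim])
qed

lemma ends_lim: "x \<in> E \<Longrightarrow> (\<lambda>n. ph (x n)) \<longlonglongrightarrow> 0"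
  by (rule ray_lim) (simp add: ends_def)

lemma ultrametric_ph: "ultrametric_element adj rt ph"
  unfolding ultrametric_element_def using ph_pos ph_dec ray_lim by blast

definition A :: "((nat \<Rightarrow> 'v) \<Rightarrow> real) \<Rightarrow> 'v \<Rightarrow> real" where "A f v = (\<integral>x. indicator (B v) x * f x \<partial>mu)"
definition av :: "((nat \<Rightarrow> 'v) \<Rightarrow> real) \<Rightarrow> 'v \<Rightarrow> real" where "av f v = A f v / mb v"
text \<open>On \<open>E\<close>, \<open>En n f\<close> is the conditional expectation of \<open>f\<close> given the first \<open>n\<close> vertices of the ray.\<close>

definition En :: "nat \<Rightarrow> ((nat \<Rightarrow> 'v) \<Rightarrow> real) \<Rightarrow> (nat \<Rightarrow> 'v) \<Rightarrow> real" where
  "En n f x = (\<Sum>v\<in>lev n. av f v * indicator (B v) x)"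

text \<open>Exactly one cylinder of each level contains a given end. A function of
  \<open>x n\<close> is thus a finite combination of indicators, which settles its measurability and
  its integral.\<close>

lemma sum_ind_lev:
  fixes g :: "'v \<Rightarrow> real"
  assumes "x \<in> E"
  shows "(\<Sum>v\<in>lev n. g v * indicator (B v) x) = g (x n)"
proof -
  have "(\<Sum>v\<in>lev n. g v * indicator (B v) x) = (\<Sum>v\<in>lev n. if v = x n then g v else 0)"
    using assms by (intro sum.cong) (auto simp: B_iff lev_def)
  also have "\<dots> = g (x n)"
  proof -
    have "x n \<in> lev n" using assms by (simp add: lev_def ends_par)
    then show ?thesis by (simp add: sum.delta)
  qed
  finally show ?thesis .
qed

lemma En_eq: "x \<in> E \<Longrightarrow> En n f x = av f (x n)"
  unfolding En_def by (rule sum_ind_lev)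

lemma ind_split:
  assumes "depth u \<le> n"
  shows "indicator (B u) x = (\<Sum>w\<in>lev n \<inter> T u. indicat_real (B w) x)"
proof (cases "x \<in> E")
  case False
  then have "x \<notin> B w" for w using B_subset by blast
  then show ?thesis by simp
next
  case True
  have "(\<Sum>w\<in>lev n \<inter> T u. indicat_real (B w) x) = (\<Sum>w\<in>lev n. indicat_real (T u) w * indicat_real (B w) x)"
    by (rule sum.mono_neutral_cong_left) (auto simp: indicator_def)
  also have "\<dots> = indicator (T u) (x n)" by (rule sum_ind_lev[OF True])
  finally show ?thesis using assms ends_T_iff[OF True, of n u] True by (auto simp: indicator_def B_iff)
qed

lemma int_ind: "integrable mu f \<Longrightarrow> integrable mu (\<lambda>x. indicator (B v) x * (f x :: real))"
  using integrable_mult_indicator[of "B v" mu f] by simp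

lemma A_split:
  assumes f: "integrable mu f" and n: "depth u \<le> n"
  shows "A f u = (\<Sum>w\<in>lev n \<inter> T u. A f w)"
proof -
  have "A f u = (\<integral>x. (\<Sum>w\<in>lev n \<inter> T u. indicator (B w) x * f x) \<partial>mu)"
    unfolding A_def ind_split[OF n] by (simp add: sum_distrib_right)
  also have "\<dots> = (\<Sum>w\<in>lev n \<inter> T u. A f w)"
    unfolding A_def using f by (intro Bochner_Integration.integral_sum int_ind)
  finally show ?thesis .
qed

lemma A_ch: "integrable mu f \<Longrightarrow> A f u = (\<Sum>w\<in>ch u. A f w)"
  using A_split[of f u "Suc (depth u)"] by (simp add: ch_eq)

lemma A_one: "A (\<lambda>_. c) v = c * mb v"
  unfolding A_def using B_subset[of v] by (simp add: Int_absorb2)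

lemma mb_split: "depth u \<le> n \<Longrightarrow> mb u = (\<Sum>w\<in>lev n \<inter> T u. mb w)"
  using A_split[of "\<lambda>_. 1" u n] by (simp add: A_one)

lemma mb_ch: "mb u = (\<Sum>w\<in>ch u. mb w)"
  using A_ch[of "\<lambda>_. 1" u] by (simp add: A_one)

lemma A_add: "integrable mu f \<Longrightarrow> integrable mu g \<Longrightarrow> A (\<lambda>x. f x + g x) v = A f v + A g v"
  unfolding A_def by (simp add: distrib_left int_ind)

lemma A_diff: "integrable mu f \<Longrightarrow> integrable mu g \<Longrightarrow> A (\<lambda>x. f x - g x) v = A f v - A g v"
  unfolding A_def by (simp add: right_diff_distrib int_ind)

lemma A_mult: "A (\<lambda>x. c * f x) v = c * A f v"
  unfolding A_def by (simp add: mult.left_commute[of _ c])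

lemma A_mono: "integrable mu f \<Longrightarrow> integrable mu g \<Longrightarrow> (\<And>x. f x \<le> g x) \<Longrightarrow> A f v \<le> A g v"
  unfolding A_def by (intro integral_mono int_ind mult_left_mono) auto

lemma A_nonneg: "(\<And>x. 0 \<le> f x) \<Longrightarrow> 0 \<le> A f v"
  unfolding A_def by (intro integral_nonneg_AE) auto

lemma A_abs: "integrable mu f \<Longrightarrow> \<bar>A f v\<bar> \<le> A (\<lambda>x. \<bar>f x\<bar>) v"
proof -
  have "\<bar>A f v\<bar> \<le> (\<integral>x. \<bar>indicator (B v) x * f x\<bar> \<partial>mu)" unfolding A_def by (rule integral_abs_bound)
  also have "\<dots> = A (\<lambda>x. \<bar>f x\<bar>) v" unfolding A_def by (simp add: abs_mult)
  finally show ?thesis .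
qed

lemma A_rt: "A f rt = (\<integral>x. f x \<partial>mu)"
  unfolding A_def by (intro Bochner_Integration.integral_cong) auto

lemma integral_split: "integrable mu f \<Longrightarrow> (\<integral>x. f x \<partial>mu) = (\<Sum>v\<in>lev n. A f v)"
  using A_split[of f rt n] by (simp add: A_rt)

lemma int_En: "integrable mu (En n f)"
  unfolding En_def by (intro Bochner_Integration.integrable_sum integrable_mult_right integrable_indicator)
    (auto simp: less_top[symmetric])

lemma meas_En [measurable]: "En n f \<in> borel_measurable mu"
  using int_En by blast

lemma En_contract:
  assumes f: "integrable mu f"
  shows "(\<integral>x. \<bar>En n f x\<bar> \<partial>mu) \<le> (\<integral>x. \<bar>f x\<bar> \<partial>mu)"
proof -
  have "(\<integral>x. \<bar>En n f x\<bar> \<partial>mu) = (\<integral>x. (\<Sum>v\<in>lev n. \<bar>av f v\<bar> * indicator (B v) x) \<partial>mu)"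
    by (intro Bochner_Integration.integral_cong refl) (simp only: space_mu En_eq sum_ind_lev)
  also have "\<dots> = (\<Sum>v\<in>lev n. \<bar>av f v\<bar> * mb v)"
    by (subst Bochner_Integration.integral_sum) (auto simp: less_top[symmetric])
  also have "\<dots> = (\<Sum>v\<in>lev n. \<bar>A f v\<bar>)"
    by (intro sum.cong) (auto simp: av_def abs_mult)
  also have "\<dots> \<le> (\<Sum>v\<in>lev n. A (\<lambda>x. \<bar>f x\<bar>) v)"
    using f by (intro sum_mono A_abs)
  also have "\<dots> = (\<integral>x. \<bar>f x\<bar> \<partial>mu)" using f by (intro integral_split[symmetric]) simp
  finally show ?thesis .
qed

lemma En_add: "integrable mu f \<Longrightarrow> integrable mu g \<Longrightarrow> En n (\<lambda>x. f x + g x) x = En n f x + En n g x"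
  unfolding En_def av_def by (simp add: A_add add_divide_distrib distrib_right sum.distrib)

lemma En_diff: "integrable mu f \<Longrightarrow> integrable mu g \<Longrightarrow> En n (\<lambda>x. f x - g x) x = En n f x - En n g x"
  unfolding En_def av_def by (simp add: A_diff diff_divide_distrib left_diff_distrib sum_subtractf)

lemma En_mult: "En n (\<lambda>x. c * f x) x = c * En n f x"
  unfolding En_def av_def by (simp add: A_mult sum_distrib_left mult.assoc)

section \<open>Convergence of the level averages in mean\<close>

text \<open>The functions that are limits in mean of their level averages. They include the cylinder
  indicators and form a linear space closed in \<open>L1\<close>, which is then shown to contain
  every integrable function.\<close>

definition L1conv :: "((nat \<Rightarrow> 'v) \<Rightarrow> real) \<Rightarrow> bool" where
  "L1conv f \<longleftrightarrow> integrable mu f \<and> (\<lambda>n. \<integral>x. \<bar>En n f x - f x\<bar> \<partial>mu) \<longlonglongrightarrow> 0"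

text \<open>An argument with three terms: by the contraction property the averages of
  \<open>f - g\<close> are small uniformly in the level.\<close>

lemma L1conv_approx:
  assumes f: "integrable mu f" and apx: "\<And>e. 0 < e \<Longrightarrow> \<exists>g. L1conv g \<and> (\<integral>x. \<bar>f x - g x\<bar> \<partial>mu) < e"
  shows "L1conv f"
proof -
  have "(\<lambda>n. \<integral>x. \<bar>En n f x - f x\<bar> \<partial>mu) \<longlonglongrightarrow> 0"
  proof (rule LIMSEQ_I)
    fix e :: real assume e: "0 < e"
    obtain g where g: "L1conv g" "(\<integral>x. \<bar>f x - g x\<bar> \<partial>mu) < e / 3" using apx[of "e / 3"] e by auto
    have gi: "integrable mu g" and gl: "(\<lambda>n. \<integral>x. \<bar>En n g x - g x\<bar> \<partial>mu) \<longlonglongrightarrow> 0"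
      using g by (auto simp: L1conv_def)
    obtain N where N: "\<And>n. n \<ge> N \<Longrightarrow> \<bar>\<integral>x. \<bar>En n g x - g x\<bar> \<partial>mu\<bar> < e / 3"
      using LIMSEQ_D[OF gl, of "e / 3"] e by auto
    have "norm ((\<integral>x. \<bar>En n f x - f x\<bar> \<partial>mu) - 0) < e" if "n \<ge> N" for n
    proof -
      have "(\<integral>x. \<bar>En n f x - f x\<bar> \<partial>mu) \<le> (\<integral>x. \<bar>En n (\<lambda>x. f x - g x) x\<bar> + \<bar>En n g x - g x\<bar> + \<bar>f x - g x\<bar> \<partial>mu)"
        by (intro integral_mono Bochner_Integration.integrable_add integrable_abs Bochner_Integration.integrable_diff int_En f gi)
           (simp add: En_diff[OF f gi])
      also have "\<dots> = (\<integral>x. \<bar>En n (\<lambda>x. f x - g x) x\<bar> \<partial>mu) + (\<integral>x. \<bar>En n g x - g x\<bar> \<partial>mu) + (\<integral>x. \<bar>f x - g x\<bar> \<partial>mu)"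
        using f gi int_En by simp
      also have "\<dots> < e"
        using En_contract[of "\<lambda>x. f x - g x" n] f gi g(2) N[OF that] by simp
      finally show ?thesis by simp
    qed
    then show "\<exists>N. \<forall>n\<ge>N. norm ((\<integral>x. \<bar>En n f x - f x\<bar> \<partial>mu) - 0) < e" by blast
  qed
  then show ?thesis using f by (simp add: L1conv_def)
qed

lemma L1conv_add: "L1conv f \<Longrightarrow> L1conv g \<Longrightarrow> L1conv (\<lambda>x. f x + g x)"
proof -
  assume a: "L1conv f" "L1conv g"
  then have f: "integrable mu f" and g: "integrable mu g" by (auto simp: L1conv_def)
  have "(\<lambda>n. (\<integral>x. \<bar>En n f x - f x\<bar> \<partial>mu) + (\<integral>x. \<bar>En n g x - g x\<bar> \<partial>mu)) \<longlonglongrightarrow> 0"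
    using a tendsto_add_zero by (auto simp: L1conv_def)
  then have "(\<lambda>n. \<integral>x. \<bar>En n (\<lambda>x. f x + g x) x - (f x + g x)\<bar> \<partial>mu) \<longlonglongrightarrow> 0"
  proof (rule tendsto_sandwich[OF _ _ tendsto_const, rotated 2])
    show "\<forall>\<^sub>F n in sequentially. (\<integral>x. \<bar>En n (\<lambda>x. f x + g x) x - (f x + g x)\<bar> \<partial>mu)
      \<le> (\<integral>x. \<bar>En n f x - f x\<bar> \<partial>mu) + (\<integral>x. \<bar>En n g x - g x\<bar> \<partial>mu)"
    proof (rule always_eventually, rule allI)
      fix n
      have "(\<integral>x. \<bar>En n (\<lambda>x. f x + g x) x - (f x + g x)\<bar> \<partial>mu) \<le> (\<integral>x. \<bar>En n f x - f x\<bar> + \<bar>En n g x - g x\<bar> \<partial>mu)"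
        using f g by (intro integral_mono) (auto simp: En_add int_En)
      also have "\<dots> = (\<integral>x. \<bar>En n f x - f x\<bar> \<partial>mu) + (\<integral>x. \<bar>En n g x - g x\<bar> \<partial>mu)"
        using f g int_En by simp
      finally show "(\<integral>x. \<bar>En n (\<lambda>x. f x + g x) x - (f x + g x)\<bar> \<partial>mu)
      \<le> (\<integral>x. \<bar>En n f x - f x\<bar> \<partial>mu) + (\<integral>x. \<bar>En n g x - g x\<bar> \<partial>mu)" .
    qed
  qed simp
  then show ?thesis using f g by (simp add: L1conv_def)
qed

lemma L1conv_mult: "L1conv f \<Longrightarrow> L1conv (\<lambda>x. c * f x)"
proof -
  assume a: "L1conv f"
  have "\<bar>En n (\<lambda>x. c * f x) x - c * f x\<bar> = \<bar>c\<bar> * \<bar>En n f x - f x\<bar>" for n x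
    unfolding En_mult by (simp add: abs_mult[symmetric] right_diff_distrib)
  then have "(\<integral>x. \<bar>En n (\<lambda>x. c * f x) x - c * f x\<bar> \<partial>mu) = \<bar>c\<bar> * (\<integral>x. \<bar>En n f x - f x\<bar> \<partial>mu)" for n
    by simp
  moreover have "(\<lambda>n. \<bar>c\<bar> * (\<integral>x. \<bar>En n f x - f x\<bar> \<partial>mu)) \<longlonglongrightarrow> 0"
    using a by (auto simp: L1conv_def intro: tendsto_mult_right_zero)
  ultimately show ?thesis using a by (simp add: L1conv_def)
qed

lemma L1conv_cong: "L1conv f \<Longrightarrow> (\<And>x. x \<in> E \<Longrightarrow> f x = g x) \<Longrightarrow> L1conv g"
proof -
  assume f: "L1conv f" and e: "\<And>x. x \<in> E \<Longrightarrow> f x = g x"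
  have "A f = A g" unfolding A_def using e by (intro ext Bochner_Integration.integral_cong) auto
  then have "En n f = En n g" for n unfolding En_def av_def by simp
  moreover have "integrable mu f = integrable mu g" using e by (intro Bochner_Integration.integrable_cong) auto
  moreover have "(\<integral>x. \<bar>En n g x - f x\<bar> \<partial>mu) = (\<integral>x. \<bar>En n g x - g x\<bar> \<partial>mu)" for n
    using e by (intro Bochner_Integration.integral_cong) auto
  ultimately show ?thesis using f by (simp add: L1conv_def)
qed

lemma L1conv_B: "L1conv (indicat_real (B u))"
proof -
  have "En n (indicat_real (B u)) x = indicat_real (B u) x" if x: "x \<in> E" and n: "depth u \<le> n" for n x
  proof -
    have d: "depth u \<le> depth (x n)" using n x by (simp add: ends_par)
    have "A (indicat_real (B u)) (x n) = indicator (T u) (x n) * mb (x n)"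
    proof (cases "x n \<in> T u")
      case True
      then have "B (x n) \<inter> B u = B (x n)" using B_mono by blast
      then show ?thesis using True by (simp add: A_def indicator_inter_arith[symmetric])
    next
      case False
      moreover have "u \<notin> T (x n)" using T_depth[of u "x n"] False d by auto
      ultimately have "B (x n) \<inter> B u = {}" by (rule B_disjoint[rotated])
      then show ?thesis using False by (simp add: A_def indicator_inter_arith[symmetric])
    qed
    then show ?thesis using ends_T_iff[OF x, of n u] n x by (auto simp: En_eq av_def indicator_def B_iff)
  qed
  then have "(\<integral>x. \<bar>En n (indicat_real (B u)) x - indicat_real (B u) x\<bar> \<partial>mu) = 0" if "depth u \<le> n" for n
    using that by (intro integral_eq_zero_AE) auto
  then have "\<forall>\<^sub>F n in sequentially. (\<integral>x. \<bar>En n (indicat_real (B u)) x - indicat_real (B u) x\<bar> \<partial>mu) = 0"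
    unfolding eventually_sequentially by blast
  then show ?thesis unfolding L1conv_def by (auto intro: tendsto_eventually simp: less_top[symmetric])
qed

text \<open>Dynkin induction from the cylinder sets. For a disjoint union, dominated convergence
  makes the finite partial unions approximate the whole in mean.\<close>

lemma L1conv_indicator: "X \<in> sets mu \<Longrightarrow> L1conv (indicat_real X)"
proof -
  assume "X \<in> sets mu"
  then have X: "X \<in> sigma_sets E (insert {} (B ` {w. 0 \<le> depth w}))"
    unfolding sigma_sets_deep using sets_eb by simp
  have GE: "insert {} (B ` {w. 0 \<le> depth w}) \<subseteq> Pow E" using B_subset by auto
  show ?thesis
    using Int_stable_B[of 0] GE X
  proof (induction X rule: sigma_sets_induct_disjoint)
    case (basic X)
    then show ?case using L1conv_B L1conv_mult[OF L1conv_B[of rt], of 0] by auto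
  next
    case empty
    show ?case using L1conv_mult[OF L1conv_B[of rt], of 0] by simp
  next
    case (compl X)
    have "L1conv (\<lambda>x. indicat_real (B rt) x + (-1) * indicat_real X x)"
      by (intro L1conv_add L1conv_mult L1conv_B compl)
    then show ?case by (rule L1conv_cong) (auto simp: indicator_def)
  next
    case (union X)
    have Xs: "X i \<in> sets mu" for i using union(2) unfolding sets_mu sets_eb sigma_sets_deep by blast
    have fin: "L1conv (\<lambda>x. \<Sum>i<n. indicat_real (X i) x)" for n :: nat
      by (induction n) (use L1conv_mult[OF L1conv_B[of rt], of 0] L1conv_add union(3) in auto)
    have sm: "(\<lambda>n. \<Sum>i<n. indicat_real (X i) x) \<longlonglongrightarrow> indicat_real (\<Union>i. X i) x" for x
      using sums_def indicator_sums[of X] union(1) by (auto simp: disjoint_family_on_def sums_def)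
    have le: "(\<Sum>i<n. indicat_real (X i) x) \<le> 1" for n x
    proof -
      have "incseq (\<lambda>n. \<Sum>i<n. indicat_real (X i) x)" by (intro incseq_SucI) auto
      then have "(\<Sum>i<n. indicat_real (X i) x) \<le> indicat_real (\<Union>i. X i) x" using incseq_le[OF _ sm] by blast
      also have "\<dots> \<le> 1" by simp
      finally show ?thesis .
    qed
    have "(\<lambda>n. \<integral>x. \<bar>indicat_real (\<Union>i. X i) x - (\<Sum>i<n. indicat_real (X i) x)\<bar> \<partial>mu) \<longlonglongrightarrow> (\<integral>x. 0 \<partial>mu)"
    proof (rule integral_dominated_convergence[where w="\<lambda>_. 2"])
      show "AE x in mu. (\<lambda>n. \<bar>indicat_real (\<Union>i. X i) x - (\<Sum>i<n. indicat_real (X i) x)\<bar>) \<longlonglongrightarrow> 0"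
      proof (rule AE_I2)
        fix x
        have "(\<lambda>n. indicat_real (\<Union>i. X i) x - (\<Sum>i<n. indicat_real (X i) x)) \<longlonglongrightarrow> indicat_real (\<Union>i. X i) x - indicat_real (\<Union>i. X i) x"
          by (intro tendsto_diff tendsto_const sm)
        then show "(\<lambda>n. \<bar>indicat_real (\<Union>i. X i) x - (\<Sum>i<n. indicat_real (X i) x)\<bar>) \<longlonglongrightarrow> 0"
          by (intro tendsto_rabs_zero) simp
      qed
      show "AE x in mu. norm \<bar>indicat_real (\<Union>i. X i) x - (\<Sum>i<n. indicat_real (X i) x)\<bar> \<le> 2" for n
      proof (rule AE_I2)
        fix x
        have "0 \<le> (\<Sum>i<n. indicat_real (X i) x)" by (intro sum_nonneg) auto
        moreover have "(\<Sum>i<n. indicat_real (X i) x) \<le> 1" by (rule le)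
        ultimately show "norm \<bar>indicat_real (\<Union>i. X i) x - (\<Sum>i<n. indicat_real (X i) x)\<bar> \<le> 2"
          by (auto simp: indicator_def)
      qed
    qed (use Xs in measurable)
    then have lim: "(\<lambda>n. \<integral>x. \<bar>indicat_real (\<Union>i. X i) x - (\<Sum>i<n. indicat_real (X i) x)\<bar> \<partial>mu) \<longlonglongrightarrow> 0" by simp
    have "integrable mu (indicat_real (\<Union>i. X i))" using Xs by (auto simp: less_top[symmetric])
    then show ?case
    proof (rule L1conv_approx)
      fix e :: real assume "0 < e"
      then obtain n where "(\<integral>x. \<bar>indicat_real (\<Union>i. X i) x - (\<Sum>i<n. indicat_real (X i) x)\<bar> \<partial>mu) < e"
        using LIMSEQ_D[OF lim, of e] by fastforce
      then show "\<exists>g. L1conv g \<and> (\<integral>x. \<bar>indicat_real (\<Union>i. X i) x - g x\<bar> \<partial>mu) < e"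
        using fin by blast
    qed
  qed
qed

lemma L1conv_integrable: "integrable mu f \<Longrightarrow> L1conv f"
proof (induction f rule: integrable_induct)
  case (base X c)
  then show ?case using L1conv_mult[OF L1conv_indicator, of X c] by (simp add: mult.commute)
next
  case (add f g)
  then show ?case by (intro L1conv_add)
next
  case (lim f s)
  have "(\<lambda>i. \<integral>x. \<bar>f x - s i x\<bar> \<partial>mu) \<longlonglongrightarrow> (\<integral>x. 0 \<partial>mu)"
  \<comment> \<open>The simple approximants satisfy
    \<open>\<bar>s i x\<bar> \<le> 2 * \<bar>f x\<bar>\<close>, so the difference is at most three
    times \<open>\<bar>f x\<bar>\<close>.\<close>
  proof (rule integral_dominated_convergence[where w="\<lambda>x. 3 * \<bar>f x\<bar>"])
    show "AE x in mu. (\<lambda>i. \<bar>f x - s i x\<bar>) \<longlonglongrightarrow> 0"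
    proof (rule AE_I2)
      fix x assume "x \<in> space mu"
      then have "(\<lambda>i. f x - s i x) \<longlonglongrightarrow> f x - f x" by (intro tendsto_diff tendsto_const lim)
      then show "(\<lambda>i. \<bar>f x - s i x\<bar>) \<longlonglongrightarrow> 0" by (intro tendsto_rabs_zero) simp
    qed
    show "AE x in mu. norm \<bar>f x - s i x\<bar> \<le> 3 * \<bar>f x\<bar>" for i
    proof (rule AE_I2)
      fix x assume "x \<in> space mu"
      then have "\<bar>s i x\<bar> \<le> 2 * \<bar>f x\<bar>" using lim(3)[of x i] by simp
      then show "norm \<bar>f x - s i x\<bar> \<le> 3 * \<bar>f x\<bar>" by simp
    qed
    show "(\<lambda>x. \<bar>f x - s i x\<bar>) \<in> borel_measurable mu" for i using lim(1)[of i] lim(4) by measurable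
  qed (use lim(4) in auto)
  then have l: "(\<lambda>i. \<integral>x. \<bar>f x - s i x\<bar> \<partial>mu) \<longlonglongrightarrow> 0" by simp
  show ?case
  proof (rule L1conv_approx[OF lim(4)])
    fix e :: real assume "0 < e"
    then obtain i where "(\<integral>x. \<bar>f x - s i x\<bar> \<partial>mu) < e" using LIMSEQ_D[OF l, of e] by fastforce
    then show "\<exists>g. L1conv g \<and> (\<integral>x. \<bar>f x - g x\<bar> \<partial>mu) < e" using lim(5) by blast
  qed
qed

end

section \<open>Variances and the jump kernel\<close>

context rtree begin

section \<open>Sums over the vertices in [0,\<infinity>]\<close>

definition vsum :: "('v \<Rightarrow> ennreal) \<Rightarrow> ennreal" where "vsum g = (\<Sum>n. \<Sum>v\<in>lev n. g v)"

lemma vsum_nn: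
  assumes [measurable]: "\<And>v. g v \<in> borel_measurable N"
  shows "(\<integral>\<^sup>+x. vsum (\<lambda>v. g v x) \<partial>N) = vsum (\<lambda>v. \<integral>\<^sup>+x. g v x \<partial>N)"
  unfolding vsum_def by (subst nn_integral_suminf) (auto simp: nn_integral_sum)

lemma vsum_measurable [measurable (raw)]:
  "(\<And>v. g v \<in> borel_measurable N) \<Longrightarrow> (\<lambda>x. vsum (\<lambda>v. g v x)) \<in> borel_measurable N"
  unfolding vsum_def by measurable

text \<open>Two views of the same sum: the series over levels gives access to partial sums, the
  counting measure to interchange, monotonicity and scaling.\<close>

lemma vsum_count: "vsum g = (\<integral>\<^sup>+v. g v \<partial>count_space UNIV)"
proof -
  have "vsum (\<lambda>w. g w * indicator {w} v) = g v" for v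
  proof -
    have "vsum (\<lambda>w. g w * indicator {w} v) = (\<Sum>n\<in>{depth v}. \<Sum>w\<in>lev n. g w * indicator {w} v)"
      unfolding vsum_def by (rule suminf_finite) (auto simp: lev_def indicator_def intro!: sum.neutral)
    also have "\<dots> = (\<Sum>w\<in>lev (depth v). if w = v then g v else 0)"
      by (auto simp: indicator_def intro!: sum.cong)
    also have "\<dots> = g v"
    proof -
      have "v \<in> lev (depth v)" by (simp add: lev_def)
      then show ?thesis by (simp add: sum.delta)
    qed
    finally show ?thesis .
  qed
  then have "(\<integral>\<^sup>+v. g v \<partial>count_space UNIV) = (\<integral>\<^sup>+v. vsum (\<lambda>w. g w * indicator {w} v) \<partial>count_space UNIV)" by simp
  also have "\<dots> = vsum (\<lambda>w. \<integral>\<^sup>+v. g w * indicator {w} v \<partial>count_space UNIV)"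
    by (rule vsum_nn) simp
  also have "\<dots> = vsum g" by (simp add: nn_integral_cmult)
  finally show ?thesis ..
qed

lemma vsum_swap: "vsum (\<lambda>v. vsum (\<lambda>w. g v w)) = vsum (\<lambda>w. vsum (\<lambda>v. g v w))"
  unfolding vsum_count[of "\<lambda>v. vsum (g v)"] using vsum_nn[of "\<lambda>w v. g v w" "count_space UNIV"]
  by (simp add: vsum_count)

lemma vsum_cmult: "vsum (\<lambda>v. c * g v) = c * vsum g"
  unfolding vsum_count by (rule nn_integral_cmult) simp

lemma vsum_finite: "finite S \<Longrightarrow> (\<And>v. v \<notin> S \<Longrightarrow> g v = 0) \<Longrightarrow> vsum g = (\<Sum>v\<in>S. g v)"
  unfolding vsum_count by (rule nn_integral_count_space') auto

lemma vsum_mono: "(\<And>v. g v \<le> h v) \<Longrightarrow> vsum g \<le> vsum h"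
  unfolding vsum_count by (rule nn_integral_mono) simp

text \<open>The vertices \<open>v\<close> with \<open>x n\<close> in \<open>T v\<close> are exactly
  those on the ray up to time \<open>n\<close>; a sum over the tree thereby becomes a sum along a
  ray.\<close>

lemma vsum_ray:
  assumes x: "x \<in> E"
  shows "vsum (\<lambda>v. g v * indicator (T v) (x n)) = (\<Sum>k\<le>n. g (x k))"
proof -
  have inj: "inj_on x {..n}" by (rule inj_onI) (metis ends_par(4)[OF x])
  have "vsum (\<lambda>v. g v * indicator (T v) (x n)) = (\<Sum>v\<in>x ` {..n}. g v * indicator (T v) (x n))"
  proof (rule vsum_finite)
    fix v assume "v \<notin> x ` {..n}"
    then have "x n \<notin> T v" unfolding ends_T_iff[OF x] by (metis atMost_iff imageI)
    then show "g v * indicator (T v) (x n) = 0" by simp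
  qed simp
  also have "\<dots> = (\<Sum>k\<le>n. g (x k) * indicator (T (x k)) (x n))" 
    unfolding sum.reindex[OF inj] o_def ..
  also have "\<dots> = (\<Sum>k\<le>n. g (x k))" by (intro sum.cong) (auto simp: ends_T[OF x])
  finally show ?thesis .
qed

lemma sum_lev_T_Suc:
  assumes "depth u \<le> n"
  shows "(\<Sum>z\<in>lev (Suc n) \<inter> T u. g z) = (\<Sum>w\<in>lev n \<inter> T u. \<Sum>z\<in>ch w. (g z :: 'b::comm_monoid_add))"
proof -
  have "lev (Suc n) \<inter> T u = (\<Union>w\<in>lev n \<inter> T u. ch w)"
  proof -
    have "z \<in> lev (Suc n) \<inter> T u \<longleftrightarrow> (\<exists>w\<in>lev n \<inter> T u. z \<in> ch w)" for z
    proof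
      assume z: "z \<in> lev (Suc n) \<inter> T u"
      then have "z \<noteq> rt" "z \<noteq> u" using assms by (auto simp: lev_def)
      then have "par z \<in> lev n \<inter> T u" using z depth_par[of z] T_rec[of z u] by (auto simp: lev_def)
      then show "\<exists>w\<in>lev n \<inter> T u. z \<in> ch w" using \<open>z \<noteq> rt\<close> by (auto simp: ch_iff)
    next
      assume "\<exists>w\<in>lev n \<inter> T u. z \<in> ch w"
      then show "z \<in> lev (Suc n) \<inter> T u" using T_rec[of z u] ch_depth[of z] by (auto simp: lev_def ch_iff)
    qed
    then show ?thesis by blast
  qed
  then show ?thesis by (subst sum.UNION_disjoint[symmetric]) (auto simp: fwd ch_iff)
qed

lemma last_common:
  assumes x: "x \<in> E" and y: "y \<in> E" and ne: "x \<noteq> y"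
  obtains n where "last_common x y = x n" "\<And>m. x m = y m \<longleftrightarrow> m \<le> n"
proof -
  have r: "x m \<in> range y \<longleftrightarrow> x m = y m" for m
    using ends_par(4)[OF x] ends_par(4)[OF y] by (metis rangeE rangeI)
  obtain N where N: "x N \<noteq> y N" using ne by blast
  have bd: "m \<le> N" if "x m = y m" for m using ends_agree[OF x y that, of N] N by (meson nat_le_linear)
  define n where "n = (GREATEST m. x m = y m)"
  have n: "x n = y n" unfolding n_def
    by (rule GreatestI_nat[of "\<lambda>m. x m = y m" 0 N]) (use bd ends_par(1)[OF x] ends_par(1)[OF y] in auto)
  have gr: "m \<le> n" if "x m = y m" for m unfolding n_def
    by (rule Greatest_le_nat[of "\<lambda>m. x m = y m" m N]) (use bd that in auto)
  have "x m = y m \<longleftrightarrow> m \<le> n" for m using gr ends_agree[OF x y n] by blast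
  moreover have "last_common x y = x n" unfolding last_common_def r n_def ..
  ultimately show ?thesis using that by blast
qed

end

context boundary begin

section \<open>The jump kernel as a sum over cylinder sets\<close>

definition "iph v = 1 / ph v"
text \<open>For an end through \<open>v\<close>, the ball of radius 1/\<tau> is \<open>B v\<close>
  for \<tau> in an interval of length \<open>kap v\<close>. The predecessor value 0 at the root
  accounts for arbitrarily large radii.\<close>

definition "kap v = iph v - (if v = rt then 0 else iph (par v))"

lemma iph_pos: "0 < iph v" using ph_pos by (simp add: iph_def)

lemma iph_less: "v \<noteq> rt \<Longrightarrow> iph (par v) < iph v"
  using ph_pos ph_dec[of v] by (simp add: iph_def frac_less2)

lemma kap_pos: "0 < kap v" using iph_pos iph_less by (simp add: kap_def)

lemma kap_sum: "x \<in> E \<Longrightarrow> (\<Sum>k\<le>n. kap (x k)) = iph (x n)"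
  by (induction n) (auto simp: kap_def ends_par)

lemma ph_ray_mono:
  assumes x: "x \<in> E" and k: "k \<le> n"
  shows "ph (x n) \<le> ph (x k)"
  using k
proof (induction n rule: dec_induct)
  case (step n)
  then show ?case using ph_dec[of "x (Suc n)"] ends_par(2,3)[OF x, of n] by simp
qed simp

lemma cball_eq:
  assumes x: "x \<in> E" and k: "ph (x k) \<le> r" "k = 0 \<or> r < ph (x (k - 1))"
  shows "end_cball adj rt ph x r = B (x k)"
proof -
  have "end_dist ph x y \<le> r \<longleftrightarrow> y (k) = x k" if y: "y \<in> E" for y
  proof (cases "x = y")
    case True
    have "0 \<le> r" using k(1) ph_pos[of "x k"] by simp
    then show ?thesis using True by (simp add: end_dist_def)
  next
    case False
    obtain n where n: "last_common x y = x n" "\<And>m. x m = y m \<longleftrightarrow> m \<le> n"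
      by (rule last_common[OF x y False]) blast
    have "ph (x n) \<le> r \<longleftrightarrow> k \<le> n"
    proof
      assume le: "ph (x n) \<le> r"
      show "k \<le> n"
      proof (rule ccontr)
        assume "\<not> k \<le> n"
        then have "n \<le> k - 1" "k \<noteq> 0" by auto
        then show False using ph_ray_mono[OF x, of n "k - 1"] le k(2) by auto
      qed
    next
      assume "k \<le> n" then show "ph (x n) \<le> r" using ph_ray_mono[OF x, of k n] k(1) by simp
    qed
    then show ?thesis using False n(1) n(2)[of k] by (auto simp: end_dist_def)
  qed
  then show ?thesis using x by (auto simp: end_cball_def B_iff ends_par)
qed

text \<open>Breakpoints of the step function that sends \<tau> to the ball of radius 1/\<tau> around
  \<open>x\<close>. Its pieces are open on the left and closed on the right because the balls are
  closed.\<close>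

definition "brk x k = (if k = 0 then 0 else iph (x (k - 1)))"

lemma brk_Suc: "brk x (Suc k) = iph (x k)" by (simp add: brk_def)

lemma brk_kap: "x \<in> E \<Longrightarrow> brk x (Suc k) - brk x k = kap (x k)"
  by (cases k) (auto simp: brk_def kap_def ends_par)

lemma brk_le: "x \<in> E \<Longrightarrow> brk x k \<le> brk x (Suc k)"
  using brk_kap[of x k] kap_pos[of "x k"] by simp

lemma brk_nonneg: "0 \<le> brk x k" using iph_pos by (simp add: brk_def less_imp_le)

lemma cball_inv:
  assumes x: "x \<in> E" and t: "brk x k < t" "t \<le> brk x (Suc k)"
  shows "end_cball adj rt ph x (1 / t) = B (x k)"
proof (rule cball_eq[OF x])
  have t0: "0 < t" using t brk_nonneg[of x k] by simp
  show "ph (x k) \<le> 1 / t" using t(2) t0 ph_pos[of "x k"] by (simp add: brk_Suc iph_def field_simps)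
  show "k = 0 \<or> 1 / t < ph (x (k - 1))"
  proof (cases "k = 0")
    case False
    then show ?thesis using t(1) t0 ph_pos[of "x (k - 1)"] by (simp add: brk_def iph_def field_simps)
  qed simp
qed

lemma step_sum:
  assumes x: "x \<in> E" and g: "\<And>k t. brk x k < t \<Longrightarrow> t \<le> brk x (Suc k) \<Longrightarrow> g t = c k"
  shows "indicator {0<..brk x (Suc n)} t * g t = (\<Sum>k\<le>n. indicator {brk x k<..brk x (Suc k)} t * (c k :: real))"
proof (induction n)
  case 0
  then show ?case using g[of 0 t] by (auto simp: brk_def indicator_def)
next
  case (Suc n)
  have "0 \<le> brk x (Suc n)" "brk x (Suc n) \<le> brk x (Suc (Suc n))" using brk_nonneg brk_le[OF x] by auto
  then have "indicator {0<..brk x (Suc (Suc n))} t * g t = indicator {0<..brk x (Suc n)} t * g t + indicator {brk x (Suc n)<..brk x (Suc (Suc n))} t * g t"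
    by (auto simp: indicator_def)
  then show ?case using Suc g[of "Suc n" t] by (auto simp: indicator_def)
qed

lemma kernel_sum:
  assumes x: "x \<in> E" and y: "y \<in> E" and ne: "x \<noteq> y" and n: "last_common x y = x n"
  shows "standard_kernel adj rt ph mu x y = (\<Sum>k\<le>n. kap (x k) / mb (x k))"
proof -
  have "1 / end_dist ph x y = brk x (Suc n)" using ne n by (simp add: end_dist_def brk_Suc iph_def)
  then have "standard_kernel adj rt ph mu x y =
     (\<integral>t. (\<Sum>k\<le>n. indicator {brk x k<..brk x (Suc k)} t * (1 / mb (x k))) \<partial>lborel)"
    unfolding standard_kernel_def set_lebesgue_integral_def
    using step_sum[OF x, of "\<lambda>t. 1 / measure mu (end_cball adj rt ph x (1 / t))" "\<lambda>k. 1 / mb (x k)" n] cball_inv[OF x]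
    by simp
  also have "\<dots> = (\<Sum>k\<le>n. (\<integral>t. indicator {brk x k<..brk x (Suc k)} t * (1 / mb (x k)) \<partial>lborel))"
    by (intro Bochner_Integration.integral_sum integrable_mult_left integrable_real_indicator)
       (auto simp: brk_le[OF x])
  also have "\<dots> = (\<Sum>k\<le>n. kap (x k) / mb (x k))"
    by (intro sum.cong refl) (simp add: brk_le[OF x] brk_kap[OF x])
  finally show ?thesis .
qed

text \<open>Writing the kernel over all vertices with a product of indicators exhibits its symmetry
  and measurability, and lets the double integral be taken term by term.\<close>

lemma kernel_vsum:
  assumes x: "x \<in> E" and y: "y \<in> E" and ne: "x \<noteq> y"
  shows "0 \<le> standard_kernel adj rt ph mu x y"
    "ennreal (standard_kernel adj rt ph mu x y) = vsum (\<lambda>v. ennreal (kap v / mb v * (indicator (B v) x * indicator (B v) y)))"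
proof -
  obtain n where n: "last_common x y = x n" "\<And>m. x m = y m \<longleftrightarrow> m \<le> n"
    by (rule last_common[OF x y ne]) blast
  note k = kernel_sum[OF x y ne n(1)]
  have nn: "0 \<le> kap v / mb v" for v using kap_pos[of v] by simp
  show "0 \<le> standard_kernel adj rt ph mu x y" unfolding k using nn by (intro sum_nonneg) auto
  have "ennreal (standard_kernel adj rt ph mu x y) = (\<Sum>k\<le>n. ennreal (kap (x k) / mb (x k)))"
    unfolding k using nn by (simp add: sum_ennreal)
  also have "\<dots> = vsum (\<lambda>v. ennreal (kap v / mb v) * indicator (T v) (x n))" by (rule vsum_ray[OF x, symmetric])
  also have "\<dots> = vsum (\<lambda>v. ennreal (kap v / mb v * (indicator (B v) x * indicator (B v) y)))"
  proof (rule arg_cong[where f=vsum], rule ext)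
    fix v
    have "x n \<in> T v \<longleftrightarrow> x \<in> B v \<and> y \<in> B v"
      unfolding ends_T_iff[OF x] B_iff using x y n(2)[of "depth v"] ends_par(4)[OF x] ends_par(4)[OF y] by metis
    then show "ennreal (kap v / mb v) * indicator (T v) (x n) = ennreal (kap v / mb v * (indicator (B v) x * indicator (B v) y))"
      by (auto simp: indicator_def)
  qed
  finally show "ennreal (standard_kernel adj rt ph mu x y) = vsum (\<lambda>v. ennreal (kap v / mb v * (indicator (B v) x * indicator (B v) y)))" .
qed

section \<open>Variances on cylinder sets\<close>

abbreviation "sq f \<equiv> \<lambda>x. (f x)\<^sup>2 :: real"

text \<open>The unnormalised variance of \<open>f\<close> on \<open>B u\<close>.
  \<open>chvar\<close> is the contribution of one generation, \<open>levvar\<close> the variance of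
  the level average \<open>En n f\<close>, and \<open>Varnn\<close> the value in [0,\<infinity>]
  that makes sense when \<open>f\<close> is merely integrable.\<close>

definition "Var f u = A (sq f) u - (A f u)\<^sup>2 / mb u"
definition "chvar f u = (\<Sum>w\<in>ch u. mb w * (av f w - av f u)\<^sup>2)"
definition "levvar f u n = (\<Sum>w\<in>lev n \<inter> T u. mb w * (av f w - av f u)\<^sup>2)"
definition "Varnn f u = (\<integral>\<^sup>+x. ennreal (indicator (B u) x * (f x - av f u)\<^sup>2) \<partial>mu)"

lemma L2_D:
  assumes "f \<in> L2 mu"
  shows L2_sq: "integrable mu (sq f)" and L2_L1: "integrable mu f" and L2_meas: "f \<in> borel_measurable mu"
proof -
  show s: "integrable mu (sq f)" and m: "f \<in> borel_measurable mu" using assms by (auto simp: L2_def)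
  show "integrable mu f"
  proof (rule Bochner_Integration.integrable_bound[of _ "\<lambda>x. 1 + (f x)\<^sup>2"])
    have "\<bar>t\<bar> \<le> \<bar>1 + t\<^sup>2\<bar>" for t :: real
    proof -
      have "0 \<le> (\<bar>t\<bar> - 1)\<^sup>2" by simp
      then show ?thesis by (auto simp: power2_eq_square algebra_simps abs_if split: if_splits)
    qed
    then show "AE x in mu. norm (f x) \<le> norm (1 + (f x)\<^sup>2)" by simp
  qed (use s m in auto)
qed

lemma A_av: "A f u = mb u * av f u" by (simp add: av_def)

lemma chvar_nonneg: "0 \<le> chvar f u" unfolding chvar_def by (intro sum_nonneg) auto

text \<open>Steiner's identity; the cross term vanishes because \<open>av f w\<close> is the
  weighted mean of the averages over the children. The centre \<open>c\<close> will be an average in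
  one use and the value of a harmonic function in another.\<close>

lemma chvar_split:
  assumes "integrable mu f"
  shows "(\<Sum>z\<in>ch w. mb z * (av f z - c)\<^sup>2) = chvar f w + mb w * (av f w - c)\<^sup>2"
proof -
  have "(\<Sum>z\<in>ch w. mb z * (av f z - c)\<^sup>2) = (\<Sum>z\<in>ch w. mb z * (av f z - av f w)\<^sup>2 + 2 * (av f w - c) * (mb z * av f z) + mb z * ((av f w - c)\<^sup>2 - 2 * (av f w - c) * av f w))"
    by (intro sum.cong refl) (simp add: power2_eq_square algebra_simps)
  also have "\<dots> = chvar f w + 2 * (av f w - c) * (\<Sum>z\<in>ch w. mb z * av f z) + (\<Sum>z\<in>ch w. mb z) * ((av f w - c)\<^sup>2 - 2 * (av f w - c) * av f w)"
    unfolding chvar_def sum.distrib by (simp add: sum_distrib_left[symmetric] sum_distrib_right[symmetric])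
  also have "(\<Sum>z\<in>ch w. mb z * av f z) = mb w * av f w" using A_ch[OF assms, of w] by (simp add: A_av)
  also have "(\<Sum>z\<in>ch w. mb z) = mb w" by (rule mb_ch[symmetric])
  finally show ?thesis by (simp add: algebra_simps)
qed

text \<open>Orthogonality of martingale increments: passing to the next level adds the
  one-generation variances. Levels above \<open>u\<close> may be included since they do not meet
  \<open>T u\<close>.\<close>

lemma levvar_sum:
  assumes f: "integrable mu f" and n: "depth u \<le> n"
  shows "levvar f u n = (\<Sum>k<n. \<Sum>w\<in>lev k. indicator (T u) w * chvar f w)"
  using n
proof (induction n rule: dec_induct)
  case base
  have "lev (depth u) \<inter> T u = {u}" using T_depth[of _ u] by (fastforce simp: lev_def)
  then have "levvar f u (depth u) = 0" by (simp add: levvar_def)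
  moreover have "(\<Sum>k<depth u. \<Sum>w\<in>lev k. indicator (T u) w * chvar f w) = 0"
    using T_depth[of _ u] by (intro sum.neutral ballI) (force simp: lev_def indicator_def)
  ultimately show ?case by simp
next
  case (step n)
  have "levvar f u (Suc n) = levvar f u n + (\<Sum>w\<in>lev n \<inter> T u. chvar f w)"
    unfolding levvar_def sum_lev_T_Suc[OF step(1)] chvar_split[OF f] by (simp add: sum.distrib)
  also have "(\<Sum>w\<in>lev n \<inter> T u. chvar f w) = (\<Sum>w\<in>lev n. indicator (T u) w * chvar f w)"
    by (rule sum.mono_neutral_cong_left) (auto simp: indicator_def)
  finally show ?case using step by simp
qed

definition "subvar f u = vsum (\<lambda>w. ennreal (indicator (T u) w * chvar f w))"

lemma levvar_subvar:
  assumes f: "integrable mu f" and n: "depth u \<le> n"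
  shows "ennreal (levvar f u n) = (\<Sum>k<n. \<Sum>w\<in>lev k. ennreal (indicator (T u) w * chvar f w))"
  unfolding levvar_sum[OF assms] using chvar_nonneg by (subst sum_ennreal[symmetric]) (auto intro!: sum_nonneg sum.cong simp: sum_ennreal)

lemma levvar_le_subvar: "integrable mu f \<Longrightarrow> depth u \<le> n \<Longrightarrow> ennreal (levvar f u n) \<le> subvar f u"
  unfolding levvar_subvar subvar_def vsum_def by (rule sum_le_suminf) auto

lemma subvar_le:
  assumes f: "integrable mu f" and le: "\<And>n. depth u \<le> n \<Longrightarrow> ennreal (levvar f u n) \<le> C"
  shows "subvar f u \<le> C"
  unfolding subvar_def vsum_def
proof (rule suminf_le_const)
  fix n
  have "(\<Sum>k<n. \<Sum>w\<in>lev k. ennreal (indicator (T u) w * chvar f w)) \<le> (\<Sum>k<max n (depth u). \<Sum>w\<in>lev k. ennreal (indicator (T u) w * chvar f w))"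
    by (rule sum_mono2) auto
  also have "\<dots> \<le> C" using le[of "max n (depth u)"] levvar_subvar[OF f, of u "max n (depth u)"] by simp
  finally show "(\<Sum>k<n. \<Sum>w\<in>lev k. ennreal (indicator (T u) w * chvar f w)) \<le> C" .
qed simp

lemma En_var:
  assumes n: "depth u \<le> n"
  shows "(\<integral>\<^sup>+x. ennreal (indicator (B u) x * (En n f x - av f u)\<^sup>2) \<partial>mu) = ennreal (levvar f u n)"
proof -
  have "(\<integral>\<^sup>+x. ennreal (indicator (B u) x * (En n f x - av f u)\<^sup>2) \<partial>mu) =
    (\<integral>\<^sup>+x. (\<Sum>w\<in>lev n. ennreal (indicator (T u) w * (av f w - av f u)\<^sup>2) * indicator (B w) x) \<partial>mu)"
  proof (rule nn_integral_cong)
    fix x assume "x \<in> space mu"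
    then have x: "x \<in> E" by simp
    have "indicator (B u) x * (En n f x - av f u)\<^sup>2 = (\<Sum>w\<in>lev n. (indicator (T u) w * (av f w - av f u)\<^sup>2) * indicator (B w) x)"
      unfolding sum_ind_lev[OF x] En_eq[OF x] using ends_T_iff[OF x, of n u] n x by (auto simp: indicator_def B_iff)
    from this show "ennreal (indicator (B u) x * (En n f x - av f u)\<^sup>2) = (\<Sum>w\<in>lev n. ennreal (indicator (T u) w * (av f w - av f u)\<^sup>2) * indicator (B w) x)"
    proof -
      assume e: "indicator (B u) x * (En n f x - av f u)\<^sup>2 = (\<Sum>w\<in>lev n. (indicator (T u) w * (av f w - av f u)\<^sup>2) * indicator (B w) x)"
      have "(\<Sum>w\<in>lev n. ennreal (indicator (T u) w * (av f w - av f u)\<^sup>2) * indicator (B w) x)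
        = (\<Sum>w\<in>lev n. ennreal ((indicator (T u) w * (av f w - av f u)\<^sup>2) * indicator (B w) x))"
        by (intro sum.cong refl) (auto simp: indicator_def)
      also have "\<dots> = ennreal (\<Sum>w\<in>lev n. (indicator (T u) w * (av f w - av f u)\<^sup>2) * indicator (B w) x)"
        by (rule sum_ennreal) auto
      finally show ?thesis unfolding e ..
    qed
  qed
  also have "\<dots> = (\<Sum>w\<in>lev n. ennreal (indicator (T u) w * (av f w - av f u)\<^sup>2) * ennreal (mb w))"
    by (subst nn_integral_sum) (auto simp: nn_integral_cmult emeasure_eq_measure)
  also have "\<dots> = ennreal (\<Sum>w\<in>lev n. indicator (T u) w * (mb w * (av f w - av f u)\<^sup>2))"
    by (subst sum_ennreal[symmetric]) (auto simp: ennreal_mult'[symmetric] mult_ac intro!: sum.cong)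
  also have "(\<Sum>w\<in>lev n. indicator (T u) w * (mb w * (av f w - av f u)\<^sup>2)) = levvar f u n"
    unfolding levvar_def by (rule sum.mono_neutral_cong_right) (auto simp: indicator_def)
  finally show ?thesis .
qed

text \<open>Convergence in mean yields almost everywhere convergence along a subsequence, which is
  enough for Fatou's lemma. As \<open>f\<close> need not be square integrable, both sides may be
  infinite.\<close>

lemma Varnn_le_subvar:
  assumes f: "integrable mu f"
  shows "Varnn f u \<le> subvar f u"
proof -
  have "\<exists>r. strict_mono r \<and> (AE x in mu. (\<lambda>n. En (r n) f x - f x) \<longlonglongrightarrow> 0)"
    using L1conv_integrable[OF f] int_En f unfolding L1conv_def
    by (intro tendsto_L1_AE_subseq Bochner_Integration.integrable_diff) auto
  then obtain r where r: "strict_mono r" and ae: "AE x in mu. (\<lambda>n. En (r n) f x - f x) \<longlonglongrightarrow> 0" by blast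
  have "Varnn f u = (\<integral>\<^sup>+x. liminf (\<lambda>n. ennreal (indicator (B u) x * (En (r n) f x - av f u)\<^sup>2)) \<partial>mu)"
    unfolding Varnn_def
  proof (rule nn_integral_cong_AE, use ae in eventually_elim)
    fix x assume "(\<lambda>n. En (r n) f x - f x) \<longlonglongrightarrow> 0"
    then have "(\<lambda>n. En (r n) f x) \<longlonglongrightarrow> f x" by (simp add: LIM_zero_iff)
    then have "(\<lambda>n. ennreal (indicator (B u) x * (En (r n) f x - av f u)\<^sup>2)) \<longlonglongrightarrow> ennreal (indicator (B u) x * (f x - av f u)\<^sup>2)"
      by (intro tendsto_ennrealI tendsto_intros)
    then show "ennreal (indicator (B u) x * (f x - av f u)\<^sup>2) = liminf (\<lambda>n. ennreal (indicator (B u) x * (En (r n) f x - av f u)\<^sup>2))"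
      by (intro lim_imp_Liminf[symmetric]) auto
  qed
  also have "\<dots> \<le> liminf (\<lambda>n. \<integral>\<^sup>+x. ennreal (indicator (B u) x * (En (r n) f x - av f u)\<^sup>2) \<partial>mu)"
    by (rule nn_integral_liminf) measurable
  also have "\<dots> \<le> liminf (\<lambda>n. subvar f u)"
  proof (rule Liminf_mono)
    show "\<forall>\<^sub>F n in sequentially. (\<integral>\<^sup>+x. ennreal (indicator (B u) x * (En (r n) f x - av f u)\<^sup>2) \<partial>mu) \<le> subvar f u"
      using eventually_ge_at_top[of "depth u"]
    proof eventually_elim
      case (elim n)
      then have "depth u \<le> r n" using seq_suble[OF r, of n] by simp
      then show ?case using En_var levvar_le_subvar[OF f] by simp
    qed
  qed
  also have "\<dots> = subvar f u" by (simp add: Liminf_const)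
  finally show ?thesis .
qed

lemma Var_eq:
  assumes "f \<in> L2 mu"
  shows "Varnn f u = ennreal (Var f u)" "0 \<le> Var f u"
proof -
  note s = L2_sq[OF assms] and i = L2_L1[OF assms]
  have e: "(\<lambda>x. indicator (B u) x * (f x - av f u)\<^sup>2) = (\<lambda>x. indicator (B u) x * (f x)\<^sup>2 - (2 * av f u) * (indicator (B u) x * f x) + (av f u)\<^sup>2 * indicator (B u) x)"
    by (rule ext) (simp add: power2_eq_square algebra_simps)
  have ii: "integrable mu (\<lambda>x. indicator (B u) x * (f x - av f u)\<^sup>2)"
    unfolding e using int_ind[OF s, of u] int_ind[OF i, of u] by (auto simp: less_top[symmetric])
  have "(\<integral>x. indicator (B u) x * (f x - av f u)\<^sup>2 \<partial>mu) = A (sq f) u - 2 * av f u * A f u + (av f u)\<^sup>2 * mb u"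
    unfolding e A_def using int_ind[OF s, of u] int_ind[OF i, of u] by (simp add: less_top[symmetric])
  also have "\<dots> = Var f u" by (simp add: Var_def A_av power2_eq_square field_simps)
  finally have v: "(\<integral>x. indicator (B u) x * (f x - av f u)\<^sup>2 \<partial>mu) = Var f u" .
  show "Varnn f u = ennreal (Var f u)" unfolding Varnn_def v[symmetric] by (rule nn_integral_eq_integral[OF ii]) auto
  show "0 \<le> Var f u" unfolding v[symmetric] by (intro integral_nonneg_AE) auto
qed

text \<open>The reverse inequality is Jensen's on each cylinder of level \<open>n\<close>, that is,
  nonnegativity of \<open>Var f w\<close>.\<close>

lemma Varnn_eq_subvar:
  assumes f: "f \<in> L2 mu"
  shows "Varnn f u = subvar f u"
proof (rule antisym)
  note s = L2_sq[OF f] and i = L2_L1[OF f]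
  show "Varnn f u \<le> subvar f u" by (rule Varnn_le_subvar[OF i])
  show "subvar f u \<le> Varnn f u"
  proof (rule subvar_le[OF i])
    fix n assume n: "depth u \<le> n"
    have "levvar f u n = (\<Sum>w\<in>lev n \<inter> T u. (A f w)\<^sup>2 / mb w - 2 * av f u * A f w + (av f u)\<^sup>2 * mb w)"
      unfolding levvar_def by (intro sum.cong refl) (simp add: A_av power2_eq_square field_simps)
    also have "\<dots> = (\<Sum>w\<in>lev n \<inter> T u. (A f w)\<^sup>2 / mb w) - 2 * av f u * A f u + (av f u)\<^sup>2 * mb u"
      unfolding sum.distrib sum_subtractf A_split[OF i n] mb_split[OF n] sum_distrib_left ..
    also have "\<dots> = (\<Sum>w\<in>lev n \<inter> T u. (A f w)\<^sup>2 / mb w) - (A f u)\<^sup>2 / mb u"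
      by (simp add: A_av power2_eq_square field_simps)
    also have "\<dots> \<le> (\<Sum>w\<in>lev n \<inter> T u. A (sq f) w) - (A f u)\<^sup>2 / mb u"
      using Var_eq(2)[OF f] by (intro diff_right_mono sum_mono) (simp add: Var_def)
    also have "\<dots> = Var f u" unfolding Var_def A_split[OF s n] ..
    finally show "ennreal (levvar f u n) \<le> Varnn f u" unfolding Var_eq(1)[OF f] by (rule ennreal_leI)
  qed
qed

definition "S2 f = vsum (\<lambda>v. ennreal (iph v * chvar f v))"

text \<open>In the exchanged double sum, the one-generation variance at \<open>w\<close> is weighted
  by the increments of 1/\<phi> over all ancestors of \<open>w\<close>, which telescope.\<close>

lemma S2_kap: "vsum (\<lambda>v. ennreal (kap v) * subvar f v) = S2 f"
proof -
  have *: "vsum (\<lambda>v. ennreal (kap v) * indicator (T v) w) = ennreal (iph w)" for w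
  proof -
    \<comment> \<open>Any end through \<open>w\<close> will do; it turns the ancestors of
      \<open>w\<close> into an initial segment of a ray.\<close>
    obtain x where x: "x \<in> E" "x (depth w) = w" using B_ne[of w] by (auto simp: B_iff)
    have "vsum (\<lambda>v. ennreal (kap v) * indicator (T v) (x (depth w))) = (\<Sum>k\<le>depth w. ennreal (kap (x k)))"
      by (rule vsum_ray[OF x(1)])
    also have "\<dots> = ennreal (iph w)"
      using kap_sum[OF x(1), of "depth w"] kap_pos x(2) by (simp add: sum_ennreal less_imp_le)
    finally show ?thesis using x by simp
  qed
  have "vsum (\<lambda>v. ennreal (kap v) * subvar f v) = vsum (\<lambda>w. vsum (\<lambda>v. ennreal (kap v) * ennreal (indicator (T v) w * chvar f w)))"
    unfolding subvar_def vsum_cmult[symmetric] by (rule vsum_swap)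
  also have "\<dots> = vsum (\<lambda>w. vsum (\<lambda>v. ennreal (chvar f w) * (ennreal (kap v) * indicator (T v) w)))"
    by (auto simp: indicator_def mult.commute intro!: arg_cong[where f=vsum] ext)
  also have "\<dots> = vsum (\<lambda>w. ennreal (chvar f w) * vsum (\<lambda>v. ennreal (kap v) * indicator (T v) w))"
    unfolding vsum_cmult ..
  also have "\<dots> = S2 f"
    unfolding *
    unfolding S2_def using iph_pos chvar_nonneg by (simp add: ennreal_mult less_imp_le mult.commute)
  finally show ?thesis .
qed

lemma S2_Var: "f \<in> L2 mu \<Longrightarrow> vsum (\<lambda>v. ennreal (kap v * Var f v)) = S2 f"
  unfolding S2_kap[symmetric] using Var_eq Varnn_eq_subvar kap_pos
  by (auto simp: ennreal_mult' less_imp_le intro!: arg_cong[where f=vsum] ext)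

text \<open>Since 1/\<phi> is smallest at the root, \<open>S2 f\<close> dominates a multiple of
  \<open>subvar f rt\<close>. Only the Fatou direction is used, because \<open>f\<close> is not yet
  known to be square integrable.\<close>

lemma L2_of_S2:
  assumes f: "integrable mu f" and fin: "S2 f < \<infinity>"
  shows "f \<in> L2 mu"
proof -
  have "ennreal (iph rt) * subvar f rt \<le> S2 f"
  proof -
    have "iph rt \<le> iph v" for v
      by (induction v rule: depth_induct) (use iph_less in \<open>auto intro: order_trans less_imp_le\<close>)
    then have "ennreal (iph rt) * subvar f rt \<le> vsum (\<lambda>v. ennreal (iph v * chvar f v))"
      unfolding subvar_def vsum_cmult[symmetric] using iph_pos chvar_nonneg
      by (intro vsum_mono) (auto simp: ennreal_mult'[symmetric] less_imp_le intro!: ennreal_leI mult_right_mono)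
    then show ?thesis by (simp add: S2_def)
  qed
  then have "ennreal (iph rt) * subvar f rt < \<infinity>" using fin by (rule le_less_trans)
  then have "subvar f rt < \<infinity>" using iph_pos[of rt] by (auto simp: ennreal_mult_less_top)
  then have "Varnn f rt < \<infinity>" using Varnn_le_subvar[OF f, of rt] by (rule le_less_trans[rotated])
  moreover have fm: "f \<in> borel_measurable mu" using f by blast
  ultimately have "integrable mu (\<lambda>x. indicator (B rt) x * (f x - av f rt)\<^sup>2)"
    unfolding Varnn_def by (intro integrableI_nonneg) (auto simp del: B_rt)
  then have "integrable mu (\<lambda>x. (f x - av f rt)\<^sup>2)"
    by (rule Bochner_Integration.integrable_cong[THEN iffD1, rotated -1]) auto
  then have "integrable mu (\<lambda>x. (f x - av f rt)\<^sup>2 + 2 * av f rt * f x - (av f rt)\<^sup>2)"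
    using f by auto
  then have "integrable mu (sq f)"
    by (rule Bochner_Integration.integrable_cong[THEN iffD1, rotated -1]) (auto simp: power2_eq_square algebra_simps)
  then show ?thesis using fm by (simp add: L2_def)
qed

end

section \<open>The standard semigroup\<close>

lemma sigma_star_powr:
  assumes "0 < t"
  shows "sigma_star r powr t = (if 0 < r then exp (- (t / r)) else 0)"
  using assms by (auto simp: sigma_star_def powr_def)

lemma sigma_star_mono: "0 < t \<Longrightarrow> x \<le> y \<Longrightarrow> sigma_star x powr t \<le> sigma_star y powr t"
  by (auto simp: sigma_star_powr frac_le)

text \<open>Continuity makes \<open>sigma_t t\<close> free of atoms, so neither the radius 0 nor the
  end points of intervals of radii matter.\<close>

lemma sigma_star_cont:
  assumes t: "0 < t"
  shows "continuous_on UNIV (\<lambda>r. sigma_star r powr t)"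
proof (rule continuous_at_imp_continuous_on, rule ballI)
  fix a :: real
  let ?F = "\<lambda>r. sigma_star r powr t"
  consider "0 < a" | "a < 0" | "a = 0" by linarith
  then show "isCont ?F a"
  proof cases
    case 1
    have "\<forall>\<^sub>F r in nhds a. 0 < r" by (rule eventually_nhds_in_open[of "{0<..}", simplified]) (use 1 in auto)
    then have "\<forall>\<^sub>F r in nhds a. ?F r = exp (- (t / r))" by eventually_elim (simp add: sigma_star_powr t)
    then have "isCont ?F a = isCont (\<lambda>r. exp (- (t / r))) a" by (rule isCont_cong)
    then show ?thesis using 1 by (auto intro!: continuous_intros)
  next
    case 2
    have "\<forall>\<^sub>F r in nhds a. r < 0" by (rule eventually_nhds_in_open[of "{..<0}", simplified]) (use 2 in auto)
    then have "\<forall>\<^sub>F r in nhds a. ?F r = 0" by eventually_elim (simp add: sigma_star_powr t)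
    then have "isCont ?F a = isCont (\<lambda>r. 0 :: real) a" by (rule isCont_cong)
    then show ?thesis by simp
  next
    case 3
    have "((\<lambda>r. exp (- (t * inverse r))) \<longlongrightarrow> 0) (at_right 0)"
      by (intro filterlim_compose[OF exp_at_bot] filterlim_compose[OF filterlim_uminus_at_bot_at_top]
          filterlim_tendsto_pos_mult_at_top[OF tendsto_const t] filterlim_inverse_at_top_right)
    moreover have "\<forall>\<^sub>F r in at_right 0. exp (- (t * inverse r)) = ?F r"
      using eventually_at_right_less[of 0] by eventually_elim (simp add: sigma_star_powr t divide_inverse)
    ultimately have "(?F \<longlongrightarrow> 0) (at_right 0)" by (rule Lim_transform_eventually)
    moreover have "(?F \<longlongrightarrow> 0) (at_left 0)"
    proof (rule tendsto_eventually)
      show "\<forall>\<^sub>F r in at_left 0. ?F r = 0"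
        by (auto simp: eventually_at_filter sigma_star_powr t)
    qed
    ultimately have "(?F \<longlongrightarrow> 0) (at 0)" by (simp add: filterlim_split_at)
    then show ?thesis using 3 t by (simp add: isCont_def sigma_star_powr)
  qed
qed

abbreviation "sigma_t t \<equiv> interval_measure (\<lambda>r. sigma_star r powr t)"

lemma sigma_t:
  assumes t: "0 < t"
  shows real_distribution_sigma_t: "real_distribution (sigma_t t)"
    and measure_sigma_t_Iic: "measure (sigma_t t) {..a} = sigma_star a powr t"
    and measure_sigma_t_Ioc: "a \<le> b \<Longrightarrow> measure (sigma_t t) {a<..b} = sigma_star b powr t - sigma_star a powr t"
    and measure_sigma_t_single: "measure (sigma_t t) {a} = 0"
proof -
  let ?F = "\<lambda>r. sigma_star r powr t"
  note m = sigma_star_mono[OF t]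
  have rc: "continuous (at_right a) ?F" for a
    using sigma_star_cont[OF t] by (auto simp: continuous_on_eq_continuous_at continuous_at_imp_continuous_at_within)
  have bot: "(?F \<longlongrightarrow> 0) at_bot"
    by (rule tendsto_eventually) (use eventually_le_at_bot[of 0] in \<open>eventually_elim, simp add: sigma_star_powr t\<close>)
  have "((\<lambda>r. exp (- (t * inverse r))) \<longlongrightarrow> exp (- (t * 0))) at_top"
    by (intro tendsto_intros tendsto_inverse_0_at_top filterlim_ident)
  moreover have "\<forall>\<^sub>F r in at_top. exp (- (t * inverse r)) = ?F r"
    using eventually_gt_at_top[of 0] by eventually_elim (simp add: sigma_star_powr t divide_inverse)
  ultimately have top: "(?F \<longlongrightarrow> 1) at_top" using Lim_transform_eventually by fastforce
  show "real_distribution (sigma_t t)" by (rule real_distribution_interval_measure[OF m rc bot top])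
  show "measure (sigma_t t) {..a} = ?F a" by (rule measure_interval_measure_Iic[OF m rc bot])
  show "a \<le> b \<Longrightarrow> measure (sigma_t t) {a<..b} = ?F b - ?F a" by (rule measure_interval_measure_Ioc[OF _ m rc])
  have "emeasure (sigma_t t) {a..a} = ennreal (?F a - ?F a)"
    by (rule emeasure_interval_measure_Icc[OF _ m sigma_star_cont[OF t]]) simp
  then show "measure (sigma_t t) {a} = 0" by (simp add: measure_def)
qed

context boundary begin

section \<open>Radii and their weights\<close>

definition "es t a = exp (- (t * a :: real))"
text \<open>The mass that \<open>sigma_t t\<close> gives to the radii for which the ball around an
  end through \<open>v\<close> is \<open>B v\<close>; see \<open>radii_measure\<close>. The value 0
  at the root is the limit of 1/r as r tends to \<infinity>.\<close>

definition "wt t v = es t (if v = rt then 0 else iph (par v)) - es t (iph v)"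

lemma es_ph: "0 < t \<Longrightarrow> sigma_star (ph v) powr t = es t (iph v)"
  using ph_pos[of v] by (simp add: sigma_star_powr es_def iph_def)

lemma wt_nonneg: "0 < t \<Longrightarrow> 0 \<le> wt t v"
  using iph_less[of v] iph_pos[of v] by (auto simp: wt_def es_def less_imp_le)

text \<open>From \<open>1 - exp (- s) \<le> s\<close>. Together with \<open>wt_lim\<close> it gives
  the domination needed when \<open>t\<close> tends to 0.\<close>

lemma wt_le:
  assumes t: "0 < t" shows "wt t v \<le> t * kap v"
proof -
  have *: "es t a - es t b \<le> t * (b - a)" if "0 \<le> a" "a \<le> b" for a b
  proof -
    have "es t a - es t b = es t a * (1 - exp (- (t * (b - a))))"
      by (simp add: es_def right_diff_distrib exp_add[symmetric] algebra_simps)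
    also have "\<dots> \<le> 1 * (t * (b - a))"
      using exp_ge_add_one_self[of "- (t * (b - a))"] t that
      by (intro mult_mono) (auto simp: es_def)
    finally show ?thesis by simp
  qed
  show ?thesis
    using *[of 0 "iph v"] *[of "iph (par v)" "iph v"] iph_pos[of v] iph_pos[of "par v"] iph_less[of v]
    by (auto simp: wt_def kap_def less_imp_le)
qed

lemma wt_lim: "((\<lambda>t. wt t v / t) \<longlongrightarrow> kap v) (at_right 0)"
proof -
  have *: "((\<lambda>t. (es t a - 1) / t) \<longlongrightarrow> - a) (at_right 0)" for a
  proof -
    have "((\<lambda>t. exp (- (t * a))) has_real_derivative - a) (at 0)"
      by (auto intro!: derivative_eq_intros)
    then have "((\<lambda>t. (exp (- (t * a)) - 1) / t) \<longlongrightarrow> - a) (at 0)"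
      by (simp add: has_field_derivative_iff)
    then show ?thesis unfolding es_def by (rule tendsto_mono[OF at_le, rotated]) simp
  qed
  have "((\<lambda>t. (es t a - 1) / t - (es t b - 1) / t) \<longlongrightarrow> - a - (- b)) (at_right 0)" for a b
    by (intro tendsto_diff *)
  then have "((\<lambda>t. (es t a - es t b) / t) \<longlongrightarrow> b - a) (at_right 0)" for a b
    by (simp add: diff_divide_distrib[symmetric])
  then show ?thesis unfolding wt_def kap_def .
qed

lemma wt_sum: "x \<in> E \<Longrightarrow> (\<Sum>k\<le>n. wt t (x k)) = 1 - es t (iph (x n))"
  by (induction n) (auto simp: wt_def ends_par es_def)

text \<open>The weights telescope to 1 minus \<open>es t (iph (x n))\<close>, and this defect
  vanishes because \<phi> tends to 0 along the ray.\<close>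

lemma wt_sums:
  assumes t: "0 < t" and x: "x \<in> E"
  shows "(\<lambda>k. wt t (x k)) sums 1"
proof -
  have "filterlim (\<lambda>n. inverse (ph (x n))) at_top sequentially"
    by (rule filterlim_inverse_at_top[OF ends_lim[OF x]]) (simp add: ph_pos)
  then have "(\<lambda>n. exp (- (t * inverse (ph (x n))))) \<longlonglongrightarrow> 0"
    by (intro filterlim_compose[OF exp_at_bot] filterlim_compose[OF filterlim_uminus_at_bot_at_top]
          filterlim_tendsto_pos_mult_at_top[OF tendsto_const t])
  then have "(\<lambda>n. 1 - es t (iph (x n))) \<longlonglongrightarrow> 1 - 0"
    unfolding es_def iph_def by (intro tendsto_intros) (simp add: divide_inverse)
  then show ?thesis unfolding sums_def_le wt_sum[OF x] by simp
qed

text \<open>These intervals partition the positive radii; they are closed on the left because the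
  balls are closed.\<close>

definition "radii x k = (if k = 0 then {ph (x 0)..} else {ph (x k)..<ph (x (k - 1))})"

lemma radii_measure:
  assumes t: "0 < t" and x: "x \<in> E"
  shows "measure (sigma_t t) (radii x k) = wt t (x k)"
proof -
  interpret N: real_distribution "sigma_t t" by (rule real_distribution_sigma_t[OF t])
  show ?thesis
  proof (cases k)
    case 0
    have "measure (sigma_t t) {ph rt..} = measure (sigma_t t) ({ph rt} \<union> (UNIV - {..ph rt}))"
      by (rule arg_cong[where f="measure (sigma_t t)"]) auto
    also have "\<dots> = measure (sigma_t t) {ph rt} + measure (sigma_t t) (UNIV - {..ph rt})"
      by (rule N.finite_measure_Union) auto
    also have "measure (sigma_t t) (UNIV - {..ph rt}) = 1 - measure (sigma_t t) {..ph rt}"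
      using N.prob_compl[of "{..ph rt}"] by simp
    finally show ?thesis using 0 t x
      by (simp add: radii_def measure_sigma_t_single measure_sigma_t_Iic es_ph wt_def ends_par es_def)
  next
    case (Suc n)
    have lt: "ph (x (Suc n)) < ph (x n)" using ph_dec[of "x (Suc n)"] ends_par(2,3)[OF x, of n] by simp
    let ?a = "ph (x (Suc n))" and ?b = "ph (x n)"
    have "measure (sigma_t t) {?a..<?b} + measure (sigma_t t) {?b} = measure (sigma_t t) ({?a..<?b} \<union> {?b})"
      by (rule N.finite_measure_Union[symmetric]) auto
    also have "{?a..<?b} \<union> {?b} = {?a} \<union> {?a<..?b}" using lt by auto
    also have "measure (sigma_t t) \<dots> = measure (sigma_t t) {?a} + measure (sigma_t t) {?a<..?b}"
      by (rule N.finite_measure_Union) auto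
    finally have "measure (sigma_t t) {?a..<?b} = es t (iph (x n)) - es t (iph (x (Suc n)))"
      using t lt by (simp add: measure_sigma_t_single measure_sigma_t_Ioc es_ph)
    then show ?thesis using Suc ends_par(2,3)[OF x, of n] by (simp add: radii_def wt_def)
  qed
qed

lemma radii_sets [measurable]: "radii x k \<in> sets borel" by (simp add: radii_def)

lemma radii_cball:
  assumes x: "x \<in> E" and r: "r \<in> radii x k"
  shows "ball_average adj rt ph mu r f x = av f (x k)"
proof -
  have "end_cball adj rt ph x r = B (x k)"
    by (rule cball_eq[OF x]) (use r in \<open>auto simp: radii_def split: if_splits\<close>)
  then show ?thesis by (simp add: ball_average_def av_def A_def set_lebesgue_integral_def)
qed

lemma radii_ex1:
  assumes x: "x \<in> E" and r: "0 < r"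
  obtains k where "\<And>j. r \<in> radii x j \<longleftrightarrow> j = k"
proof -
  obtain N where N: "ph (x N) < r"
    using order_tendstoD(2)[OF ends_lim[OF x] r] by (auto simp: eventually_sequentially)
  define k where "k = (LEAST k. ph (x k) \<le> r)"
  have k: "ph (x k) \<le> r" unfolding k_def by (rule LeastI[of _ N]) (use N in simp)
  have k': "r < ph (x j)" if "j < k" for j using not_less_Least[of j "\<lambda>k. ph (x k) \<le> r"] that by (auto simp: k_def)
  have "r \<in> radii x j \<longleftrightarrow> j = k" for j
  proof
    assume j: "r \<in> radii x j"
    then have a: "ph (x j) \<le> r" by (auto simp: radii_def split: if_splits)
    then have "k \<le> j" using k' by (meson leD not_le_imp_less)
    moreover have "\<not> k < j"
    proof
      assume "k < j"
      then have "j \<noteq> 0" "k \<le> j - 1" by auto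
      then have "ph (x (j - 1)) \<le> r" using ph_ray_mono[OF x, of k "j - 1"] k by simp
      then show False using j \<open>j \<noteq> 0\<close> by (auto simp: radii_def)
    qed
    ultimately show "j = k" by simp
  next
    assume "j = k"
    then show "r \<in> radii x j" using k k'[of "k - 1"] by (auto simp: radii_def)
  qed
  then show ?thesis using that by blast
qed

abbreviation "sem \<equiv> standard_semigroup adj rt ph mu"

section \<open>The semigroup as a series along a ray\<close>

text \<open>The ball average is a step function of the radius with infinitely many steps
  accumulating at 0; absolute summability justifies integrating it step by step.\<close>

lemma semigroup_sum:
  assumes t: "0 < t" and x: "x \<in> E" and s: "summable (\<lambda>k. wt t (x k) * \<bar>av f (x k)\<bar>)"
  shows "(\<lambda>k. wt t (x k) * av f (x k)) sums sem t f x"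
proof -
  interpret N: real_distribution "sigma_t t" by (rule real_distribution_sigma_t[OF t])
  define u where "u k r = indicator (radii x k) r * av f (x k)" for k and r :: real
  \<comment> \<open>At radius 0 the ball is the single point \<open>x\<close>, whose mass may be 0.
    The value there is kept as an arbitrary constant and drops out, since the radius 0 has measure
    0.\<close>
  define d where "d = ball_average adj rt ph mu 0 f x"
  have J0: "r \<notin> radii x k" if "r \<le> 0" for r k
    using that ph_pos[of "x k"] by (auto simp: radii_def not_le split: if_splits)
  have fin: "\<exists>S. finite S \<and> (\<forall>k. k \<notin> S \<longrightarrow> u k r = 0)" for r
  proof (cases "0 < r")
    case True
    then obtain k where "\<And>j. r \<in> radii x j \<longleftrightarrow> j = k" using radii_ex1[OF x] by blast
    then show ?thesis by (intro exI[of _ "{k}"]) (auto simp: u_def)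
  next
    case False then show ?thesis using J0 by (intro exI[of _ "{}"]) (auto simp: u_def)
  qed
  have point: "indicator {0..} r * ball_average adj rt ph mu r f x = (\<Sum>k. u k r) + indicator {0} r * d" for r
  proof -
    consider "0 < r" | "r = 0" | "r < 0" by linarith
    then show ?thesis
    proof cases
      case 1
      then obtain k where k: "\<And>j. r \<in> radii x j \<longleftrightarrow> j = k" using radii_ex1[OF x] by blast
      have "(\<Sum>k. u k r) = (\<Sum>k\<in>{k}. u k r)" by (rule suminf_finite) (auto simp: u_def k)
      then show ?thesis using 1 radii_cball[OF x, of r k f] k by (simp add: u_def)
    next
      case 2 then show ?thesis using J0 by (simp add: u_def d_def)
    next
      case 3 then show ?thesis using J0 by (simp add: u_def)
    qed
  qed
  have iu: "integrable (sigma_t t) (u k)" for k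
    unfolding u_def by (intro integrable_mult_left integrable_real_indicator) (auto simp: less_top[symmetric])
  have nu: "(\<integral>r. norm (u k r) \<partial>sigma_t t) = wt t (x k) * \<bar>av f (x k)\<bar>" for k
    unfolding u_def by (simp add: abs_mult radii_measure[OF t x])
  have su: "summable (\<lambda>k. norm (u k r))" for r
  proof -
    obtain S where S: "finite S" "\<And>k. k \<notin> S \<Longrightarrow> u k r = 0" using fin[of r] by auto
    show ?thesis by (rule summable_finite[OF S(1)]) (simp add: S(2))
  qed
  have sn: "summable (\<lambda>k. \<integral>r. norm (u k r) \<partial>sigma_t t)" unfolding nu by (rule s)
  have S: "(\<lambda>k. integral\<^sup>L (sigma_t t) (u k)) sums (\<integral>r. (\<Sum>k. u k r) \<partial>sigma_t t)"
    by (rule sums_integral[OF iu AE_I2[OF su] sn])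
  have I: "integrable (sigma_t t) (\<lambda>r. \<Sum>k. u k r)"
    by (rule integrable_suminf[OF iu AE_I2[OF su] sn])
  have "sem t f x = (\<integral>r. (\<Sum>k. u k r) + indicator {0} r * d \<partial>sigma_t t)"
    unfolding standard_semigroup_def set_lebesgue_integral_def by (simp add: point)
  also have "\<dots> = (\<integral>r. (\<Sum>k. u k r) \<partial>sigma_t t)"
    using I by (subst Bochner_Integration.integral_add) (auto simp: measure_sigma_t_single[OF t] less_top[symmetric])
  finally have "(\<lambda>k. integral\<^sup>L (sigma_t t) (u k)) sums sem t f x" using S by simp
  moreover have "integral\<^sup>L (sigma_t t) (u k) = wt t (x k) * av f (x k)" for k
    unfolding u_def by (simp add: radii_measure[OF t x])
  ultimately show ?thesis by simp
qed

text \<open>Where the series diverges, the integral defining the semigroup takes the junk value 0.\<close>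

lemma semigroup_not_summable:
  assumes t: "0 < t" and x: "x \<in> E" and s: "\<not> summable (\<lambda>k. wt t (x k) * \<bar>av f (x k)\<bar>)"
  shows "sem t f x = 0"
proof -
  interpret N: real_distribution "sigma_t t" by (rule real_distribution_sigma_t[OF t])
  let ?G = "\<lambda>r. indicator {0..} r *\<^sub>R ball_average adj rt ph mu r f x"
  have "\<not> integrable (sigma_t t) ?G"
  proof
    assume G: "integrable (sigma_t t) ?G"
    have "summable (\<lambda>k. wt t (x k) * \<bar>av f (x k)\<bar>)"
    proof (rule summableI_nonneg_bounded)
      fix n
      show "0 \<le> wt t (x n) * \<bar>av f (x n)\<bar>" using wt_nonneg[OF t] by simp
      have i: "integrable (sigma_t t) (\<lambda>r. indicator (radii x k) r * \<bar>av f (x k)\<bar>)" for k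
        by (intro integrable_mult_left integrable_real_indicator) (auto simp: less_top[symmetric])
      have "(\<integral>r. (\<Sum>k<n. indicator (radii x k) r * \<bar>av f (x k)\<bar>) \<partial>sigma_t t) = (\<Sum>k<n. \<integral>r. indicator (radii x k) r * \<bar>av f (x k)\<bar> \<partial>sigma_t t)"
        by (rule Bochner_Integration.integral_sum) (rule i)
      then have "(\<Sum>k<n. wt t (x k) * \<bar>av f (x k)\<bar>) = (\<integral>r. (\<Sum>k<n. indicator (radii x k) r * \<bar>av f (x k)\<bar>) \<partial>sigma_t t)"
        by (simp add: radii_measure[OF t x])
      also have "\<dots> \<le> (\<integral>r. \<bar>?G r\<bar> \<partial>sigma_t t)"
      proof (rule integral_mono)
        show "integrable (sigma_t t) (\<lambda>r. \<Sum>k<n. indicator (radii x k) r * \<bar>av f (x k)\<bar>)"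
          by (intro Bochner_Integration.integrable_sum i)
        show "integrable (sigma_t t) (\<lambda>r. \<bar>?G r\<bar>)" by (rule integrable_abs[OF G])
        show "(\<Sum>k<n. indicator (radii x k) r * \<bar>av f (x k)\<bar>) \<le> \<bar>?G r\<bar>" for r
        proof (cases "\<exists>k. r \<in> radii x k")
          case True
          then obtain j where j: "r \<in> radii x j" by blast
          then have r0: "0 < r" using ph_pos[of "x j"] by (auto simp: radii_def intro: less_le_trans split: if_splits)
          obtain k where k: "\<And>j. r \<in> radii x j \<longleftrightarrow> j = k" using radii_ex1[OF x r0] by blast
          have "(\<Sum>i<n. indicator (radii x i) r * \<bar>av f (x i)\<bar>) = (\<Sum>i<n. if i = k then \<bar>av f (x k)\<bar> else 0)"
            by (intro sum.cong) (auto simp: k indicator_def)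
          also have "\<dots> \<le> \<bar>av f (x k)\<bar>" by simp
          finally show ?thesis using r0 radii_cball[OF x, of r k f] k by simp
        next
          case False
          then have "(\<Sum>k<n. indicator (radii x k) r * \<bar>av f (x k)\<bar>) = 0" by (intro sum.neutral) auto
          then show ?thesis by (simp only: abs_ge_zero)
        qed
      qed
      finally show "(\<Sum>k<n. wt t (x k) * \<bar>av f (x k)\<bar>) \<le> (\<integral>r. \<bar>?G r\<bar> \<partial>sigma_t t)" .
    qed
    then show False using s by blast
  qed
  then show ?thesis unfolding standard_semigroup_def set_lebesgue_integral_def by (rule not_integrable_integral_eq)
qed

text \<open>The semigroup is a pointwise integral without a measurability statement of its own; it
  equals the series where that converges absolutely and 0 elsewhere, a measurable case
  distinction.\<close>

lemma semigroup_meas: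
  assumes t: "0 < t"
  shows "(\<lambda>x. sem t f x) \<in> borel_measurable mu"
proof -
  let ?a = "\<lambda>k x. \<Sum>w\<in>lev k. wt t w * \<bar>av f w\<bar> * indicator (B w) x"
  let ?b = "\<lambda>k x. \<Sum>w\<in>lev k. wt t w * av f w * indicator (B w) x"
  have a0: "0 \<le> ?a k x" for k x using wt_nonneg[OF t] by (intro sum_nonneg mult_nonneg_nonneg) auto
  have "sem t f x = (if (\<Sum>k. ennreal (?a k x)) \<noteq> \<top> then \<Sum>k. ?b k x else 0)" if "x \<in> space mu" for x
  proof -
    have x: "x \<in> E" using that by simp
    have "(\<Sum>k. ennreal (?a k x)) \<noteq> \<top> \<longleftrightarrow> summable (\<lambda>k. ?a k x)"
    proof
      assume "(\<Sum>k. ennreal (?a k x)) \<noteq> \<top>"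
      then show "summable (\<lambda>k. ?a k x)" by (rule summable_suminf_not_top[OF a0])
    next
      assume "summable (\<lambda>k. ?a k x)"
      then show "(\<Sum>k. ennreal (?a k x)) \<noteq> \<top>" by (rule ennreal_suminf_neq_top[OF _ a0])
    qed
    also have "\<dots> \<longleftrightarrow> summable (\<lambda>k. wt t (x k) * \<bar>av f (x k)\<bar>)" unfolding sum_ind_lev[OF x] ..
    finally have iff: "(\<Sum>k. ennreal (?a k x)) \<noteq> \<top> \<longleftrightarrow> summable (\<lambda>k. wt t (x k) * \<bar>av f (x k)\<bar>)" .
    show ?thesis
    proof (cases "summable (\<lambda>k. wt t (x k) * \<bar>av f (x k)\<bar>)")
      case True
      then show ?thesis unfolding iff using semigroup_sum[OF t x True] by (simp only: sum_ind_lev[OF x] sums_iff if_True)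
    next
      case False
      then show ?thesis unfolding iff using semigroup_not_summable[OF t x False] by (simp only: if_False)
    qed
  qed
  moreover have "(\<lambda>x. if (\<Sum>k. ennreal (?a k x)) \<noteq> \<top> then \<Sum>k. ?b k x else 0) \<in> borel_measurable mu"
    by measurable
  ultimately show ?thesis by (subst measurable_cong)
qed

section \<open>Pairing the semigroup with a function\<close>

lemma level_integral:
  assumes "integrable mu h"
  shows "(\<integral>x. (\<Sum>w\<in>lev k. c w * indicator (B w) x) * h x \<partial>mu) = (\<Sum>w\<in>lev k. c w * A h w)"
    "integrable mu (\<lambda>x. (\<Sum>w\<in>lev k. c w * indicator (B w) x) * h x)"
proof -
  have e: "(\<lambda>x. (\<Sum>w\<in>lev k. c w * indicator (B w) x) * h x) = (\<lambda>x. \<Sum>w\<in>lev k. c w * (indicator (B w) x * h x))"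
    by (rule ext) (simp only: sum_distrib_right mult.assoc)
  show "integrable mu (\<lambda>x. (\<Sum>w\<in>lev k. c w * indicator (B w) x) * h x)"
    unfolding e by (intro Bochner_Integration.integrable_sum integrable_mult_right int_ind[OF assms])
  show "(\<integral>x. (\<Sum>w\<in>lev k. c w * indicator (B w) x) * h x \<partial>mu) = (\<Sum>w\<in>lev k. c w * A h w)"
    unfolding e A_def
    by (subst Bochner_Integration.integral_sum) (intro integrable_mult_right int_ind[OF assms], simp)
qed

text \<open>Along each ray the weights add up to 1, so all partial sums are at most the integral of
  \<open>h\<close>.\<close>

lemma summable_wt_integral:
  assumes t: "0 < t" and h: "integrable mu h" and h0: "\<And>x. 0 \<le> h x"
  shows "summable (\<lambda>k. \<Sum>w\<in>lev k. wt t w * A h w)"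
proof (rule summableI_nonneg_bounded)
  fix n
  show "0 \<le> (\<Sum>w\<in>lev n. wt t w * A h w)"
    using wt_nonneg[OF t] A_nonneg[of h] h0 by (intro sum_nonneg mult_nonneg_nonneg) auto
  have "(\<Sum>k<n. \<Sum>w\<in>lev k. wt t w * A h w) = (\<integral>x. (\<Sum>k<n. (\<Sum>w\<in>lev k. wt t w * indicator (B w) x) * h x) \<partial>mu)"
    using level_integral[OF h] by simp
  also have "\<dots> \<le> (\<integral>x. h x \<partial>mu)"
  proof (rule integral_mono)
    show "integrable mu (\<lambda>x. \<Sum>k<n. (\<Sum>w\<in>lev k. wt t w * indicator (B w) x) * h x)"
      using level_integral(2)[OF h] by simp
    fix x assume "x \<in> space mu"
    then have x: "x \<in> E" by simp
    have "(\<Sum>k<n. wt t (x k)) \<le> 1"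
      using wt_sums[OF t x] wt_nonneg[OF t] sum_le_suminf[of "\<lambda>k. wt t (x k)" "{..<n}"] by (auto simp: sums_iff)
    then show "(\<Sum>k<n. (\<Sum>w\<in>lev k. wt t w * indicator (B w) x) * h x) \<le> h x"
      unfolding sum_ind_lev[OF x] using h0[of x] by (simp add: sum_distrib_right[symmetric] mult_left_le_one_le sum_nonneg wt_nonneg[OF t])
  qed (rule h)
  finally show "(\<Sum>k<n. \<Sum>w\<in>lev k. wt t w * A h w) \<le> (\<integral>x. h x \<partial>mu)" .
qed

text \<open>The series has finite integral, hence finite values almost everywhere; the default value
  of the semigroup occurs only on a null set.\<close>

lemma AE_summable:
  assumes t: "0 < t" and f: "integrable mu f"
  shows "AE x in mu. summable (\<lambda>k. wt t (x k) * \<bar>av f (x k)\<bar>)"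
proof -
  let ?a = "\<lambda>k x. \<Sum>w\<in>lev k. wt t w * \<bar>av f w\<bar> * indicator (B w) x"
  have a0: "0 \<le> ?a k x" for k x using wt_nonneg[OF t] by (intro sum_nonneg mult_nonneg_nonneg) auto
  have ia: "integrable mu (?a k)" "(\<integral>x. ?a k x \<partial>mu) = (\<Sum>w\<in>lev k. wt t w * \<bar>A f w\<bar>)" for k
  proof -
    have one: "integrable mu (\<lambda>_. 1 :: real)" by simp
    show "integrable mu (?a k)" using level_integral(2)[OF one] unfolding mult_1_right .
    show "(\<integral>x. ?a k x \<partial>mu) = (\<Sum>w\<in>lev k. wt t w * \<bar>A f w\<bar>)"
      using level_integral(1)[OF one, where c="\<lambda>w. wt t w * \<bar>av f w\<bar>" and k=k] unfolding mult_1_right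
      by (simp only: A_one A_av abs_mult mult_1 mult_ac abs_of_pos[OF mb_pos])
  qed
  have fs: "summable (\<lambda>k. \<Sum>w\<in>lev k. wt t w * A (\<lambda>x. \<bar>f x\<bar>) w)"
    using f by (intro summable_wt_integral[OF t]) auto
  have s: "summable (\<lambda>k. \<integral>x. ?a k x \<partial>mu)"
  proof (rule summable_comparison_test'[OF fs])
    fix n
    have "norm (\<integral>x. ?a n x \<partial>mu) = (\<Sum>w\<in>lev n. wt t w * \<bar>A f w\<bar>)"
      unfolding ia using wt_nonneg[OF t] by (simp add: sum_nonneg)
    also have "\<dots> \<le> (\<Sum>w\<in>lev n. wt t w * A (\<lambda>x. \<bar>f x\<bar>) w)"
      using wt_nonneg[OF t] A_abs[OF f] by (intro sum_mono mult_left_mono) auto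
    finally show "norm (\<integral>x. ?a n x \<partial>mu) \<le> (\<Sum>w\<in>lev n. wt t w * A (\<lambda>x. \<bar>f x\<bar>) w)" .
  qed
  have "(\<integral>\<^sup>+x. (\<Sum>k. ennreal (?a k x)) \<partial>mu) = (\<Sum>k. \<integral>\<^sup>+x. ennreal (?a k x) \<partial>mu)"
    by (rule nn_integral_suminf) measurable
  also have "\<dots> = (\<Sum>k. ennreal (\<integral>x. ?a k x \<partial>mu))"
    using a0 by (intro arg_cong[where f=suminf] ext nn_integral_eq_integral ia) auto
  also have "\<dots> \<noteq> \<infinity>" unfolding infinity_ennreal_def
    by (rule ennreal_suminf_neq_top[OF s]) (intro integral_nonneg_AE AE_I2 a0)
  finally have "AE x in mu. (\<Sum>k. ennreal (?a k x)) \<noteq> \<infinity>"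
    by (rule nn_integral_PInf_AE[rotated]) measurable
  then show ?thesis
    using AE_space
  proof eventually_elim
    case (elim x)
    then have x: "x \<in> E" by simp
    have "summable (\<lambda>k. ?a k x)" using elim(1) a0 by (intro summable_suminf_not_top) auto
    then show ?case unfolding sum_ind_lev[OF x] .
  qed
qed

definition "Cov f g v = A (\<lambda>x. f x * g x) v - A f v * A g v / mb v"

lemma Cov_self: "Cov f f v = Var f v" by (simp add: Cov_def Var_def power2_eq_square)

lemma L2_mult: "f \<in> L2 mu \<Longrightarrow> g \<in> L2 mu \<Longrightarrow> integrable mu (\<lambda>x. f x * g x)"
proof -
  assume f: "f \<in> L2 mu" and g: "g \<in> L2 mu"
  have "\<bar>a * b\<bar> \<le> \<bar>a\<^sup>2 + b\<^sup>2\<bar>" for a b :: real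
    using sum_squares_bound[of a b] sum_squares_bound[of "-a" b] zero_le_power2[of a] zero_le_power2[of b] by (auto simp: abs_if)
  then have ae: "AE x in mu. norm (f x * g x) \<le> norm ((f x)\<^sup>2 + (g x)\<^sup>2)" by (simp only: real_norm_def AE_I2)
  show ?thesis
    by (rule Bochner_Integration.integrable_bound[OF Bochner_Integration.integrable_add[OF L2_sq[OF f] L2_sq[OF g]]
        borel_measurable_times[OF L2_meas[OF f] L2_meas[OF g]] ae])
qed

text \<open>Jensen's inequality for each factor, after a crude form of
  \<open>2 * a * b \<le> a\<^sup>2 + b\<^sup>2\<close>. The constant is irrelevant, as the bound
  only serves as a summable majorant.\<close>

lemma A_cs:
  assumes f: "f \<in> L2 mu" and g: "g \<in> L2 mu"
  shows "\<bar>av f v\<bar> * A (\<lambda>x. \<bar>g x\<bar>) v \<le> A (\<lambda>x. (f x)\<^sup>2 + (g x)\<^sup>2) v"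
proof -
  have g': "(\<lambda>x. \<bar>g x\<bar>) \<in> L2 mu" using g by (auto simp: L2_def)
  let ?a = "A f v" and ?b = "A (\<lambda>x. \<bar>g x\<bar>) v"
  have "\<bar>?a\<bar> * ?b \<le> ?a\<^sup>2 + ?b\<^sup>2" 
  proof -
    have "2 * (\<bar>?a\<bar> * ?b) \<le> ?a\<^sup>2 + ?b\<^sup>2" using sum_squares_bound[of "\<bar>?a\<bar>" ?b] by (simp add: mult.assoc)
    moreover have "0 \<le> ?a\<^sup>2 + ?b\<^sup>2" by simp
    ultimately show ?thesis by linarith
  qed
  then have "\<bar>?a\<bar> * ?b / mb v \<le> (?a\<^sup>2 + ?b\<^sup>2) / mb v" by (intro divide_right_mono) auto
  also have "\<dots> = ?a\<^sup>2 / mb v + ?b\<^sup>2 / mb v" by (simp add: add_divide_distrib)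
  also have "\<dots> \<le> A (sq f) v + A (sq g) v"
    using Var_eq(2)[OF f, of v] Var_eq(2)[OF g', of v] by (intro add_mono) (simp_all add: Var_def)
  also have "\<dots> = A (\<lambda>x. (f x)\<^sup>2 + (g x)\<^sup>2) v" using A_add[OF L2_sq[OF f] L2_sq[OF g]] by simp
  finally show ?thesis by (simp add: av_def)
qed

text \<open>As the weights add up to 1, \<open>f - sem t f\<close> is the series of
  \<open>wt t (x k) * (f x - av f (x k))\<close>. Integrating its \<open>k\<close>-th term against
  \<open>g\<close> gives the covariances on the cylinders of level \<open>k\<close>.\<close>

lemma semigroup_pairing:
  assumes t: "0 < t" and f: "f \<in> L2 mu" and g: "g \<in> L2 mu"
  shows "(\<lambda>k. \<Sum>v\<in>lev k. wt t v * Cov f g v) sums (\<integral>x. (f x - sem t f x) * g x \<partial>mu)"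
proof -
  note f1 = L2_L1[OF f] and g1 = L2_L1[OF g] and fg = L2_mult[OF f g]
  let ?W = "\<lambda>k x. \<Sum>w\<in>lev k. wt t w * indicator (B w) x"
  let ?V = "\<lambda>k x. \<Sum>w\<in>lev k. wt t w * av f w * indicator (B w) x"
  define u where "u k x = ?W k x * (f x * g x) - ?V k x * g x" for k x
  have ux: "u k x = wt t (x k) * (f x - av f (x k)) * g x" if "x \<in> E" for k x
    unfolding u_def sum_ind_lev[OF that] by (simp add: algebra_simps)
  have iu: "integrable mu (u k)" for k
    unfolding u_def[abs_def] by (intro Bochner_Integration.integrable_diff level_integral fg g1)
  have Iu: "integral\<^sup>L mu (u k) = (\<Sum>v\<in>lev k. wt t v * Cov f g v)" for k
  proof -
    have "integral\<^sup>L mu (u k) = (\<integral>x. ?W k x * (f x * g x) \<partial>mu) - (\<integral>x. ?V k x * g x \<partial>mu)"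
      unfolding u_def[abs_def] by (rule Bochner_Integration.integral_diff[OF level_integral(2)[OF fg] level_integral(2)[OF g1]])
    also have "\<dots> = (\<Sum>w\<in>lev k. wt t w * A (\<lambda>x. f x * g x) w) - (\<Sum>w\<in>lev k. wt t w * av f w * A g w)"
      unfolding level_integral(1)[OF fg] level_integral(1)[OF g1] ..
    finally have "integral\<^sup>L mu (u k) = \<dots>" .
    then show ?thesis by (simp add: Cov_def av_def sum_subtractf[symmetric] right_diff_distrib mult.assoc)
  qed
  have su: "AE x in mu. summable (\<lambda>k. norm (u k x))"
    using AE_summable[OF t f1] AE_space
  proof eventually_elim
    case (elim x)
    then have x: "x \<in> E" by simp
    have "summable (\<lambda>k. wt t (x k) * (\<bar>f x\<bar> * \<bar>g x\<bar>) + wt t (x k) * \<bar>av f (x k)\<bar> * \<bar>g x\<bar>)"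
      using wt_sums[OF t x] elim(1) by (intro summable_add summable_mult2) (auto simp: sums_iff)
    then show ?case
    proof (rule summable_comparison_test')
      fix k
      have "\<bar>u k x\<bar> = wt t (x k) * (\<bar>f x - av f (x k)\<bar> * \<bar>g x\<bar>)"
        unfolding ux[OF x] using wt_nonneg[OF t] by (simp add: abs_mult)
      also have "\<dots> \<le> wt t (x k) * ((\<bar>f x\<bar> + \<bar>av f (x k)\<bar>) * \<bar>g x\<bar>)"
        using wt_nonneg[OF t] by (intro mult_left_mono mult_right_mono) auto
      finally show "norm (norm (u k x)) \<le> wt t (x k) * (\<bar>f x\<bar> * \<bar>g x\<bar>) + wt t (x k) * \<bar>av f (x k)\<bar> * \<bar>g x\<bar>"
        by (simp add: algebra_simps)
    qed
  qed
  let ?s = "\<lambda>x. (f x)\<^sup>2 + (g x)\<^sup>2"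
  have iss: "integrable mu ?s" using L2_sq[OF f] L2_sq[OF g] by simp
  have sn: "summable (\<lambda>k. \<integral>x. norm (u k x) \<partial>mu)"
  proof (rule summable_comparison_test')
    show "summable (\<lambda>k. 2 * (\<Sum>w\<in>lev k. wt t w * A ?s w))"
      by (intro summable_mult summable_wt_integral[OF t iss]) simp
    fix k
    have i1: "integrable mu (\<lambda>x. \<bar>f x * g x\<bar>)" and i2: "integrable mu (\<lambda>x. \<bar>g x\<bar>)" using fg g1 by auto
    have "(\<integral>x. \<bar>u k x\<bar> \<partial>mu) \<le> (\<integral>x. ?W k x * \<bar>f x * g x\<bar> + (\<Sum>w\<in>lev k. wt t w * \<bar>av f w\<bar> * indicator (B w) x) * \<bar>g x\<bar> \<partial>mu)"
    proof (rule integral_mono)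
      show "integrable mu (\<lambda>x. ?W k x * \<bar>f x * g x\<bar> + (\<Sum>w\<in>lev k. wt t w * \<bar>av f w\<bar> * indicator (B w) x) * \<bar>g x\<bar>)"
        by (intro Bochner_Integration.integrable_add level_integral i1 i2)
      fix x assume "x \<in> space mu"
      then have x: "x \<in> E" by simp
      have "\<bar>u k x\<bar> = wt t (x k) * (\<bar>f x - av f (x k)\<bar> * \<bar>g x\<bar>)"
        unfolding ux[OF x] using wt_nonneg[OF t] by (simp add: abs_mult)
      also have "\<dots> \<le> wt t (x k) * ((\<bar>f x\<bar> + \<bar>av f (x k)\<bar>) * \<bar>g x\<bar>)"
        using wt_nonneg[OF t] by (intro mult_left_mono mult_right_mono) auto
      finally show "\<bar>u k x\<bar> \<le> ?W k x * \<bar>f x * g x\<bar> + (\<Sum>w\<in>lev k. wt t w * \<bar>av f w\<bar> * indicator (B w) x) * \<bar>g x\<bar>"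
        unfolding sum_ind_lev[OF x] by (simp add: algebra_simps abs_mult)
    qed (use iu in simp)
    also have "\<dots> = (\<Sum>w\<in>lev k. wt t w * A (\<lambda>x. \<bar>f x * g x\<bar>) w) + (\<Sum>w\<in>lev k. wt t w * \<bar>av f w\<bar> * A (\<lambda>x. \<bar>g x\<bar>) w)"
      unfolding Bochner_Integration.integral_add[OF level_integral(2)[OF i1] level_integral(2)[OF i2]]
        level_integral(1)[OF i1] level_integral(1)[OF i2] ..
    also have "\<dots> \<le> (\<Sum>w\<in>lev k. wt t w * A ?s w) + (\<Sum>w\<in>lev k. wt t w * A ?s w)"
    proof (intro add_mono sum_mono)
      fix w
      have "\<bar>a * b\<bar> \<le> a\<^sup>2 + b\<^sup>2" for a b :: real
        using sum_squares_bound[of a b] sum_squares_bound[of "-a" b] zero_le_power2[of a] zero_le_power2[of b] by (auto simp: abs_if)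
      then show "wt t w * A (\<lambda>x. \<bar>f x * g x\<bar>) w \<le> wt t w * A ?s w"
        using wt_nonneg[OF t] i1 iss by (intro mult_left_mono A_mono) auto
      show "wt t w * \<bar>av f w\<bar> * A (\<lambda>x. \<bar>g x\<bar>) w \<le> wt t w * A ?s w"
        using wt_nonneg[OF t] A_cs[OF f g] unfolding mult.assoc by (intro mult_left_mono) auto
    qed
    finally have "(\<integral>x. \<bar>u k x\<bar> \<partial>mu) \<le> 2 * (\<Sum>w\<in>lev k. wt t w * A ?s w)" by simp
    moreover have "0 \<le> (\<integral>x. \<bar>u k x\<bar> \<partial>mu)" by (intro integral_nonneg_AE) auto
    ultimately show "norm (\<integral>x. norm (u k x) \<partial>mu) \<le> 2 * (\<Sum>w\<in>lev k. wt t w * A ?s w)" by simp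
  qed
  have S: "(\<lambda>k. integral\<^sup>L mu (u k)) sums (\<integral>x. (\<Sum>k. u k x) \<partial>mu)"
    by (rule sums_integral[OF iu su sn])
  have I: "integrable mu (\<lambda>x. \<Sum>k. u k x)" by (rule integrable_suminf[OF iu su sn])
  have ae: "AE x in mu. (\<Sum>k. u k x) = (f x - sem t f x) * g x"
    using AE_summable[OF t f1] AE_space
  proof eventually_elim
    case (elim x)
    then have x: "x \<in> E" by simp
    have "(\<lambda>k. (wt t (x k) * f x - wt t (x k) * av f (x k)) * g x) sums ((1 * f x - sem t f x) * g x)"
      by (intro sums_mult2 sums_diff wt_sums[OF t x] semigroup_sum[OF t x elim(1)])
    then show ?case by (simp add: ux[OF x] sums_iff algebra_simps)
  qed
  have "(\<integral>x. (\<Sum>k. u k x) \<partial>mu) = (\<integral>x. (f x - sem t f x) * g x \<partial>mu)"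
    using I ae semigroup_meas[OF t, of f] L2_meas[OF f] L2_meas[OF g]
    by (intro integral_cong_AE borel_measurable_times borel_measurable_diff) auto
  then show ?thesis using S unfolding Iu by simp
qed

section \<open>The standard Dirichlet form\<close>

text \<open>The common quadratic form with which both Dirichlet forms are identified.\<close>

definition "q f = enn2real (S2 f)"
definition "Dom = {f \<in> L2 mu. S2 f < \<infinity>}"
abbreviation "polar Q f g \<equiv> (Q (\<lambda>x. f x + g x) - Q f - Q g) / (2 :: real)"

lemma Var_sums:
  assumes "f \<in> Dom"
  shows "(\<lambda>k. \<Sum>v\<in>lev k. kap v * Var f v) sums q f"
proof -
  have f: "f \<in> L2 mu" and fin: "S2 f < \<infinity>" using assms by (auto simp: Dom_def)
  have n: "0 \<le> kap v * Var f v" for v using kap_pos[of v] Var_eq(2)[OF f, of v] by simp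
  have e: "S2 f = (\<Sum>k. ennreal (\<Sum>v\<in>lev k. kap v * Var f v))"
    unfolding S2_Var[OF f, symmetric] vsum_def using n by (simp add: sum_ennreal)
  have s: "summable (\<lambda>k. \<Sum>v\<in>lev k. kap v * Var f v)"
    by (rule summable_suminf_not_top) (use n fin e in \<open>auto intro!: sum_nonneg\<close>)
  have "S2 f = ennreal (\<Sum>k. \<Sum>v\<in>lev k. kap v * Var f v)"
    unfolding e by (rule suminf_ennreal2) (use n s in \<open>auto intro!: sum_nonneg\<close>)
  then have "q f = (\<Sum>k. \<Sum>v\<in>lev k. kap v * Var f v)"
    unfolding q_def using s n by (simp add: suminf_nonneg sum_nonneg)
  then show ?thesis using s by (simp add: sums_iff)
qed

lemma L2_add: "f \<in> L2 mu \<Longrightarrow> g \<in> L2 mu \<Longrightarrow> (\<lambda>x. f x + g x) \<in> L2 mu"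
proof -
  assume f: "f \<in> L2 mu" and g: "g \<in> L2 mu"
  have "(\<lambda>x. (f x + g x)\<^sup>2) = (\<lambda>x. (f x)\<^sup>2 + 2 * (f x * g x) + (g x)\<^sup>2)" by (rule ext) (simp add: power2_sum)
  then have "integrable mu (\<lambda>x. (f x + g x)\<^sup>2)" using L2_sq[OF f] L2_sq[OF g] L2_mult[OF f g] by simp
  then show ?thesis using L2_meas[OF f] L2_meas[OF g] by (simp add: L2_def)
qed

lemma Cov_add:
  assumes f: "f \<in> L2 mu" and g: "g \<in> L2 mu"
  shows "Var (\<lambda>x. f x + g x) v = Var f v + 2 * Cov f g v + Var g v"
proof -
  have e: "(\<lambda>x. (f x + g x)\<^sup>2) = (\<lambda>x. ((f x)\<^sup>2 + 2 * (f x * g x)) + (g x)\<^sup>2)" by (rule ext) (simp add: power2_sum)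
  have "A (\<lambda>x. (f x + g x)\<^sup>2) v = A (sq f) v + 2 * A (\<lambda>x. f x * g x) v + A (sq g) v"
    unfolding e using L2_sq[OF f] L2_sq[OF g] L2_mult[OF f g] by (simp add: A_add A_mult)
  then show ?thesis
    using A_add[OF L2_L1[OF f] L2_L1[OF g], of v]
    by (simp add: Var_def Cov_def power2_sum add_divide_distrib diff_divide_distrib)
qed

abbreviation "kint f \<equiv> \<lambda>(x, y). (f x - f y)\<^sup>2 * standard_kernel adj rt ph mu x y"
abbreviation "bint f v \<equiv> \<lambda>(x, y). indicator (B v) x * (indicator (B v) y * (f x - f y)\<^sup>2)"

lemma kernel_integrand:
  assumes "z \<in> space (mu \<Otimes>\<^sub>M mu)"
  shows "ennreal (kint f z) =
     vsum (\<lambda>v. ennreal (kap v / mb v) * ennreal (bint f v z))"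
    "0 \<le> kint f z"
proof -
  obtain x y where z: "z = (x, y)" by (cases z)
  then have x: "x \<in> E" and y: "y \<in> E" using assms by (auto simp: space_pair_measure)
  show "ennreal (kint f z) =
     vsum (\<lambda>v. ennreal (kap v / mb v) * ennreal (bint f v z))"
  proof (cases "x = y")
    case True then show ?thesis by (simp add: z vsum_def)
  next
    case False
    have "ennreal ((f x - f y)\<^sup>2 * standard_kernel adj rt ph mu x y) = vsum (\<lambda>v. ennreal ((f x - f y)\<^sup>2) * ennreal (kap v / mb v * (indicator (B v) x * indicator (B v) y)))"
      unfolding vsum_cmult kernel_vsum(2)[OF x y False, symmetric] by (simp add: ennreal_mult')
    also have "\<dots> = vsum (\<lambda>v. ennreal (kap v / mb v) * ennreal (indicator (B v) x * (indicator (B v) y * (f x - f y)\<^sup>2)))"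
      using kap_pos mb_pos by (intro arg_cong[where f=vsum] ext) (simp add: ennreal_mult'[symmetric] mult_ac less_imp_le)
    finally show ?thesis by (simp add: z)
  qed
  show "0 \<le> kint f z"
    using kernel_vsum(1)[OF x y] by (cases "x = y") (auto simp: z)
qed

text \<open>Measurability is inherited from the expansion over cylinder sets, which agrees with the
  integrand at every point of the space.\<close>

lemma kernel_meas:
  assumes [measurable]: "f \<in> borel_measurable mu"
  shows "kint f \<in> borel_measurable (mu \<Otimes>\<^sub>M mu)"
proof -
  have m: "(\<lambda>z. enn2real (vsum (\<lambda>v. ennreal (kap v / mb v) * ennreal (bint f v z)))) \<in> borel_measurable (mu \<Otimes>\<^sub>M mu)"
    by measurable
  have e: "kint f z =
      enn2real (vsum (\<lambda>v. ennreal (kap v / mb v) * ennreal (bint f v z)))"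
    if "z \<in> space (mu \<Otimes>\<^sub>M mu)" for z
    unfolding kernel_integrand(1)[OF that, symmetric] enn2real_ennreal[OF kernel_integrand(2)[OF that]] ..
  show ?thesis by (rule measurable_cong[THEN iffD2, OF e m])
qed

text \<open>The expression of a variance through two independent copies; its factor 2 cancels the
  one half in the standard form.\<close>

lemma pair_Var:
  assumes f: "f \<in> L2 mu"
  shows "(\<integral>\<^sup>+z. ennreal (bint f v z) \<partial>(mu \<Otimes>\<^sub>M mu))
     = ennreal (2 * (mb v * Var f v))"
proof -
  note [measurable] = L2_meas[OF f]
  note s = int_ind[OF L2_sq[OF f], of v] and i = int_ind[OF L2_L1[OF f], of v]
  have one: "integrable mu (\<lambda>x. indicat_real (B v) x)" by (auto simp: less_top[symmetric])
  have m: "(\<lambda>z. ennreal (bint f v z)) \<in> borel_measurable (mu \<Otimes>\<^sub>M mu)"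
    by measurable
  \<comment> \<open>The inner integral as a polynomial in \<open>f x\<close>. It is nonnegative,
    being \<open>mb v\<close> times the squared deviation from the average plus
    \<open>Var f v\<close>.\<close>
  let ?p = "\<lambda>x. (f x)\<^sup>2 * mb v - 2 * f x * A f v + A (sq f) v"
  have inner: "(\<integral>\<^sup>+y. ennreal (indicator (B v) x * (indicator (B v) y * (f x - f y)\<^sup>2)) \<partial>mu) = ennreal (indicator (B v) x * ?p x)" for x
  proof -
    have e: "(\<lambda>y. indicator (B v) x * (indicator (B v) y * (f x - f y)\<^sup>2)) =
      (\<lambda>y. indicator (B v) x * ((f x)\<^sup>2 * indicator (B v) y - 2 * f x * (indicator (B v) y * f y) + indicator (B v) y * (f y)\<^sup>2))"
      by (rule ext) (simp add: power2_eq_square algebra_simps)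
    have "integrable mu (\<lambda>y. indicator (B v) x * (indicator (B v) y * (f x - f y)\<^sup>2))"
      unfolding e using s i one by (intro integrable_mult_right Bochner_Integration.integrable_add Bochner_Integration.integrable_diff)
    then have "(\<integral>\<^sup>+y. ennreal (indicator (B v) x * (indicator (B v) y * (f x - f y)\<^sup>2)) \<partial>mu)
      = ennreal (\<integral>y. indicator (B v) x * (indicator (B v) y * (f x - f y)\<^sup>2) \<partial>mu)"
      by (rule nn_integral_eq_integral) auto
    also have "(\<integral>y. indicator (B v) x * (indicator (B v) y * (f x - f y)\<^sup>2) \<partial>mu) = indicator (B v) x * ?p x"
      unfolding e A_def using s i one by simp
    finally show ?thesis .
  qed
  have "(\<integral>\<^sup>+z. ennreal (bint f v z) \<partial>(mu \<Otimes>\<^sub>M mu))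
     = (\<integral>\<^sup>+x. \<integral>\<^sup>+y. ennreal (indicator (B v) x * (indicator (B v) y * (f x - f y)\<^sup>2)) \<partial>mu \<partial>mu)"
    using nn_integral_fst[OF m, symmetric] by simp
  also have "\<dots> = (\<integral>\<^sup>+x. ennreal (indicator (B v) x * ?p x) \<partial>mu)" unfolding inner ..
  also have "\<dots> = ennreal (\<integral>x. indicator (B v) x * ?p x \<partial>mu)"
  proof (rule nn_integral_eq_integral)
    have e: "(\<lambda>x. indicator (B v) x * ?p x) = (\<lambda>x. mb v * (indicator (B v) x * (f x)\<^sup>2) - 2 * A f v * (indicator (B v) x * f x) + A (sq f) v * indicator (B v) x)"
      by (rule ext) (simp add: algebra_simps)
    show "integrable mu (\<lambda>x. indicator (B v) x * ?p x)"
      unfolding e using s i one by (intro integrable_mult_right Bochner_Integration.integrable_add Bochner_Integration.integrable_diff)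
    have "0 \<le> ?p x" for x
    proof -
      have "?p x = mb v * (f x - av f v)\<^sup>2 + Var f v" by (simp add: Var_def A_av power2_eq_square field_simps)
      then show ?thesis using Var_eq(2)[OF f, of v] by simp
    qed
    then show "AE x in mu. 0 \<le> indicator (B v) x * ?p x" by (intro AE_I2 mult_nonneg_nonneg) auto
  qed
  also have "(\<integral>x. indicator (B v) x * ?p x \<partial>mu) = 2 * (mb v * Var f v)"
  proof -
    have e: "(\<lambda>x. indicator (B v) x * ?p x) = (\<lambda>x. mb v * (indicator (B v) x * (f x)\<^sup>2) - 2 * A f v * (indicator (B v) x * f x) + A (sq f) v * indicator (B v) x)"
      by (rule ext) (simp add: algebra_simps)
    have "(\<integral>x. indicator (B v) x * ?p x \<partial>mu) = mb v * A (sq f) v - 2 * A f v * A f v + A (sq f) v * mb v"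
      unfolding e unfolding A_def using s i one by simp
    then show ?thesis by (simp add: Var_def power2_eq_square right_diff_distrib)
  qed
  finally show ?thesis .
qed

lemma standard_nn:
  assumes f: "f \<in> L2 mu"
  shows "(\<integral>\<^sup>+z. ennreal (kint f z) \<partial>(mu \<Otimes>\<^sub>M mu)) = 2 * S2 f"
proof -
  note [measurable] = L2_meas[OF f]
  let ?g = "\<lambda>v z. ennreal (bint f v z)"
  have "(\<integral>\<^sup>+z. ennreal (kint f z) \<partial>(mu \<Otimes>\<^sub>M mu))
    = (\<integral>\<^sup>+z. vsum (\<lambda>v. ennreal (kap v / mb v) * ?g v z) \<partial>(mu \<Otimes>\<^sub>M mu))"
    by (rule nn_integral_cong) (rule kernel_integrand(1))
  also have "\<dots> = vsum (\<lambda>v. \<integral>\<^sup>+z. ennreal (kap v / mb v) * ?g v z \<partial>(mu \<Otimes>\<^sub>M mu))"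
    by (rule vsum_nn) measurable
  also have "\<dots> = vsum (\<lambda>v. ennreal (kap v / mb v) * (\<integral>\<^sup>+z. ?g v z \<partial>(mu \<Otimes>\<^sub>M mu)))"
    by (intro arg_cong[where f=vsum] ext nn_integral_cmult) measurable
  also have "\<dots> = vsum (\<lambda>v. 2 * ennreal (kap v * Var f v))"
  proof (intro arg_cong[where f=vsum] ext)
    fix v
    have "ennreal (kap v / mb v) * ennreal (2 * (mb v * Var f v)) = ennreal (2 * (kap v * Var f v))"
      using kap_pos[of v] by (simp add: ennreal_mult'[symmetric] less_imp_le mult.left_commute)
    then show "ennreal (kap v / mb v) * (\<integral>\<^sup>+z. ?g v z \<partial>(mu \<Otimes>\<^sub>M mu)) = 2 * ennreal (kap v * Var f v)"
      unfolding pair_Var[OF f] by (simp add: ennreal_mult')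
  qed
  also have "\<dots> = 2 * S2 f" unfolding vsum_cmult S2_Var[OF f] ..
  finally show ?thesis .
qed

lemma standard_domain_eq: "standard_domain adj rt ph mu = Dom"
proof -
  have "integrable (mu \<Otimes>\<^sub>M mu) (kint f) \<longleftrightarrow> S2 f < \<infinity>"
    if f: "f \<in> L2 mu" for f
  proof -
    let ?g = "\<lambda>(x, y). (f x - f y)\<^sup>2 * standard_kernel adj rt ph mu x y"
    have "(\<integral>\<^sup>+z. ennreal (norm (?g z)) \<partial>(mu \<Otimes>\<^sub>M mu)) = (\<integral>\<^sup>+z. ennreal (?g z) \<partial>(mu \<Otimes>\<^sub>M mu))"
      using kernel_integrand(2)[where f=f] by (intro nn_integral_cong) (simp add: abs_of_nonneg)
    also have "\<dots> = 2 * S2 f" by (rule standard_nn[OF f])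
    finally have "integrable (mu \<Otimes>\<^sub>M mu) ?g \<longleftrightarrow> 2 * S2 f < \<infinity>"
      unfolding integrable_iff_bounded using kernel_meas[OF L2_meas[OF f]] by simp
    also have "\<dots> \<longleftrightarrow> S2 f < \<infinity>" by (auto simp: ennreal_mult_less_top ennreal_mult_eq_top_iff less_top)
    finally show ?thesis .
  qed
  then show ?thesis unfolding standard_domain_def Dom_def by blast
qed

lemma standard_form_self:
  assumes "f \<in> Dom"
  shows "standard_form adj rt ph mu f f = q f"
proof -
  have f: "f \<in> L2 mu" using assms by (simp add: Dom_def)
  let ?g = "\<lambda>(x, y). (f x - f y)\<^sup>2 * standard_kernel adj rt ph mu x y"
  have "(\<integral>z. ?g z \<partial>(mu \<Otimes>\<^sub>M mu)) = enn2real (\<integral>\<^sup>+z. ennreal (?g z) \<partial>(mu \<Otimes>\<^sub>M mu))"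
    using kernel_integrand(2)[where f=f] by (intro integral_eq_nn_integral kernel_meas[OF L2_meas[OF f]] AE_I2)
  then have "(\<integral>z. ?g z \<partial>(mu \<Otimes>\<^sub>M mu)) = 2 * q f" unfolding standard_nn[OF f] q_def by (simp add: enn2real_mult)
  then show ?thesis by (simp add: standard_form_def power2_eq_square)
qed

text \<open>Nonnegativity of the variance of \<open>f - g\<close> bounds the covariance term. This
  makes the domain closed under addition, as polarisation requires.\<close>

lemma S2_add:
  assumes f: "f \<in> L2 mu" and g: "g \<in> L2 mu"
  shows "S2 (\<lambda>x. f x + g x) \<le> 2 * S2 f + 2 * S2 g"
proof -
  let ?h = "\<lambda>x. f x + g x" and ?d = "\<lambda>x. f x + (-1) * g x"
  have h: "?h \<in> L2 mu" by (rule L2_add[OF f g])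
  have g': "(\<lambda>x. (-1) * g x) \<in> L2 mu" using g by (auto simp: L2_def)
  have d: "?d \<in> L2 mu" by (rule L2_add[OF f g'])
  have "Var ?h v \<le> 2 * Var f v + 2 * Var g v" for v
  proof -
    have "Var (\<lambda>x. (-1) * g x) v = Var g v" by (simp add: Var_def A_mult[of "-1", simplified])
    moreover have "Cov f (\<lambda>x. (-1) * g x) v = - Cov f g v"
      using A_mult[of "-1" "\<lambda>x. f x * g x" v] A_mult[of "-1" g v] by (simp add: Cov_def)
    ultimately have "0 \<le> Var f v - 2 * Cov f g v + Var g v"
      using Var_eq(2)[OF d, of v] unfolding Cov_add[OF f g'] by simp
    then show ?thesis unfolding Cov_add[OF f g] by simp
  qed
  then have "S2 ?h \<le> vsum (\<lambda>v. ennreal (kap v * (2 * Var f v + 2 * Var g v)))"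
    unfolding S2_Var[OF h, symmetric] using kap_pos by (intro vsum_mono ennreal_leI mult_left_mono) (auto simp: less_imp_le)
  also have "\<dots> = vsum (\<lambda>v. 2 * ennreal (kap v * Var f v) + 2 * ennreal (kap v * Var g v))"
  proof (intro arg_cong[where f=vsum] ext)
    fix v
    have n: "0 \<le> kap v * Var f v" "0 \<le> kap v * Var g v"
      using kap_pos[of v] Var_eq(2)[OF f, of v] Var_eq(2)[OF g, of v] by simp_all
    have "ennreal (kap v * (2 * Var f v + 2 * Var g v)) = ennreal (2 * (kap v * Var f v) + 2 * (kap v * Var g v))"
      by (rule arg_cong[where f=ennreal]) (simp add: algebra_simps)
    also have "\<dots> = ennreal (2 * (kap v * Var f v)) + ennreal (2 * (kap v * Var g v))"
      using n by (intro ennreal_plus) auto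
    finally show "ennreal (kap v * (2 * Var f v + 2 * Var g v)) = 2 * ennreal (kap v * Var f v) + 2 * ennreal (kap v * Var g v)"
      using n by (simp add: ennreal_mult')
  qed
  also have "\<dots> = 2 * S2 f + 2 * S2 g"
    unfolding vsum_count by (subst nn_integral_add) (auto simp: vsum_count[symmetric] vsum_cmult S2_Var[OF f] S2_Var[OF g])
  finally show ?thesis .
qed

lemma Dom_add: "f \<in> Dom \<Longrightarrow> g \<in> Dom \<Longrightarrow> (\<lambda>x. f x + g x) \<in> Dom"
proof -
  assume "f \<in> Dom" "g \<in> Dom"
  then have f: "f \<in> L2 mu" and g: "g \<in> L2 mu" and fin: "S2 f < \<top>" "S2 g < \<top>" by (auto simp: Dom_def)
  have "2 * S2 f + 2 * S2 g < \<top>" using fin by (simp add: ennreal_mult_less_top)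
  then have "S2 (\<lambda>x. f x + g x) < \<top>" by (rule le_less_trans[OF S2_add[OF f g]])
  then show ?thesis using L2_add[OF f g] by (simp add: Dom_def)
qed

lemma standard_form_polar:
  assumes f: "f \<in> Dom" and g: "g \<in> Dom"
  shows "standard_form adj rt ph mu f g = polar q f g"
proof -
  let ?k = "standard_kernel adj rt ph mu"
  let ?g = "\<lambda>f. \<lambda>(x, y). (f x - f y)\<^sup>2 * ?k x y"
  let ?h = "\<lambda>x. f x + g x"
  have i: "integrable (mu \<Otimes>\<^sub>M mu) (?g f)" if "f \<in> Dom" for f
    using that unfolding standard_domain_eq[symmetric] standard_domain_def by simp
  have I: "(\<integral>z. ?g f z \<partial>(mu \<Otimes>\<^sub>M mu)) = 2 * q f" if "f \<in> Dom" for f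
    using standard_form_self[OF that] by (simp add: standard_form_def power2_eq_square)
  have e: "(\<lambda>(x, y). (f x - f y) * (g x - g y) * ?k x y) = (\<lambda>z. (?g ?h z - ?g f z - ?g g z) / 2)"
    by (auto simp: fun_eq_iff power2_eq_square algebra_simps)
  have "(\<integral>z. (\<lambda>(x, y). (f x - f y) * (g x - g y) * ?k x y) z \<partial>(mu \<Otimes>\<^sub>M mu)) = ((\<integral>z. ?g ?h z \<partial>(mu \<Otimes>\<^sub>M mu)) - (\<integral>z. ?g f z \<partial>(mu \<Otimes>\<^sub>M mu)) - (\<integral>z. ?g g z \<partial>(mu \<Otimes>\<^sub>M mu))) / 2"
  proof -
    have "(\<integral>z. (a z - b z - c z) / 2 \<partial>N) = (integral\<^sup>L N a - integral\<^sup>L N b - integral\<^sup>L N c) / 2"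
      if "integrable N a" "integrable N b" "integrable N c" for a b c :: "_ \<Rightarrow> real" and N :: "((nat \<Rightarrow> 'v) \<times> (nat \<Rightarrow> 'v)) measure"
      using that by simp
    from this[OF i[OF Dom_add[OF f g]] i[OF f] i[OF g]] show ?thesis unfolding e .
  qed
  then show ?thesis unfolding I[OF f] I[OF g] I[OF Dom_add[OF f g]] standard_form_def by simp
qed

section \<open>The limit of small times\<close>

abbreviation "apx t f g \<equiv> (\<integral>x. (f x - sem t f x) * g x \<partial>mu) / t"

lemma apx_sums:
  assumes t: "0 < t" and f: "f \<in> L2 mu"
  shows "(\<lambda>k. \<Sum>v\<in>lev k. wt t v / t * Var f v) sums apx t f f"
  using sums_divide[OF semigroup_pairing[OF t f f], of t]
  by (simp add: Cov_self sum_divide_distrib)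

lemma apx_term_nonneg: "0 < t \<Longrightarrow> f \<in> L2 mu \<Longrightarrow> 0 \<le> (\<Sum>v\<in>lev k. wt t v / t * Var f v)"
  using wt_nonneg[of t] Var_eq(2)[of f] by (intro sum_nonneg mult_nonneg_nonneg) auto

lemma apx_term_lim: "((\<lambda>t. \<Sum>v\<in>lev k. wt t v / t * Var f v) \<longlongrightarrow> (\<Sum>v\<in>lev k. kap v * Var f v)) (at_right 0)"
  by (intro tendsto_intros wt_lim)

text \<open>Dominated convergence for series (Tannery): each \<open>wt t v / t\<close> tends to
  \<open>kap v\<close> and is bounded by it for every positive \<open>t\<close>.\<close>

lemma apx_lim:
  assumes "f \<in> Dom"
  shows "((\<lambda>t. apx t f f) \<longlongrightarrow> q f) (at_right 0)"
proof -
  have f: "f \<in> L2 mu" using assms by (simp add: Dom_def)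
  note s = Var_sums[OF assms]
  let ?a = "\<lambda>k t. \<Sum>v\<in>lev k. wt t v / t * Var f v"
  have bd: "\<bar>?a k t\<bar> \<le> (\<Sum>v\<in>lev k. kap v * Var f v)" if t: "0 < t" for k t
  proof -
    have "?a k t \<le> (\<Sum>v\<in>lev k. kap v * Var f v)"
      using wt_le[OF t] t Var_eq(2)[OF f] by (intro sum_mono mult_right_mono) (auto simp: divide_simps mult.commute)
    then show ?thesis using apx_term_nonneg[OF t f, of k] by simp
  qed
  have "\<forall>\<^sub>F z in (at_top :: nat filter) \<times>\<^sub>F at_right (0::real). 0 < snd z"
    using eventually_compose_filterlim[OF eventually_at_right_less[of "0::real"] filterlim_snd[of "at_right (0::real)" "at_top :: nat filter"]] .
  then have "\<forall>\<^sub>F (k, t) in at_top \<times>\<^sub>F at_right 0. norm (?a k t) \<le> (\<Sum>v\<in>lev k. kap v * Var f v)"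
    by eventually_elim (use bd in auto)
  then have "((\<lambda>t. \<Sum>k. ?a k t) \<longlongrightarrow> (\<Sum>k. \<Sum>v\<in>lev k. kap v * Var f v)) (at_right 0)"
    using tannerys_theorem[of ?a "\<lambda>k. \<Sum>v\<in>lev k. kap v * Var f v" "at_right 0" "\<lambda>k. \<Sum>v\<in>lev k. kap v * Var f v"] apx_term_lim s
    by (auto simp: sums_iff)
  then have "((\<lambda>t. \<Sum>k. ?a k t) \<longlongrightarrow> q f) (at_right 0)" using s by (simp add: sums_iff)
  moreover have "\<forall>\<^sub>F t in at_right 0. (\<Sum>k. ?a k t) = apx t f f"
    using eventually_at_right_less[of 0] by eventually_elim (use apx_sums[OF _ f] in \<open>simp add: sums_iff\<close>)
  ultimately show ?thesis by (rule Lim_transform_eventually)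
qed

text \<open>A Fatou argument: all terms are nonnegative, so every finite partial sum of the limiting
  series is at most \<open>l\<close>.\<close>

lemma apx_lim_Dom:
  assumes f: "f \<in> L2 mu" and l: "((\<lambda>t. apx t f f) \<longlongrightarrow> l) (at_right 0)"
  shows "f \<in> Dom"
proof -
  have le: "(\<Sum>k<n. \<Sum>v\<in>lev k. kap v * Var f v) \<le> l" for n
  proof (rule tendsto_le[OF _ l])
    show "((\<lambda>t. \<Sum>k<n. \<Sum>v\<in>lev k. wt t v / t * Var f v) \<longlongrightarrow> (\<Sum>k<n. \<Sum>v\<in>lev k. kap v * Var f v)) (at_right 0)"
      by (intro tendsto_sum apx_term_lim)
    show "\<forall>\<^sub>F t in at_right 0. (\<Sum>k<n. \<Sum>v\<in>lev k. wt t v / t * Var f v) \<le> apx t f f"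
      using eventually_at_right_less[of 0]
    proof eventually_elim
      case (elim t)
      have "(\<Sum>k<n. \<Sum>v\<in>lev k. wt t v / t * Var f v) \<le> (\<Sum>k. \<Sum>v\<in>lev k. wt t v / t * Var f v)"
        using apx_sums[OF elim f] apx_term_nonneg[OF elim f] by (intro sum_le_suminf) (auto simp: sums_iff)
      then show ?case using apx_sums[OF elim f] by (simp add: sums_iff)
    qed
  qed simp
  have n: "0 \<le> kap v * Var f v" for v using kap_pos[of v] Var_eq(2)[OF f, of v] by simp
  have "S2 f \<le> ennreal l"
    unfolding S2_Var[OF f, symmetric] vsum_def
  proof (rule suminf_le_const)
    fix m
    have "(\<Sum>k<m. \<Sum>v\<in>lev k. ennreal (kap v * Var f v)) = ennreal (\<Sum>k<m. \<Sum>v\<in>lev k. kap v * Var f v)"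
      using n by (simp add: sum_ennreal sum_nonneg)
    also have "\<dots> \<le> ennreal l" by (rule ennreal_leI[OF le])
    finally show "(\<Sum>k<m. \<Sum>v\<in>lev k. ennreal (kap v * Var f v)) \<le> ennreal l" .
  qed simp
  then show ?thesis using f unfolding Dom_def by (auto intro: le_less_trans)
qed

text \<open>Bilinearity and symmetry are read off from the covariance series. The operator itself is
  not treated as pointwise linear, since it takes default values on null sets that depend on the
  function.\<close>

lemma apx_polar:
  assumes t: "0 < t" and f: "f \<in> L2 mu" and g: "g \<in> L2 mu"
  shows "apx t f g = polar (\<lambda>f. apx t f f) f g"
proof -
  have fg: "(\<lambda>x. f x + g x) \<in> L2 mu" by (rule L2_add[OF f g])
  let ?h = "\<lambda>x. f x + g x"
  have "(\<lambda>k. ((\<Sum>v\<in>lev k. wt t v * Cov ?h ?h v) - (\<Sum>v\<in>lev k. wt t v * Cov f f v) - (\<Sum>v\<in>lev k. wt t v * Cov g g v)) / 2)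
    sums (((\<integral>x. (?h x - sem t ?h x) * ?h x \<partial>mu) - (\<integral>x. (f x - sem t f x) * f x \<partial>mu) - (\<integral>x. (g x - sem t g x) * g x \<partial>mu)) / 2)"
    by (intro sums_divide sums_diff semigroup_pairing t f g fg)
  moreover have "((\<Sum>v\<in>lev k. wt t v * Cov ?h ?h v) - (\<Sum>v\<in>lev k. wt t v * Cov f f v) - (\<Sum>v\<in>lev k. wt t v * Cov g g v)) / 2
    = (\<Sum>v\<in>lev k. wt t v * Cov f g v)" for k
    unfolding Cov_self Cov_add[OF f g] sum_subtractf[symmetric] sum_divide_distrib
    by (intro sum.cong refl) (simp add: algebra_simps)
  ultimately have "(\<integral>x. (f x - sem t f x) * g x \<partial>mu) = ((\<integral>x. (?h x - sem t ?h x) * ?h x \<partial>mu) - (\<integral>x. (f x - sem t f x) * f x \<partial>mu) - (\<integral>x. (g x - sem t g x) * g x \<partial>mu)) / 2"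
    using sums_unique2[OF semigroup_pairing[OF t f g]] by simp
  then show ?thesis by (simp add: diff_divide_distrib)
qed

lemma dirichlet_polar:
  assumes E: "\<And>f g. f \<in> Dom \<Longrightarrow> g \<in> Dom \<Longrightarrow> Ef f g = polar q f g"
  shows "dirichlet_form_of_semigroup mu sem Dom Ef"
proof -
  have "Dom = {f \<in> L2 mu. \<exists>l. ((\<lambda>t. apx t f f) \<longlongrightarrow> l) (at_right 0)}"
  proof (intro equalityI subsetI)
    fix f assume f: "f \<in> Dom"
    then have "f \<in> L2 mu" by (simp add: Dom_def)
    then show "f \<in> {f \<in> L2 mu. \<exists>l. ((\<lambda>t. apx t f f) \<longlongrightarrow> l) (at_right 0)}" using apx_lim[OF f] by blast
  next
    fix f assume "f \<in> {f \<in> L2 mu. \<exists>l. ((\<lambda>t. apx t f f) \<longlongrightarrow> l) (at_right 0)}"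
    then show "f \<in> Dom" using apx_lim_Dom by blast
  qed
  moreover have "((\<lambda>t. apx t f g) \<longlongrightarrow> Ef f g) (at_right 0)" if f: "f \<in> Dom" and g: "g \<in> Dom" for f g
  proof -
    have "((\<lambda>t. polar (\<lambda>f. apx t f f) f g) \<longlongrightarrow> polar q f g) (at_right 0)"
      by (intro tendsto_intros apx_lim Dom_add f g) simp
    moreover have "\<forall>\<^sub>F t in at_right 0. polar (\<lambda>f. apx t f f) f g = apx t f g"
      using eventually_at_right_less[of 0]
    proof eventually_elim
      case (elim t)
      have L: "f \<in> L2 mu" "g \<in> L2 mu" using f g by (auto simp: Dom_def)
      show ?case by (rule apx_polar[OF elim L, symmetric])
    qed
    ultimately show ?thesis unfolding E[OF f g] by (rule Lim_transform_eventually)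
  qed
  ultimately show ?thesis unfolding dirichlet_form_of_semigroup_def by blast
qed

end

section \<open>Energy of the Poisson extension\<close>

context rtree begin

lemma sum_lev_split:
  assumes "n \<le> k"
  shows "(\<Sum>z\<in>lev k. g z) = (\<Sum>v\<in>lev n. \<Sum>z\<in>lev k \<inter> T v. (g z :: 'b::comm_monoid_add))"
proof -
  have "lev k = (\<Union>v\<in>lev n. lev k \<inter> T v)" using T_ex assms by (fastforce simp: lev_def)
  moreover have "(\<Sum>z\<in>(\<Union>v\<in>lev n. lev k \<inter> T v). g z) = (\<Sum>v\<in>lev n. \<Sum>z\<in>lev k \<inter> T v. g z)"
  proof (rule sum.UNION_disjoint)
    show "\<forall>i\<in>lev n. \<forall>j\<in>lev n. i \<noteq> j \<longrightarrow> lev k \<inter> T i \<inter> (lev k \<inter> T j) = {}"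
    proof (intro ballI impI)
      fix i j assume "i \<in> lev n" "j \<in> lev n" "i \<noteq> j"
      then have "w \<in> T i \<Longrightarrow> w \<in> T j \<Longrightarrow> False" for w using T_same_depth[of w i j] by (auto simp: lev_def)
      then show "lev k \<inter> T i \<inter> (lev k \<inter> T j) = {}" by blast
    qed
  qed auto
  ultimately show ?thesis by simp
qed

text \<open>Reconciles the unordered sum in the tree form with the series over levels: the finite
  unions of levels eventually contain every finite set of vertices other than the root.\<close>

lemma nonroot_sum:
  fixes g :: "'v \<Rightarrow> real"
  assumes g: "\<And>v. 0 \<le> g v"
  shows "g summable_on - {rt} \<longleftrightarrow> summable (\<lambda>k. \<Sum>v\<in>lev (Suc k). g v)"
    and "g summable_on - {rt} \<Longrightarrow> (\<lambda>k. \<Sum>v\<in>lev (Suc k). g v) sums (\<Sum>\<^sub>\<infinity>v\<in>- {rt}. g v)"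
proof -
  define L where "L n = (\<Union>k<n. lev (Suc k))" for n
  have Lsum: "sum g (L n) = (\<Sum>k<n. \<Sum>v\<in>lev (Suc k). g v)" for n
  proof -
    have "\<forall>i\<in>{..<n}. \<forall>j\<in>{..<n}. i \<noteq> j \<longrightarrow> lev (Suc i) \<inter> lev (Suc j) = {}" by (auto simp: lev_def)
    then show ?thesis unfolding L_def by (intro sum.UNION_disjoint) auto
  qed
  have Lsub: "L n \<subseteq> - {rt}" "finite (L n)" for n
    using finite_lev by (auto simp: L_def) (auto simp: lev_def)
  have cover: "\<exists>n. F \<subseteq> L n" if F: "finite F" "F \<subseteq> - {rt}" for F
  proof
    show "F \<subseteq> L (Max (depth ` F))"
    proof
      fix v assume v: "v \<in> F"
      then have "depth v \<le> Max (depth ` F)" using F by simp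
      moreover obtain k where k: "depth v = Suc k" using v F(2) by (cases "depth v") auto
      ultimately have "k < Max (depth ` F)" by simp
      then show "v \<in> L (Max (depth ` F))" using k by (auto simp: L_def lev_def)
    qed
  qed
  have L_mono: "m \<le> n \<Longrightarrow> L m \<subseteq> L n" for m n by (force simp: L_def)
  have lim: "filterlim L (finite_subsets_at_top (- {rt})) sequentially"
    unfolding filterlim_finite_subsets_at_top
  proof (intro allI impI)
    fix X assume X: "finite X \<and> X \<subseteq> - {rt}"
    then obtain n where n: "X \<subseteq> L n" using cover by blast
    show "\<forall>\<^sub>F y in sequentially. finite (L y) \<and> X \<subseteq> L y \<and> L y \<subseteq> - {rt}"
      using eventually_ge_at_top[of n]
    proof eventually_elim
      case (elim y)
      then show ?case using n L_mono[of n y] Lsub[of y] by blast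
    qed
  qed
  show sums: "(\<lambda>k. \<Sum>v\<in>lev (Suc k). g v) sums (\<Sum>\<^sub>\<infinity>v\<in>- {rt}. g v)" if "g summable_on - {rt}"
  proof -
    have "(g has_sum (\<Sum>\<^sub>\<infinity>v\<in>- {rt}. g v)) (- {rt})" using that by simp
    then have "((\<lambda>F. sum g F) \<longlongrightarrow> (\<Sum>\<^sub>\<infinity>v\<in>- {rt}. g v)) (finite_subsets_at_top (- {rt}))" by (simp add: has_sum_def)
    then have "(\<lambda>n. sum g (L n)) \<longlonglongrightarrow> (\<Sum>\<^sub>\<infinity>v\<in>- {rt}. g v)" by (rule filterlim_compose[OF _ lim])
    then show ?thesis unfolding Lsum sums_def .
  qed
  show "g summable_on - {rt} \<longleftrightarrow> summable (\<lambda>k. \<Sum>v\<in>lev (Suc k). g v)"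
  proof
    assume "g summable_on - {rt}" then show "summable (\<lambda>k. \<Sum>v\<in>lev (Suc k). g v)" using sums by (auto simp: sums_iff)
  next
    assume s: "summable (\<lambda>k. \<Sum>v\<in>lev (Suc k). g v)"
    show "g summable_on - {rt}"
    proof (rule nonneg_bdd_above_summable_on)
      show "bdd_above (sum g ` {F. F \<subseteq> - {rt} \<and> finite F})"
      proof (rule bdd_aboveI2)
        fix F assume "F \<in> {F. F \<subseteq> - {rt} \<and> finite F}"
        then obtain n where n: "F \<subseteq> L n" using cover by blast
        have "sum g F \<le> sum g (L n)" by (rule sum_mono2) (use n Lsub g in auto)
        also have "\<dots> \<le> (\<Sum>k. \<Sum>v\<in>lev (Suc k). g v)"
          unfolding Lsum using g by (intro sum_le_suminf s) (auto intro: sum_nonneg)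
        finally show "sum g F \<le> (\<Sum>k. \<Sum>v\<in>lev (Suc k). g v)" .
      qed
    qed (rule g)
  qed
qed

end

text \<open>The conductances enter only through \<open>a_mb\<close>: \<mu> is the unit current
  driven by the potential \<phi>.\<close>

locale network = boundary adj rt ph mu
  for adj :: "'v \<Rightarrow> 'v \<Rightarrow> bool" and rt :: 'v and ph :: "'v \<Rightarrow> real" and mu :: "(nat \<Rightarrow> 'v) measure" +
  fixes a :: "'v \<Rightarrow> real"
  assumes a_mb: "\<And>v. v \<noteq> rt \<Longrightarrow> measure mu (ends_below adj rt v) = a v * (ph (parent adj rt v) - ph v)"
begin

lemma a_pos: "v \<noteq> rt \<Longrightarrow> 0 < a v"
  using a_mb[of v] mb_pos[of v] ph_dec[of v] by (metis diff_gt_0_iff_gt zero_less_mult_pos2)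

definition "current h v = a v * (h v - h (par v))"
definition "energy h v = a v * (h v - h (par v))\<^sup>2"
definition "residual f h v = mb v * (av f v - h v)\<^sup>2 / ph v"

text \<open>
  The recursion is the one satisfied by the Poisson integral of \<open>f\<close>. The current of \<open>h\<close> is a flow,
  and \<open>residual f h v\<close> is the least energy of a flow of the same strength below \<open>v\<close>, so the
  residuals are controlled by the tails of the energy of \<open>h\<close> (Thomson's principle).
\<close>

context
  fixes f :: "(nat \<Rightarrow> 'v) \<Rightarrow> real" and h :: "'v \<Rightarrow> real"
  assumes f: "integrable mu f" and h_rt: "h rt = av f rt"
    and h_rec: "\<And>v. v \<noteq> rt \<Longrightarrow> h v = ph v / ph (par v) * h (par v) + (1 - ph v / ph (par v)) * av f v"
begin

abbreviation "cur \<equiv> current h"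
abbreviation "nrg \<equiv> energy h"
abbreviation "R \<equiv> residual f h"

section \<open>Ohm's and Kirchhoff's laws\<close>

text \<open>Ohm's law: \<open>ph v / mb v\<close> acts as the resistance from \<open>v\<close> to
  the boundary below it, and \<open>ph (par v) / mb v\<close> as the same with the edge above
  \<open>v\<close> connected in series.\<close>

lemma cur_down: "v \<noteq> rt \<Longrightarrow> mb v * (av f v - h v) = ph v * cur v"
  and cur_up: "v \<noteq> rt \<Longrightarrow> mb v * (av f v - h (par v)) = ph (par v) * cur v"
proof -
  assume v: "v \<noteq> rt"
  note pp = ph_pos[of "par v"]
  have d: "h v - h (par v) = (ph (par v) - ph v) / ph (par v) * (av f v - h (par v))"
    unfolding h_rec[OF v] using pp by (simp add: field_simps)
  have e: "av f v - h v = ph v / ph (par v) * (av f v - h (par v))"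
    unfolding h_rec[OF v] using pp by (simp add: field_simps)
  show "mb v * (av f v - h (par v)) = ph (par v) * cur v"
    unfolding current_def a_mb[OF v] d using pp by simp
  show "mb v * (av f v - h v) = ph v * cur v"
    unfolding current_def a_mb[OF v] d e using pp by simp
qed

text \<open>Kirchhoff's law at \<open>v\<close>: \<open>cur_up\<close> for the children, added up,
  is \<open>cur_down\<close> for \<open>v\<close>, because integrals over cylinder sets are
  additive.\<close>

lemma cur_flow: "v \<noteq> rt \<Longrightarrow> (\<Sum>z\<in>ch v. cur z) = cur v"
proof -
  assume v: "v \<noteq> rt"
  have "ph v * (\<Sum>z\<in>ch v. cur z) = (\<Sum>z\<in>ch v. mb z * (av f z - h v))"
    unfolding sum_distrib_left using cur_up by (intro sum.cong refl) (auto simp: ch_iff)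
  also have "\<dots> = (\<Sum>z\<in>ch v. A f z) - h v * (\<Sum>z\<in>ch v. mb z)"
    by (simp add: A_av sum_subtractf right_diff_distrib sum_distrib_left mult.commute)
  also have "\<dots> = mb v * (av f v - h v)"
    unfolding A_ch[OF f, symmetric] mb_ch[symmetric] by (simp add: A_av algebra_simps)
  also have "\<dots> = ph v * cur v" by (rule cur_down[OF v])
  finally show ?thesis using ph_pos[of v] by simp
qed

lemma nrg_nonneg: "v \<noteq> rt \<Longrightarrow> 0 \<le> nrg v" using a_pos[of v] by (simp add: energy_def)

lemma nrg_lev_nonneg: "v \<in> lev (Suc k) \<Longrightarrow> 0 \<le> nrg v"
  by (rule nrg_nonneg) (auto simp: lev_def)

lemma R_nonneg: "0 \<le> R v" using ph_pos[of v] by (simp add: residual_def)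

text \<open>In the series connection of an edge with the tree below it, the dissipated power splits
  accordingly.\<close>

lemma node_split:
  assumes z: "z \<noteq> rt"
  shows "mb z * (av f z - h (par z))\<^sup>2 / ph (par z) = nrg z + R z"
proof -
  note pp = ph_pos[of "par z"] ph_pos[of z]
  define s where "s = av f z - h (par z)"
  have d: "h z - h (par z) = (ph (par z) - ph z) / ph (par z) * s"
    unfolding h_rec[OF z] s_def using pp by (simp add: field_simps)
  have e: "av f z - h z = ph z / ph (par z) * s"
    unfolding h_rec[OF z] s_def using pp by (simp add: field_simps)
  show ?thesis
    unfolding energy_def residual_def d e a_mb[OF z] s_def[symmetric] using pp
    by (simp add: power_mult_distrib power_divide power2_eq_square field_simps)
qed

text \<open>At each vertex of level \<open>n\<close>, \<open>node_split\<close> over the children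
  meets \<open>chvar_split\<close> centred at \<open>h u\<close>; the residual there is traded for
  edge energies and residuals one level down. The induction starts with residual 0, as
  \<open>h\<close> is the average at the root.\<close>

lemma S2_partial: "(\<Sum>k<n. \<Sum>u\<in>lev k. iph u * chvar f u) = (\<Sum>k<n. \<Sum>z\<in>lev (Suc k). nrg z) + (\<Sum>v\<in>lev n. R v)"
proof (induction n)
  case 0 then show ?case by (simp add: lev_0 residual_def h_rt)
next
  case (Suc n)
  have "(\<Sum>z\<in>ch u. nrg z + R z) = iph u * chvar f u + R u" for u
  proof -
    have "(\<Sum>z\<in>ch u. nrg z + R z) = (\<Sum>z\<in>ch u. mb z * (av f z - h u)\<^sup>2 / ph u)"
      using node_split by (intro sum.cong refl) (auto simp: ch_iff)
    also have "\<dots> = (chvar f u + mb u * (av f u - h u)\<^sup>2) / ph u"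
      unfolding chvar_split[OF f, symmetric] by (simp add: sum_divide_distrib)
    finally show ?thesis by (simp add: iph_def residual_def add_divide_distrib)
  qed
  then have "(\<Sum>z\<in>lev (Suc n). nrg z) + (\<Sum>z\<in>lev (Suc n). R z) = (\<Sum>u\<in>lev n. iph u * chvar f u) + (\<Sum>u\<in>lev n. R u)"
    by (simp add: sum.distrib[symmetric] sum_lev_Suc)
  then show ?case using Suc by simp
qed

section \<open>Thomson's principle and the vanishing of the residuals\<close>

lemma flow_pairing:
  assumes v: "v \<noteq> rt" and N: "depth v \<le> N"
  shows "(\<Sum>k\<in>{depth v..<N}. \<Sum>z\<in>lev (Suc k) \<inter> T v. cur z * (psi (par z) - psi z))
    = cur v * psi v - (\<Sum>w\<in>lev N \<inter> T v. cur w * (psi w :: real))"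
  using N
proof (induction N rule: dec_induct)
  case base
  have "lev (depth v) \<inter> T v = {v}" using T_depth[of _ v] by (fastforce simp: lev_def)
  then show ?case by simp
next
  case (step N)
  have "(\<Sum>z\<in>lev (Suc N) \<inter> T v. cur z * psi (par z)) = (\<Sum>w\<in>lev N \<inter> T v. \<Sum>z\<in>ch w. cur z * psi w)"
    unfolding sum_lev_T_Suc[OF step(1)] by (intro sum.cong refl) (auto simp: ch_iff)
  also have "\<dots> = (\<Sum>w\<in>lev N \<inter> T v. cur w * psi w)"
  proof (intro sum.cong refl)
    fix w assume "w \<in> lev N \<inter> T v"
    then have "w \<noteq> rt" using v by (auto simp: T_rt)
    then show "(\<Sum>z\<in>ch w. cur z * psi w) = cur w * psi w" by (simp add: sum_distrib_right[symmetric] cur_flow)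
  qed
  finally show ?case using step by (simp add: right_diff_distrib sum_subtractf)
qed

text \<open>The masses \<open>mb\<close> form a flow too, so summation by parts applies again. As
  \<open>mb z = a z * (ph (par z) - ph z)\<close>, the left side is the energy of \<phi> in
  \<open>T v\<close> down to level \<open>N\<close>, hence at most
  \<open>mb v * ph v\<close>.\<close>

lemma phi_energy:
  assumes v: "v \<noteq> rt" and N: "depth v \<le> N"
  shows "(\<Sum>k\<in>{depth v..<N}. \<Sum>z\<in>lev (Suc k) \<inter> T v. mb z * (ph (par z) - ph z))
    = mb v * ph v - (\<Sum>w\<in>lev N \<inter> T v. mb w * ph w)"
  using N
proof (induction N rule: dec_induct)
  case base
  have "lev (depth v) \<inter> T v = {v}" using T_depth[of _ v] by (fastforce simp: lev_def)
  then show ?case by simp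
next
  case (step N)
  have "(\<Sum>z\<in>lev (Suc N) \<inter> T v. mb z * ph (par z)) = (\<Sum>w\<in>lev N \<inter> T v. \<Sum>z\<in>ch w. mb z * ph w)"
    unfolding sum_lev_T_Suc[OF step(1)] by (intro sum.cong refl) (auto simp: ch_iff)
  also have "\<dots> = (\<Sum>w\<in>lev N \<inter> T v. mb w * ph w)"
    by (simp add: sum_distrib_right[symmetric] mb_ch[symmetric])
  finally show ?case using step by (simp add: right_diff_distrib sum_subtractf)
qed

text \<open>Testing the flow against \<open>\<psi> = (\<phi> - \<phi>(v)/2)\<^sup>+\<close>, which has finite support.\<close>

lemma thomson:
  assumes v: "v \<noteq> rt"
  shows "\<forall>\<^sub>F N in sequentially. R v \<le> 4 * (\<Sum>k\<in>{depth v..<N}. \<Sum>z\<in>lev (Suc k) \<inter> T v. nrg z)"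
proof -
  have "finite {w. \<not> ph w < ph v / 2}"
    using order_tendstoD(2)[OF ph_lim, of "ph v / 2"] ph_pos[of v] by (simp add: eventually_cofinite)
  then obtain N0 where N0: "\<And>w. \<not> ph w < ph v / 2 \<Longrightarrow> depth w \<le> N0"
    by (metis (mono_tags) finite_imageI finite_nat_set_iff_bounded_le imageI mem_Collect_eq)
  have "R v \<le> 4 * (\<Sum>k\<in>{depth v..<N}. \<Sum>z\<in>lev (Suc k) \<inter> T v. nrg z)" if N: "N > N0" "N \<ge> depth v" for N
  proof -
    \<comment> \<open>Any cut strictly between 0 and \<open>ph v\<close> would serve. Half of
      \<open>ph v\<close> leaves \<open>psi v = ph v / 2\<close>, and squaring this half produces
      the factor 4.\<close>
    define psi where "psi w = max 0 (ph w - ph v / 2)" for w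
    define I where "I = Sigma {depth v..<N} (\<lambda>k. lev (Suc k) \<inter> T v)"
    have Isum: "(\<Sum>k\<in>{depth v..<N}. \<Sum>z\<in>lev (Suc k) \<inter> T v. g z) = (\<Sum>i\<in>I. g (snd i))" for g :: "'v \<Rightarrow> real"
      unfolding I_def by (subst sum.Sigma) (auto simp: case_prod_beta)
    have Inr: "snd i \<noteq> rt" if "i \<in> I" for i using that v by (auto simp: I_def T_rt)
    \<comment> \<open>Level \<open>N\<close> lies below all vertices where \<phi> reaches the cut,
      so the boundary term of the summation by parts disappears.\<close>
    have "(\<Sum>w\<in>lev N \<inter> T v. cur w * psi w) = 0"
    proof (rule sum.neutral, rule ballI)
      fix w assume "w \<in> lev N \<inter> T v"
      then have "ph w < ph v / 2" using N0[of w] N by (auto simp: lev_def)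
      then show "cur w * psi w = 0" by (simp add: psi_def)
    qed
    from this have e: "(\<Sum>i\<in>I. cur (snd i) * (psi (par (snd i)) - psi (snd i))) = cur v * (ph v / 2)"
    proof -
      have "psi v = ph v / 2" using ph_pos[of v] by (simp add: psi_def)
      moreover assume "(\<Sum>w\<in>lev N \<inter> T v. cur w * psi w) = 0"
      ultimately show ?thesis using flow_pairing[OF v N(2), of psi] unfolding Isum by simp
    qed
    \<comment> \<open>The conductance is shared out by square roots, so that the two Cauchy-Schwarz
      factors are the energies of \<open>h\<close> and of \<open>psi\<close>.\<close>
    let ?s = "\<lambda>i. sqrt (a (snd i)) * (h (snd i) - h (par (snd i)))"
    let ?t = "\<lambda>i. sqrt (a (snd i)) * (psi (par (snd i)) - psi (snd i))"
    have "(cur v * (ph v / 2))\<^sup>2 = (\<Sum>i\<in>I. ?s i * ?t i)\<^sup>2"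
      unfolding e[symmetric]
    proof (intro arg_cong[where f="\<lambda>x. x\<^sup>2"] sum.cong refl)
      fix i assume "i \<in> I"
      then have aa: "sqrt (a (snd i)) * sqrt (a (snd i)) = a (snd i)" using a_pos[OF Inr, of i] by simp
      have "?s i * ?t i = (sqrt (a (snd i)) * sqrt (a (snd i))) * ((h (snd i) - h (par (snd i))) * (psi (par (snd i)) - psi (snd i)))"
        by (simp only: mult_ac)
      then have "?s i * ?t i = a (snd i) * ((h (snd i) - h (par (snd i))) * (psi (par (snd i)) - psi (snd i)))"
        unfolding aa .
      then show "cur (snd i) * (psi (par (snd i)) - psi (snd i)) = ?s i * ?t i"
        unfolding current_def mult.assoc by (rule sym)
    qed
    also have "\<dots> \<le> (\<Sum>i\<in>I. (?s i)\<^sup>2) * (\<Sum>i\<in>I. (?t i)\<^sup>2)" by (rule Cauchy_Schwarz_ineq_sum)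
    also have "(\<Sum>i\<in>I. (?s i)\<^sup>2) = (\<Sum>i\<in>I. nrg (snd i))"
      using Inr a_pos by (intro sum.cong refl) (simp add: energy_def power_mult_distrib less_imp_le)
    also have "(\<Sum>i\<in>I. (?t i)\<^sup>2) \<le> (\<Sum>i\<in>I. mb (snd i) * (ph (par (snd i)) - ph (snd i)))"
    proof (rule sum_mono)
      fix i assume "i \<in> I"
      then have nr: "snd i \<noteq> rt" by (rule Inr)
      let ?d = "ph (par (snd i)) - ph (snd i)"
      have "0 \<le> psi (par (snd i)) - psi (snd i)" "psi (par (snd i)) - psi (snd i) \<le> ?d"
        using ph_dec[OF nr] by (auto simp: psi_def)
      then have "(psi (par (snd i)) - psi (snd i))\<^sup>2 \<le> ?d\<^sup>2" by (intro power_mono) auto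
      then have "a (snd i) * (psi (par (snd i)) - psi (snd i))\<^sup>2 \<le> a (snd i) * ?d\<^sup>2"
        using a_pos[OF nr] by simp
      moreover have "(?t i)\<^sup>2 = a (snd i) * (psi (par (snd i)) - psi (snd i))\<^sup>2"
        using a_pos[OF nr] by (simp add: power_mult_distrib)
      moreover have "mb (snd i) * ?d = a (snd i) * ?d\<^sup>2"
        unfolding a_mb[OF nr] by (simp only: power2_eq_square mult.assoc)
      ultimately show "(?t i)\<^sup>2 \<le> mb (snd i) * ?d" by simp
    qed
    also have "\<dots> \<le> mb v * ph v"
      using phi_energy[OF v N(2)] ph_pos unfolding Isum by (simp add: sum_nonneg less_imp_le)
    finally have cs: "(cur v * (ph v / 2))\<^sup>2 \<le> (\<Sum>i\<in>I. nrg (snd i)) * (mb v * ph v)"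
      using Inr nrg_nonneg by (simp add: mult_left_mono sum_nonneg)
    have "R v * (mb v * ph v) = (ph v * cur v)\<^sup>2"
      unfolding residual_def cur_down[OF v, symmetric] using ph_pos[of v] by (simp add: power2_eq_square)
    also have "\<dots> = 4 * (cur v * (ph v / 2))\<^sup>2" by (simp add: power2_eq_square)
    also have "\<dots> \<le> 4 * (\<Sum>i\<in>I. nrg (snd i)) * (mb v * ph v)" using cs by simp
    finally have "R v \<le> 4 * (\<Sum>i\<in>I. nrg (snd i))"
      by (rule mult_right_le_imp_le) (use ph_pos mb_pos in simp)
    then show ?thesis unfolding Isum .
  qed
  then show ?thesis unfolding eventually_sequentially by (intro exI[of _ "Suc (max N0 (depth v))"]) auto
qed

text \<open>The subtrees below the vertices of level \<open>n\<close> are disjoint, so adding up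
  Thomson's bound gives four times the tail of the energy beyond level \<open>n\<close>. Finiteness
  of the level provides one \<open>N\<close> valid for all its vertices.\<close>

lemma R_tail:
  assumes s: "summable (\<lambda>k. \<Sum>z\<in>lev (Suc k). nrg z)"
  shows "(\<lambda>n. \<Sum>v\<in>lev n. R v) \<longlonglongrightarrow> 0"
proof -
  let ?t = "\<lambda>k. \<Sum>z\<in>lev (Suc k). nrg z"
  have t0: "0 \<le> ?t k" for k using nrg_lev_nonneg by (rule sum_nonneg)
  have bd: "(\<Sum>v\<in>lev n. R v) \<le> 4 * (\<Sum>k. ?t (k + n))" if n: "0 < n" for n
  proof -
    have nr: "v \<noteq> rt" if "v \<in> lev n" for v using that n by (auto simp: lev_def)
    have "\<forall>\<^sub>F N in sequentially. \<forall>v\<in>lev n. R v \<le> 4 * (\<Sum>k\<in>{depth v..<N}. \<Sum>z\<in>lev (Suc k) \<inter> T v. nrg z)"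
      by (rule eventually_ball_finite) (use thomson nr in auto)
    then obtain N where N: "\<And>v. v \<in> lev n \<Longrightarrow> R v \<le> 4 * (\<Sum>k\<in>{depth v..<N}. \<Sum>z\<in>lev (Suc k) \<inter> T v. nrg z)"
      using eventually_happens'[OF sequentially_bot] by blast
    have "(\<Sum>v\<in>lev n. R v) \<le> (\<Sum>v\<in>lev n. 4 * (\<Sum>k\<in>{n..<N}. \<Sum>z\<in>lev (Suc k) \<inter> T v. nrg z))"
      using N by (intro sum_mono) (auto simp: lev_def)
    also have "\<dots> = 4 * (\<Sum>k\<in>{n..<N}. \<Sum>v\<in>lev n. \<Sum>z\<in>lev (Suc k) \<inter> T v. nrg z)"
      unfolding sum_distrib_left[symmetric] by (subst sum.swap) simp
    also have "(\<Sum>k\<in>{n..<N}. \<Sum>v\<in>lev n. \<Sum>z\<in>lev (Suc k) \<inter> T v. nrg z) = (\<Sum>k\<in>{n..<N}. ?t k)"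
      by (intro sum.cong refl sum_lev_split[symmetric]) auto
    also have "\<dots> = (\<Sum>k<N - n. ?t (k + n))"
      by (rule sum.reindex_bij_witness[of _ "\<lambda>k. k + n" "\<lambda>k. k - n"]) auto
    also have "\<dots> \<le> (\<Sum>k. ?t (k + n))"
      by (rule sum_le_suminf[OF summable_ignore_initial_segment[OF s]]) (use t0 in auto)
    finally show ?thesis by simp
  qed
  have "(\<lambda>n. \<Sum>k. ?t (k + n)) \<longlonglongrightarrow> 0" using suminf_exist_split2[OF s] .
  then have "(\<lambda>n. 4 * (\<Sum>k. ?t (k + n))) \<longlonglongrightarrow> 0" by (rule tendsto_mult_right_zero)
  then show ?thesis
  proof (rule tendsto_sandwich[OF _ _ tendsto_const, rotated 2])
    show "\<forall>\<^sub>F n in sequentially. (\<Sum>v\<in>lev n. R v) \<le> 4 * (\<Sum>k. ?t (k + n))"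
      using eventually_gt_at_top[of 0] by eventually_elim (rule bd)
  qed (simp add: R_nonneg sum_nonneg)
qed

text \<open>Finite energy makes the residuals vanish, so both series have the same sum. Conversely,
  residuals are nonnegative, so partial energies are at most the partial sums of
  \<open>S2 f\<close>.\<close>

lemma nrg_iff:
  "summable (\<lambda>k. \<Sum>z\<in>lev (Suc k). nrg z) \<longleftrightarrow> S2 f < \<infinity>"
  "S2 f < \<infinity> \<Longrightarrow> (\<lambda>k. \<Sum>z\<in>lev (Suc k). nrg z) sums q f"
proof -
  let ?t = "\<lambda>k. \<Sum>z\<in>lev (Suc k). nrg z" and ?c = "\<lambda>k. \<Sum>u\<in>lev k. iph u * chvar f u"
  have t0: "0 \<le> ?t k" for k using nrg_lev_nonneg by (rule sum_nonneg)
  have b0: "0 \<le> iph u * chvar f u" for u using iph_pos[of u] chvar_nonneg[of f u] by simp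
  then have c0: "0 \<le> ?c k" for k by (intro sum_nonneg)
  have S: "S2 f = (\<Sum>k. ennreal (?c k))"
    unfolding S2_def vsum_def using b0 by (simp add: sum_ennreal)
  have fwd: "?c sums suminf ?t" if s: "summable ?t"
  proof -
    have "(\<lambda>n. (\<Sum>k<n. ?t k) + (\<Sum>v\<in>lev n. R v)) \<longlonglongrightarrow> suminf ?t + 0"
      by (intro tendsto_add R_tail s summable_LIMSEQ)
    then show ?thesis unfolding sums_def S2_partial by simp
  qed
  have bwd: "summable ?t" if fin: "S2 f < \<infinity>"
  proof -
    have "summable ?c" by (rule summable_suminf_not_top[OF c0]) (use fin S in auto)
    show ?thesis
    proof (rule summableI_nonneg_bounded[OF t0])
      fix n
      have "(\<Sum>k<n. ?t k) \<le> (\<Sum>k<n. ?c k)" unfolding S2_partial using R_nonneg by (simp add: sum_nonneg)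
      also have "\<dots> \<le> suminf ?c" using \<open>summable ?c\<close> c0 by (intro sum_le_suminf) auto
      finally show "(\<Sum>k<n. ?t k) \<le> suminf ?c" .
    qed
  qed
  have fwd': "S2 f = ennreal (suminf ?t)" if s: "summable ?t"
    unfolding S by (rule suminf_ennreal_eq[OF c0 fwd[OF s]])
  show "summable ?t \<longleftrightarrow> S2 f < \<infinity>" using bwd fwd' by auto
  show "?t sums q f" if "S2 f < \<infinity>"
    using bwd[OF that] fwd'[OF bwd[OF that]] t0 by (simp add: q_def suminf_nonneg sums_iff)
qed

end

end

section \<open>The boundary process\<close>

context limit_walk begin

abbreviation "cond v \<equiv> mm v * p v (par v)"

lemma network: "(ph \<longlongrightarrow> 0) cofinite \<Longrightarrow> network adj rt ph mu cond"
  by (intro network.intro network_axioms.intro boundary.intro boundary_axioms.intro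
      rtree_axioms ph_pos ph_dec prob_nu sets_nu mb_pos nu_rt_B)

lemma integrable_nu: "integrable mu f \<Longrightarrow> integrable (nu v) (f :: _ \<Rightarrow> real)"
proof -
  assume f: "integrable mu f"
  obtain D C where D [measurable]: "D \<in> borel_measurable (ends_borel adj rt)" and D0: "\<And>x. 0 \<le> D x" and DC: "\<And>x. D x \<le> C"
    and nuD: "nu v = density mu (\<lambda>x. ennreal (D x))" using nu_density by blast
  have fm [measurable]: "f \<in> borel_measurable (ends_borel adj rt)"
    using borel_measurable_integrable[OF f] by (simp cong: measurable_cong_sets)
  have "integrable mu (\<lambda>x. D x * f x)"
  proof (rule Bochner_Integration.integrable_bound[of _ "\<lambda>x. C * f x"])
    have "\<bar>D x\<bar> \<le> \<bar>C\<bar>" for x using D0[of x] DC[of x] by auto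
    then show "AE x in mu. norm (D x * f x) \<le> norm (C * f x)" by (auto simp: abs_mult intro!: mult_right_mono)
  qed (use f in auto)
  then show ?thesis unfolding nuD using D0 by (subst integrable_density) auto
qed

lemma poisson_add:
  "integrable mu f \<Longrightarrow> integrable mu g \<Longrightarrow> poisson nu (\<lambda>x. f x + g x) v = poisson nu f v + poisson nu g v"
  unfolding poisson_def by (rule Bochner_Integration.integral_add[OF integrable_nu integrable_nu])

context
  assumes lim: "(ph \<longlongrightarrow> 0) cofinite"
begin

interpretation N: network adj rt ph mu cond by (rule network[OF lim])

lemma poisson_energy:
  assumes f: "integrable mu f"
  shows "finite_energy adj rt p (poisson nu f) \<longleftrightarrow> N.S2 f < \<infinity>"
    and "N.S2 f < \<infinity> \<Longrightarrow> HD_form adj rt p nu f f = N.q f"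
proof -
  let ?h = "poisson nu f"
  have h_rt: "?h rt = N.av f rt" by (simp add: poisson_def N.av_def N.A_rt)
  have h_rec: "?h v = ph v / ph (par v) * ?h (par v) + (1 - ph v / ph (par v)) * N.av f v" if v: "v \<noteq> rt" for v
  proof -
    have "F v = ph v / ph (par v)" using ph_rec[OF v] ph_pos[of "par v"] by (simp add: field_simps)
    moreover have "(LINT x:B v|mu. f x) / mb v = N.av f v"
      by (simp add: N.av_def N.A_def set_lebesgue_integral_def)
    ultimately show ?thesis using poisson_rec[OF v f] by simp
  qed
  have ed: "energy_density adj rt p ?h ?h = N.energy ?h"
    unfolding fun_eq_iff N.energy_def energy_density_def by (simp add: mm_def power2_eq_square)
  \<comment> \<open>Needed at the root as well, where the parent is meaningless; the coefficient is
    nonnegative there too.\<close>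
  have nn: "0 \<le> N.energy ?h v" for v
    using mm_pos[of v] by (simp add: N.energy_def)
  have iff: "summable (\<lambda>k. \<Sum>z\<in>lev (Suc k). N.energy ?h z) \<longleftrightarrow> N.S2 f < \<infinity>"
    by (rule N.nrg_iff(1)[OF f h_rt h_rec])
  show "finite_energy adj rt p ?h \<longleftrightarrow> N.S2 f < \<infinity>"
    unfolding finite_energy_def ed nonroot_sum(1)[of "N.energy ?h", OF nn] by (rule iff)
  assume fin: "N.S2 f < \<infinity>"
  then have "N.energy ?h summable_on - {rt}" unfolding nonroot_sum(1)[of "N.energy ?h", OF nn] using iff by blast
  note nonroot_sum(2)[OF nn this]
  moreover have "(\<lambda>k. \<Sum>z\<in>lev (Suc k). N.energy ?h z) sums N.q f"
    by (rule N.nrg_iff(2)[OF f h_rt h_rec fin])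
  ultimately show "HD_form adj rt p nu f f = N.q f"
    unfolding HD_form_def tree_form_def ed by (rule sums_unique2)
qed

text \<open>One side asks for integrability, the other for square integrability;
  \<open>N.L2_of_S2\<close> bridges the gap once \<open>S2\<close> is finite.\<close>

lemma HD_domain_eq: "HD_domain adj rt p nu = N.Dom"
  unfolding HD_domain_def N.Dom_def using poisson_energy(1) N.L2_of_S2 N.L2_L1 by blast

text \<open>Polarisation holds edge by edge, so summability of the mixed energy density follows from
  that of the three pure ones.\<close>

lemma HD_polar:
  assumes f: "f \<in> N.Dom" and g: "g \<in> N.Dom"
  shows "HD_form adj rt p nu f g = N.polar N.q f g"
proof -
  let ?h = "\<lambda>x. f x + g x"
  have dom: "integrable mu k" "N.S2 k < \<infinity>" if "k \<in> N.Dom" for k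
    using that N.L2_L1 by (auto simp: N.Dom_def)
  have hs: "(energy_density adj rt p (poisson nu k) (poisson nu k) has_sum N.q k) (- {rt})" if "k \<in> N.Dom" for k
    using poisson_energy[OF dom(1)[OF that]] dom(2)[OF that]
    unfolding finite_energy_def HD_form_def tree_form_def by (metis has_sum_infsum)
  let ?e = "\<lambda>k v. energy_density adj rt p (poisson nu k) (poisson nu k) v"
  have "((\<lambda>v. (1 / 2) * (?e ?h v + - ?e f v + - ?e g v)) has_sum (1 / 2) * (N.q ?h + - N.q f + - N.q g)) (- {rt})"
    by (intro has_sum_cmult_right has_sum_add has_sum_uminusI hs f g N.Dom_add)
  moreover have "(1 / 2) * (?e ?h v + - ?e f v + - ?e g v) = energy_density adj rt p (poisson nu f) (poisson nu g) v" for v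
    unfolding energy_density_def poisson_add[OF dom(1)[OF f] dom(1)[OF g]] by (simp add: field_simps)
  ultimately show ?thesis unfolding HD_form_def tree_form_def by (simp add: infsumI)
qed

lemma boundary_process:
  "ultrametric_element adj rt ph \<and>
   HD_domain adj rt p nu = standard_domain adj rt ph mu \<and>
   (\<forall>f\<in>HD_domain adj rt p nu. \<forall>g\<in>HD_domain adj rt p nu. HD_form adj rt p nu f g = standard_form adj rt ph mu f g) \<and>
   dirichlet_form_of_semigroup mu (standard_semigroup adj rt ph mu) (HD_domain adj rt p nu) (HD_form adj rt p nu)"
proof (intro conjI ballI)
  show "ultrametric_element adj rt ph" by (rule N.ultrametric_ph)
  show "HD_domain adj rt p nu = standard_domain adj rt ph mu"
    unfolding HD_domain_eq N.standard_domain_eq ..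
  show "HD_form adj rt p nu f g = standard_form adj rt ph mu f g"
    if "f \<in> HD_domain adj rt p nu" "g \<in> HD_domain adj rt p nu" for f g
    using that HD_polar[of f g] N.standard_form_polar[of f g] unfolding HD_domain_eq by metis
  show "dirichlet_form_of_semigroup mu (standard_semigroup adj rt ph mu) (HD_domain adj rt p nu) (HD_form adj rt p nu)"
    unfolding HD_domain_eq by (rule N.dirichlet_polar[OF HD_polar])
qed

end

end

theorem theorem7p1:
  fixes adj :: "'v \<Rightarrow> 'v \<Rightarrow> bool"
    and rt :: 'v
    and p :: "'v \<Rightarrow> 'v \<Rightarrow> real"
    and M :: "'v \<Rightarrow> 'w measure"
    and Z :: "nat \<Rightarrow> 'w \<Rightarrow> 'v"
  assumes "is_tree adj"
    and "\<forall>u. finite (forward_neighbours adj rt u) \<and> 2 \<le> card (forward_neighbours adj rt u)"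
    and "nn_transition_matrix adj p"
    and "markov_chain p M Z"
    and "transient p"
    and "\<forall>v. v \<noteq> rt \<longrightarrow> hit_prob M Z v (parent adj rt v) < 1"
    and "((\<lambda>v. green p v rt) \<longlongrightarrow> 0) cofinite"
  shows "let \<nu> = limit_distr adj rt M Z;
             \<phi> = (\<lambda>v. green p v rt)
         in ultrametric_element adj rt \<phi> \<and>
            HD_domain adj rt p \<nu> = standard_domain adj rt \<phi> (\<nu> rt) \<and>
            (\<forall>f\<in>HD_domain adj rt p \<nu>. \<forall>g\<in>HD_domain adj rt p \<nu>.
               HD_form adj rt p \<nu> f g = standard_form adj rt \<phi> (\<nu> rt) f g) \<and>
            dirichlet_form_of_semigroup (\<nu> rt) (standard_semigroup adj rt \<phi> (\<nu> rt))
              (HD_domain adj rt p \<nu>) (HD_form adj rt p \<nu>)"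
proof -
  interpret W: limit_walk adj rt p M Z
    by unfold_locales (use assms in auto)
  have ph: "W.ph = (\<lambda>v. green p v rt)" by (rule ext) (simp add: W.ph_def)
  have nu: "W.nu = limit_distr adj rt M Z" by (rule ext) (simp add: W.nu_def)
  show ?thesis using W.boundary_process assms(7) unfolding Let_def ph nu by blast
qed

end
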